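(* Let $G$ be a transitive nonunimodular graph and let $p_c=p_c(G)$ be its critical probability for Bernoulli bond percolation. Then, almost surely, Bernoulli$(p_c)$ edge percolation on $G$ has no infinite light clusters.
   Context: All graphs are locally finite; transitive graphs are infinite and connected. $\mathrm{Aut}(G)$ is the automorphism group of $G$, and $S_x=\{g\in \mathrm{Aut}(G): g(x)=x\}$ is the stabilizer of a vertex $x$, so $S_xy$ is the orbit of $y$ under $S_x$. A transitive graph $G$ is unimodular if $|S_xy|=|S_yx|$ for all $x,y\in V(G)$ (equivalently, $\mathrm{Aut}(G)$ is a unimodular group); otherwise it is nonunimodular. Fix a vertex $o$; the weight of $x\in V(G)$ is $w(x)=|S_xo|/|S_ox|$ (independent of $o$ up to a constant factor; it satisfies $|S_xy|/|S_yx|=w(x)/w(y)$). In Bernoulli$(p)$ edge percolation each edge is independently kept (open) with probability $p$ and removed (closed) with probability $1-p$; clusters are the connected components of the resulting open subgraph (on all vertices). A cluster $C$ is heavy if $\sum_{x\in C}w(x)=\infty$ and light otherwise. $p_c(G)$ is the infimum of $p\in[0,1]$ such that the cluster of a fixed vertex in Bernoulli$(p)$ edge percolation is infinite with positive probability. *)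

theory Defs
  imports "HOL-Probability.Probability" "HOL-Combinatorics.Permutations"
begin

text \<open>An undirected edge is the two-element set of its endpoints.\<close>

locale simple_graph =
  fixes V :: "'a set" and E :: "'a set set"
  assumes edges: "e \<in> E \<Longrightarrow> \<exists>u\<in>V. \<exists>v\<in>V. u \<noteq> v \<and> e = {u, v}"

definition adj :: "'a set set \<Rightarrow> ('a \<times> 'a) set" where
  "adj E = {(u, v). {u, v} \<in> E}"

definition component :: "'a set set \<Rightarrow> 'a \<Rightarrow> 'a set" where
  "component E x = {y. (x, y) \<in> (adj E)\<^sup>*}"

definition locally_finite :: "'a set \<Rightarrow> 'a set set \<Rightarrow> bool" where
  "locally_finite V E \<longleftrightarrow> (\<forall>v\<in>V. finite {u. {u, v} \<in> E})"

definition connected_graph :: "'a set \<Rightarrow> 'a set set \<Rightarrow> bool" where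
  "connected_graph V E \<longleftrightarrow> (\<forall>x\<in>V. \<forall>y\<in>V. y \<in> component E x)"

text \<open>The condition \<open>g permutes V\<close> fixes \<open>g\<close> to be the identity off \<open>V\<close>, so that an
  automorphism is determined by its action on the vertices.\<close>

definition Aut :: "'a set \<Rightarrow> 'a set set \<Rightarrow> ('a \<Rightarrow> 'a) set" where
  "Aut V E = {g. g permutes V \<and> (\<forall>u\<in>V. \<forall>v\<in>V. {g u, g v} \<in> E \<longleftrightarrow> {u, v} \<in> E)}"

definition stabilizer :: "'a set \<Rightarrow> 'a set set \<Rightarrow> 'a \<Rightarrow> ('a \<Rightarrow> 'a) set" where
  "stabilizer V E x = {g \<in> Aut V E. g x = x}"

definition stab_orbit :: "'a set \<Rightarrow> 'a set set \<Rightarrow> 'a \<Rightarrow> 'a \<Rightarrow> 'a set" where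
  "stab_orbit V E x y = (\<lambda>g. g y) ` stabilizer V E x"

locale transitive_graph = simple_graph +
  assumes locally_finite: "locally_finite V E"
    and connected: "connected_graph V E"
    and infinite: "infinite V"
    and transitive: "\<lbrakk>x \<in> V; y \<in> V\<rbrakk> \<Longrightarrow> \<exists>g\<in>Aut V E. g x = y"

text \<open>In a connected locally finite graph the orbits \<open>stab_orbit V E x y\<close> are finite, since
  \<open>stabilizer V E x\<close> preserves the finite spheres around \<open>x\<close>; hence \<open>card\<close> below is the
  true cardinality.\<close>

definition unimodular :: "'a set \<Rightarrow> 'a set set \<Rightarrow> bool" where
  "unimodular V E \<longleftrightarrow>
     (\<forall>x\<in>V. \<forall>y\<in>V. card (stab_orbit V E x y) = card (stab_orbit V E y x))"

text \<open>The weight of \<open>x\<close> relative to the reference vertex \<open>a\<close>.\<close>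

definition weight :: "'a set \<Rightarrow> 'a set set \<Rightarrow> 'a \<Rightarrow> 'a \<Rightarrow> real" where
  "weight V E a x = real (card (stab_orbit V E x a)) / real (card (stab_orbit V E a x))"

definition heavy :: "'a set \<Rightarrow> 'a set set \<Rightarrow> 'a \<Rightarrow> 'a set \<Rightarrow> bool" where
  "heavy V E a C \<longleftrightarrow> (\<Sum>\<^sub>\<infinity>x\<in>C. ennreal (weight V E a x)) = \<infinity>"

abbreviation light :: "'a set \<Rightarrow> 'a set set \<Rightarrow> 'a \<Rightarrow> 'a set \<Rightarrow> bool" where
  "light V E a C \<equiv> \<not> heavy V E a C"

text \<open>A configuration assigns to each edge \<open>True\<close> (open) or \<open>False\<close> (closed).\<close>

definition bond_percolation :: "'a set set \<Rightarrow> real \<Rightarrow> ('a set \<Rightarrow> bool) measure" where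
  "bond_percolation E p = PiM E (\<lambda>_. measure_pmf (bernoulli_pmf p))"

definition open_edges :: "'a set set \<Rightarrow> ('a set \<Rightarrow> bool) \<Rightarrow> 'a set set" where
  "open_edges E \<omega> = {e \<in> E. \<omega> e}"

definition cluster :: "'a set set \<Rightarrow> ('a set \<Rightarrow> bool) \<Rightarrow> 'a \<Rightarrow> 'a set" where
  "cluster E \<omega> x = component (open_edges E \<omega>) x"

definition clusters :: "'a set \<Rightarrow> 'a set set \<Rightarrow> ('a set \<Rightarrow> bool) \<Rightarrow> 'a set set" where
  "clusters V E \<omega> = cluster E \<omega> ` V"

text \<open>The vertex \<open>x\<close> is the fixed vertex whose cluster is observed; for a connected graph the
  value does not depend on it.\<close>

definition critical_probability :: "'a set set \<Rightarrow> 'a \<Rightarrow> real" where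
  "critical_probability E x =
     Inf {p \<in> {0..1}. measure (bond_percolation E p)
            {\<omega> \<in> space (bond_percolation E p). infinite (cluster E \<omega> x)} > 0}"

end

theory Submission
  imports Defs
begin

text \<open>Let \<open>r > 1\<close> bound the ratio of the weights of neighbours, and let \<open>A\<^sub>p(c)\<close> be the probability
  that a vertex \<open>v\<close> is connected to some vertex of weight at least \<open>c w(v)\<close> by open paths staying at
  weights at least \<open>w(v)\<close>. Exploring until height \<open>c\<close> is reached shows that \<open>A\<^sub>p\<close> is
  supermultiplicative, and the mass transport principle gives \<open>c A\<^sub>p(c) \<le> \<chi>(p)\<close>, where \<open>\<chi>(p)\<close> is the
  expected cluster size. Below criticality \<open>\<chi>(p)\<close> is finite (sharpness, by the argument of
  Duminil-Copin and Tassion), so \<open>c A\<^sub>p(c) \<le> 1\<close>; by left continuity this persists at \<open>p\<^sub>c\<close>. Mass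
  transport turns it into a bound, uniform in \<open>n\<close>, on the expected number of vertices at relative
  height about \<open>r\<^sup>-\<^sup>n\<close> that the cluster of \<open>x\<close> reaches from above, on the event that the cluster has at
  most \<open>m\<close> vertices of weight more than \<open>w(x)/r\<close>. In an infinite light cluster such an \<open>m\<close> exists,
  and the number of vertices reached at height about \<open>r\<^sup>-\<^sup>n\<close> is positive for all \<open>n\<close>; it cannot stay
  bounded along a subsequence, because each time it is bounded the cluster stops with probability
  bounded below. This contradicts the bound on the expectation.\<close>

section \<open>Connectivity in sets of edges\<close>

text \<open>Finiteness of the susceptibility is used only qualitatively. Since
  \<open>(c A(c))^k \<le> c^k A(c^k) \<le> \<chi>\<close> for every \<open>k\<close>, it forces
  \<open>c A(c) \<le> 1\<close>, a bound free of constants depending on \<open>p\<close>; this is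
  why it survives the limit to the critical point, although the bound on \<open>\<chi>\<close> need
  not. The obstacle is to count vertices seen downwards. Mass transport turns this into a weighted
  count upwards, and a vertex may see arbitrarily many vertices in one band of heights. Demanding at
  most \<open>m\<close> cluster vertices at comparable or greater height caps that number by
  \<open>m\<close>; the factor \<open>c\<close> from the weights is then paid by
  \<open>A(c) \<le> 1/c\<close>. Bands have ratio \<open>r\<close> because one edge changes the
  weight by at most the factor \<open>r\<close>, so a cluster that leaves a height level cannot jump
  over the next band. Stopping a cluster requires closing boundedly many edges, which has
  probability bounded below when \<open>p\<^sub>c < 1\<close>. If \<open>p\<^sub>c = 1\<close>,
  every edge is open, and nonunimodularity shows that \<open>V\<close> itself is heavy.\<close>

lemma component_refl: "x \<in> component X x"
  by (simp add: component_def)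

lemma component_edge: "y \<in> component X x \<Longrightarrow> {y, z} \<in> X \<Longrightarrow> z \<in> component X x"
  unfolding component_def adj_def by (auto intro: rtrancl.rtrancl_into_rtrancl)

lemma component_trans: "y \<in> component X x \<Longrightarrow> z \<in> component X y \<Longrightarrow> z \<in> component X x"
  unfolding component_def by (auto intro: rtrancl_trans)

lemma component_induct [consumes 1, case_names base step]:
  assumes "y \<in> component X x" "P x"
    and "\<And>u v. u \<in> component X x \<Longrightarrow> {u, v} \<in> X \<Longrightarrow> P u \<Longrightarrow> P v"
  shows "P y"
  using assms(1) unfolding component_def mem_Collect_eq
proof (induction rule: rtrancl_induct)
  case base
  show ?case by fact
next
  case (step u v)
  then show ?case
    using assms(3)[of u v] by (auto simp: component_def adj_def)
qed

lemma component_mono: "y \<in> component X x \<Longrightarrow> X \<subseteq> Y \<Longrightarrow> y \<in> component Y x"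
  by (induction rule: component_induct) (auto intro: component_refl component_edge)

lemma component_sym: "y \<in> component X x \<Longrightarrow> x \<in> component X y"
proof (induction rule: component_induct)
  case (step u v)
  have "u \<in> component X v"
    using step(2) by (intro component_edge[OF component_refl]) (simp add: insert_commute)
  then show ?case
    using step(3) component_trans by metis
qed (rule component_refl)

lemma component_eq: "y \<in> component X x \<Longrightarrow> component X y = component X x"
  by (meson component_sym component_trans subsetI subset_antisym)

lemma component_closed:
  assumes "x \<in> C" "\<And>u v. u \<in> C \<Longrightarrow> {u, v} \<in> X \<Longrightarrow> v \<in> C"
  shows "component X x \<subseteq> C"
proof
  fix y assume "y \<in> component X x"
  then show "y \<in> C" by (induction rule: component_induct) (use assms in auto)
qed

text \<open>A cluster is recognised by the states of the edges touching it. Events that a cluster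
  equals \<open>C\<close> therefore leave all other edges independent.\<close>

lemma component_cong:
  assumes "component X x = C" "\<And>e. e \<inter> C \<noteq> {} \<Longrightarrow> e \<in> X \<longleftrightarrow> e \<in> Y"
  shows "component Y x = C"
proof (rule subset_antisym)
  have "x \<in> C" using assms(1) component_refl[of x X] by simp
  moreover have "v \<in> C" if "u \<in> C" "{u, v} \<in> Y" for u v
    using that assms(2)[of "{u, v}"] component_edge[of u X x v] assms(1) by auto
  ultimately show "component Y x \<subseteq> C" by (intro component_closed)
next
  show "C \<subseteq> component Y x"
  proof
    fix y assume "y \<in> C"
    then have "y \<in> component X x" using assms(1) by simp
    then show "y \<in> component Y x"
    proof (induction rule: component_induct)
      case base show ?case by (rule component_refl)
    next
      case (step u v)
      have "u \<in> C" using step(1) assms(1) by simp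
      then have "{u, v} \<in> Y" using assms(2)[of "{u, v}"] step(2) by auto
      with step(3) show ?case by (rule component_edge)
    qed
  qed
qed

text \<open>Cut a path at its first vertex outside \<open>W\<close>: every edge used up to there has
  an endpoint in \<open>W\<close>.\<close>

lemma component_first_exit:
  assumes "z \<in> component X x" "z \<notin> W"
  shows "\<exists>y. y \<notin> W \<and> y \<in> component {e \<in> X. e \<inter> W \<noteq> {}} x"
proof -
  let ?Y = "{e \<in> X. e \<inter> W \<noteq> {}}"
  from assms(1) have "z \<in> component ?Y x \<or> (\<exists>y. y \<notin> W \<and> y \<in> component ?Y x)"
  proof (induction rule: component_induct)
    case base show ?case by (simp add: component_refl)
  next
    case (step u v)
    then show ?case
    proof (cases "u \<in> W")
      case True
      then have "{u, v} \<in> ?Y" using step by auto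
      then show ?thesis using step(3) component_edge[of u ?Y x v] by blast
    next
      case False
      then show ?thesis using step(3) by blast
    qed
  qed
  then show ?thesis using assms(2) by blast
qed

lemma component_exit_edge:
  assumes "z \<in> component X x" "x \<in> W" "z \<notin> W"
  shows "\<exists>u\<in>W. \<exists>v. v \<notin> W \<and> {u, v} \<in> X \<and> u \<in> component X x"
proof (rule ccontr)
  assume *: "\<not> ?thesis"
  have "z \<in> W"
    using assms(1) by (induction rule: component_induct) (use assms(2) * in blast)+
  then show False using assms(3) by simp
qed

text \<open>Cut the path after its last visit to \<open>C\<close>. The rest avoids \<open>C\<close>,
  hence is independent of an exploration of \<open>C\<close>, and is strictly shorter.\<close>

lemma relpow_last_exit:
  assumes "(x, z) \<in> adj X ^^ n" "x \<in> C" "z \<notin> C"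
  shows "\<exists>u\<in>C. \<exists>v. v \<notin> C \<and> {u, v} \<in> X \<and> (\<exists>k<n. (v, z) \<in> adj {e \<in> X. e \<inter> C = {}} ^^ k)"
  using assms(1,3)
proof (induction n arbitrary: z)
  case 0
  then show ?case using assms(2) by simp
next
  case (Suc n)
  then obtain t where t: "(x, t) \<in> adj X ^^ n" "(t, z) \<in> adj X" by auto
  show ?case
  proof (cases "t \<in> C")
    case True
    then show ?thesis using t Suc.prems by (force simp: adj_def)
  next
    case False
    then obtain u v k where *: "u \<in> C" "v \<notin> C" "{u, v} \<in> X" "k < n"
        "(v, t) \<in> adj {e \<in> X. e \<inter> C = {}} ^^ k"
      using Suc.IH[OF t(1)] by blast
    have "(t, z) \<in> adj {e \<in> X. e \<inter> C = {}}"
      using t(2) False Suc.prems by (auto simp: adj_def)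
    then have "(v, z) \<in> adj {e \<in> X. e \<inter> C = {}} ^^ Suc k" using *(5) by auto
    then show ?thesis using * by (meson Suc_less_eq)
  qed
qed

lemma component_iff_relpow: "y \<in> component X x \<longleftrightarrow> (\<exists>n. (x, y) \<in> adj X ^^ n)"
  by (simp add: component_def rtrancl_power)

lemma relpow_adj_mono: "(x, y) \<in> adj X ^^ n \<Longrightarrow> X \<subseteq> Y \<Longrightarrow> (x, y) \<in> adj Y ^^ n"
proof (induction n arbitrary: y)
  case (Suc n)
  then obtain t where "(x, t) \<in> adj X ^^ n" "(t, y) \<in> adj X" by auto
  then have "(x, t) \<in> adj Y ^^ n" "(t, y) \<in> adj Y" using Suc by (auto simp: adj_def)
  then show ?case by auto
qed auto

text \<open>A path uses finitely many edges. Measurability of connections and their approximation by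
  finite edge sets rest on this.\<close>

lemma relpow_adj_finite:
  "(x, y) \<in> adj X ^^ n \<longleftrightarrow> (\<exists>F. finite F \<and> F \<subseteq> X \<and> (x, y) \<in> adj F ^^ n)"
proof
  assume "(x, y) \<in> adj X ^^ n"
  then show "\<exists>F. finite F \<and> F \<subseteq> X \<and> (x, y) \<in> adj F ^^ n"
  proof (induction n arbitrary: y)
    case 0
    then show ?case by (intro exI[of _ "{}"]) auto
  next
    case (Suc n)
    then obtain t where t: "(x, t) \<in> adj X ^^ n" "(t, y) \<in> adj X" by auto
    from Suc.IH[OF t(1)] obtain F where F: "finite F" "F \<subseteq> X" "(x, t) \<in> adj F ^^ n" by blast
    have "(x, t) \<in> adj (insert {t, y} F) ^^ n"
      using F(3) by (rule relpow_adj_mono) auto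
    moreover have "(t, y) \<in> adj (insert {t, y} F)" by (auto simp: adj_def)
    ultimately have "(x, y) \<in> adj (insert {t, y} F) ^^ Suc n" by auto
    then show ?case
      using F t(2) by (intro exI[of _ "insert {t, y} F"]) (auto simp: adj_def)
  qed
qed (auto intro: relpow_adj_mono)

lemma adj_image:
  assumes "inj g"
  shows "(g u, g v) \<in> adj ((`) g ` X) \<longleftrightarrow> (u, v) \<in> adj X"
proof -
  have "{g u, g v} = g ` {u, v}" by simp
  then show ?thesis
    unfolding adj_def using assms by (auto simp: image_iff inj_image_eq_iff simp del: image_insert)
qed

lemma relpow_adj_image:
  assumes "bij g"
  shows "(g u, g v) \<in> adj ((`) g ` X) ^^ n \<longleftrightarrow> (u, v) \<in> adj X ^^ n"
proof (induction n arbitrary: v)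
  case 0
  then show ?case using assms by (auto simp: bij_def inj_eq)
next
  case (Suc n)
  have "(g u, g v) \<in> adj ((`) g ` X) ^^ Suc n \<longleftrightarrow>
      (\<exists>t. (g u, t) \<in> adj ((`) g ` X) ^^ n \<and> (t, g v) \<in> adj ((`) g ` X))" by auto
  also have "\<dots> \<longleftrightarrow> (\<exists>t. (g u, g t) \<in> adj ((`) g ` X) ^^ n \<and> (g t, g v) \<in> adj ((`) g ` X))"
    using assms by (metis bij_pointE)
  also have "\<dots> \<longleftrightarrow> (\<exists>t. (u, t) \<in> adj X ^^ n \<and> (t, v) \<in> adj X)"
    using Suc.IH adj_image[of g] assms by (simp add: bij_def)
  finally show ?case by auto
qed

lemma component_image:
  assumes "bij g"
  shows "g v \<in> component ((`) g ` X) (g u) \<longleftrightarrow> v \<in> component X u"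
  by (simp add: component_iff_relpow relpow_adj_image[OF assms])

section \<open>Events of bond percolation\<close>

text \<open>Events are given by predicates on the set of open edges. The sample space and the measurable
  sets do not depend on \<open>p\<close>, so the parameter 0 in \<open>event\<close> and \<open>ev\<close> is arbitrary.\<close>

locale countable_edges =
  fixes E :: "'a set set"
  assumes countable_edges: "countable E"
begin

definition event :: "('a set set \<Rightarrow> bool) \<Rightarrow> ('a set \<Rightarrow> bool) set" where
  "event Q = {\<omega> \<in> space (bond_percolation E 0). Q (open_edges E \<omega>)}"

definition ev :: "('a set set \<Rightarrow> bool) \<Rightarrow> bool" where
  "ev Q \<longleftrightarrow> event Q \<in> sets (bond_percolation E 0)"

definition pr :: "real \<Rightarrow> ('a set set \<Rightarrow> bool) \<Rightarrow> real" where
  "pr p Q = measure (bond_percolation E p) (event Q)"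

text \<open>\<open>J\<close> may contain sets that are not edges, which allows simple index sets
  such as \<open>{e. e \<inter> C = {}}\<close>.\<close>

definition depends :: "'a set set \<Rightarrow> ('a set set \<Rightarrow> bool) \<Rightarrow> bool" where
  "depends J Q \<longleftrightarrow> (\<forall>X\<subseteq>E. Q X \<longleftrightarrow> Q (X \<inter> J))"

lemma prob_space_percolation: "prob_space (bond_percolation E p)"
  unfolding bond_percolation_def by (intro prob_space_PiM) (rule prob_space_measure_pmf)

sublocale perc: prob_space "bond_percolation E p" for p
  by (rule prob_space_percolation)

lemma sets_percolation: "sets (bond_percolation E p) = sets (bond_percolation E 0)"
  unfolding bond_percolation_def by (intro sets_PiM_cong) auto

lemma space_percolation: "space (bond_percolation E p) = space (bond_percolation E 0)"
  using sets_percolation by (rule sets_eq_imp_space_eq)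

lemma space_percolation_PiE: "space (bond_percolation E p) = (\<Pi>\<^sub>E e\<in>E. UNIV)"
  unfolding bond_percolation_def by (simp add: space_PiM)

lemma ev_sets: "ev Q \<Longrightarrow> event Q \<in> sets (bond_percolation E p)"
  unfolding ev_def by (subst sets_percolation)

lemma event_eq: "event Q = {\<omega> \<in> space (bond_percolation E p). Q (open_edges E \<omega>)}"
  unfolding event_def by (subst space_percolation[of p]) simp

lemma ev_not [intro]: "ev Q \<Longrightarrow> ev (\<lambda>X. \<not> Q X)"
  unfolding ev_def event_def by (rule sets.sets_Collect)

lemma ev_conj [intro]: "ev Q \<Longrightarrow> ev R \<Longrightarrow> ev (\<lambda>X. Q X \<and> R X)"
  unfolding ev_def event_def by (rule sets.sets_Collect)

lemma ev_disj [intro]: "ev Q \<Longrightarrow> ev R \<Longrightarrow> ev (\<lambda>X. Q X \<or> R X)"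
  unfolding ev_def event_def by (rule sets.sets_Collect)

lemma ev_imp [intro]: "ev Q \<Longrightarrow> ev R \<Longrightarrow> ev (\<lambda>X. Q X \<longrightarrow> R X)"
  unfolding ev_def event_def by (rule sets.sets_Collect)

lemma ev_const [intro]: "ev (\<lambda>X. b)"
  unfolding ev_def event_def by (rule sets.sets_Collect)

lemma ev_bex [intro]:
  assumes "countable I" "\<And>i. i \<in> I \<Longrightarrow> ev (Q i)"
  shows "ev (\<lambda>X. \<exists>i\<in>I. Q i X)"
proof -
  have "event (\<lambda>X. \<exists>i\<in>I. Q i X) = (\<Union>i\<in>I. event (Q i))" by (auto simp: event_def)
  then show ?thesis using assms unfolding ev_def by auto
qed

lemma ev_ball [intro]:
  assumes "countable I" "\<And>i. i \<in> I \<Longrightarrow> ev (Q i)"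
  shows "ev (\<lambda>X. \<forall>i\<in>I. Q i X)"
proof -
  have "ev (\<lambda>X. \<not> (\<exists>i\<in>I. \<not> Q i X))" using assms by (intro ev_not ev_bex) auto
  then show ?thesis by simp
qed

lemma ev_ex [intro]:
  fixes Q :: "'i :: countable \<Rightarrow> 'a set set \<Rightarrow> bool"
  shows "(\<And>i. ev (Q i)) \<Longrightarrow> ev (\<lambda>X. \<exists>i. Q i X)"
  using ev_bex[of UNIV Q] by simp

lemma ev_all [intro]:
  fixes Q :: "'i :: countable \<Rightarrow> 'a set set \<Rightarrow> bool"
  shows "(\<And>i. ev (Q i)) \<Longrightarrow> ev (\<lambda>X. \<forall>i. Q i X)"
  using ev_ball[of UNIV Q] by simp

lemma ev_cong: "(\<And>X. X \<subseteq> E \<Longrightarrow> Q X \<longleftrightarrow> R X) \<Longrightarrow> ev Q \<longleftrightarrow> ev R"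
proof -
  assume *: "\<And>X. X \<subseteq> E \<Longrightarrow> Q X \<longleftrightarrow> R X"
  have "open_edges E \<omega> \<subseteq> E" for \<omega> by (auto simp: open_edges_def)
  then have "event Q = event R" using * by (auto simp: event_def)
  then show ?thesis by (simp add: ev_def)
qed

lemma ev_mem [intro]: "ev (\<lambda>X. e \<in> X)"
proof (cases "e \<in> E")
  case True
  have "Measurable.pred (bond_percolation E 0) (\<lambda>\<omega>. \<omega> e)"
    unfolding bond_percolation_def
    by (rule measurable_compose[OF measurable_component_singleton[OF True]]) simp
  then have "{\<omega> \<in> space (bond_percolation E 0). \<omega> e} \<in> sets (bond_percolation E 0)"
    by (rule predE)
  also have "{\<omega> \<in> space (bond_percolation E 0). \<omega> e} = event (\<lambda>X. e \<in> X)"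
    using True by (auto simp: event_def open_edges_def)
  finally show ?thesis by (simp add: ev_def)
next
  case False
  have "ev (\<lambda>X. e \<in> X) \<longleftrightarrow> ev (\<lambda>X. False)" using False by (intro ev_cong) auto
  then show ?thesis using ev_const by simp
qed

lemma ev_finite_subset [intro]: "finite F \<Longrightarrow> ev (\<lambda>X. F \<subseteq> X)"
  using ev_ball[of F "\<lambda>e X. e \<in> X"] by (simp add: subset_eq countable_finite ev_mem)

lemma countable_finite_subsets: "countable A \<Longrightarrow> countable {F. finite F \<and> F \<subseteq> A}"
  by (rule countable_Collect_finite_subset)

text \<open>The event is a union, over the countably many finite edge sets that contain a suitable
  path, of the events that the set is open.\<close>

lemma ev_relpow [intro]: "ev (\<lambda>X. (x, y) \<in> adj {e \<in> X. P e} ^^ n)"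
proof -
  have "ev (\<lambda>X. \<exists>F\<in>{F. finite F \<and> F \<subseteq> E}. F \<subseteq> X \<and> (\<forall>e\<in>F. P e) \<and> (x, y) \<in> adj F ^^ n)"
    by (intro ev_bex countable_finite_subsets countable_edges ev_conj ev_finite_subset ev_const) auto
  also have "?this \<longleftrightarrow> ev (\<lambda>X. (x, y) \<in> adj {e \<in> X. P e} ^^ n)"
    by (rule ev_cong, subst relpow_adj_finite) blast
  finally show ?thesis .
qed

lemma ev_component [intro]: "ev (\<lambda>X. y \<in> component {e \<in> X. P e} x)"
  unfolding component_iff_relpow by auto

lemma ev_component_UNIV [intro]: "ev (\<lambda>X. y \<in> component X x)"
  using ev_component[of y "\<lambda>_. True" x] by simp

lemma ev_relpow_UNIV [intro]: "ev (\<lambda>X. (x, y) \<in> adj X ^^ n)"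
  using ev_relpow[where P = "\<lambda>_. True"] by simp

lemma pr_nonneg [simp]: "0 \<le> pr p Q" and pr_le_1 [simp]: "pr p Q \<le> 1"
  by (simp_all add: pr_def)

lemma pr_cong: "(\<And>X. X \<subseteq> E \<Longrightarrow> Q X \<longleftrightarrow> R X) \<Longrightarrow> pr p Q = pr p R"
proof -
  assume *: "\<And>X. X \<subseteq> E \<Longrightarrow> Q X \<longleftrightarrow> R X"
  have "open_edges E \<omega> \<subseteq> E" for \<omega> by (auto simp: open_edges_def)
  then have "event Q = event R" using * by (auto simp: event_def)
  then show ?thesis by (simp add: pr_def)
qed

lemma pr_mono: "ev R \<Longrightarrow> (\<And>X. X \<subseteq> E \<Longrightarrow> Q X \<Longrightarrow> R X) \<Longrightarrow> pr p Q \<le> pr p R"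
  unfolding pr_def
  by (intro perc.finite_measure_mono ev_sets) (auto simp: event_def open_edges_def)

lemma pr_True: "pr p (\<lambda>_. True) = 1"
  by (simp add: pr_def event_def perc.prob_space[of p, unfolded space_percolation[of p]])

lemma pr_not: "ev Q \<Longrightarrow> pr p (\<lambda>X. \<not> Q X) = 1 - pr p Q"
proof -
  assume "ev Q"
  have "event (\<lambda>X. \<not> Q X) = space (bond_percolation E p) - event Q"
    by (subst space_percolation) (auto simp: event_def)
  then show ?thesis unfolding pr_def using perc.prob_compl[OF ev_sets[OF \<open>ev Q\<close>]] by simp
qed

lemma emeasure_event: "emeasure (bond_percolation E p) (event Q) = ennreal (pr p Q)"
  by (simp add: pr_def perc.emeasure_eq_measure)

lemma pr_disj_le: "ev Q \<Longrightarrow> ev R \<Longrightarrow> pr p (\<lambda>X. Q X \<or> R X) \<le> pr p Q + pr p R"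
proof -
  assume *: "ev Q" "ev R"
  have "event (\<lambda>X. Q X \<or> R X) = event Q \<union> event R" by (auto simp: event_def)
  then show ?thesis unfolding pr_def using * ev_sets
    by (metis measure_Un_le)
qed

lemma pr_disj: "ev Q \<Longrightarrow> ev R \<Longrightarrow> (\<And>X. X \<subseteq> E \<Longrightarrow> \<not> (Q X \<and> R X)) \<Longrightarrow>
  pr p (\<lambda>X. Q X \<or> R X) = pr p Q + pr p R"
proof -
  assume *: "ev Q" "ev R" "\<And>X. X \<subseteq> E \<Longrightarrow> \<not> (Q X \<and> R X)"
  have "event (\<lambda>X. Q X \<or> R X) = event Q \<union> event R" by (auto simp: event_def)
  moreover have "open_edges E \<omega> \<subseteq> E" for \<omega> by (auto simp: open_edges_def)
  then have "event Q \<inter> event R = {}" using *(3) by (auto simp: event_def)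
  ultimately show ?thesis unfolding pr_def using *(1,2) ev_sets
    by (simp add: perc.finite_measure_Union)
qed

lemma pr_bex_disjoint:
  assumes "countable I" "\<And>i. i \<in> I \<Longrightarrow> ev (Q i)"
    and "\<And>i j X. i \<in> I \<Longrightarrow> j \<in> I \<Longrightarrow> X \<subseteq> E \<Longrightarrow> Q i X \<Longrightarrow> Q j X \<Longrightarrow> i = j"
  shows "ennreal (pr p (\<lambda>X. \<exists>i\<in>I. Q i X)) = (\<integral>\<^sup>+i. ennreal (pr p (Q i)) \<partial>count_space I)"
proof -
  have *: "open_edges E \<omega> \<subseteq> E" for \<omega> by (auto simp: open_edges_def)
  have "event (\<lambda>X. \<exists>i\<in>I. Q i X) = (\<Union>i\<in>I. event (Q i))" by (auto simp: event_def)
  moreover have "disjoint_family_on (\<lambda>i. event (Q i)) I"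
    using assms(3)[OF _ _ *] by (auto simp: disjoint_family_on_def event_def)
  then have "emeasure (bond_percolation E p) (\<Union>i\<in>I. event (Q i)) =
      (\<integral>\<^sup>+i. emeasure (bond_percolation E p) (event (Q i)) \<partial>count_space I)"
    using assms(1,2) by (intro emeasure_UN_countable ev_sets)
  ultimately show ?thesis by (simp flip: emeasure_event)
qed

lemma pr_bex_finite:
  assumes "finite I" "\<And>i. i \<in> I \<Longrightarrow> ev (Q i)"
    and "\<And>i j X. i \<in> I \<Longrightarrow> j \<in> I \<Longrightarrow> X \<subseteq> E \<Longrightarrow> Q i X \<Longrightarrow> Q j X \<Longrightarrow> i = j"
  shows "pr p (\<lambda>X. \<exists>i\<in>I. Q i X) = (\<Sum>i\<in>I. pr p (Q i))"
proof -
  have *: "open_edges E \<omega> \<subseteq> E" for \<omega> by (auto simp: open_edges_def)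
  have "event (\<lambda>X. \<exists>i\<in>I. Q i X) = (\<Union>i\<in>I. event (Q i))" by (auto simp: event_def)
  moreover have "disjoint_family_on (\<lambda>i. event (Q i)) I"
    using assms(3)[OF _ _ *] by (auto simp: disjoint_family_on_def event_def)
  ultimately show ?thesis unfolding pr_def
    using assms(1,2) ev_sets by (simp add: perc.finite_measure_finite_Union image_subset_iff)
qed

lemma pr_bex_finite_le:
  assumes "finite I" "\<And>i. i \<in> I \<Longrightarrow> ev (Q i)"
  shows "pr p (\<lambda>X. \<exists>i\<in>I. Q i X) \<le> (\<Sum>i\<in>I. pr p (Q i))"
proof -
  have "event (\<lambda>X. \<exists>i\<in>I. Q i X) = (\<Union>i\<in>I. event (Q i))" by (auto simp: event_def)
  then show ?thesis unfolding pr_def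
    using assms ev_sets by (simp add: perc.finite_measure_subadditive_finite image_subset_iff)
qed

lemma pr_bex_le:
  assumes "countable I" "\<And>i. i \<in> I \<Longrightarrow> ev (Q i)"
  shows "ennreal (pr p (\<lambda>X. \<exists>i\<in>I. Q i X)) \<le> (\<integral>\<^sup>+i. ennreal (pr p (Q i)) \<partial>count_space I)"
proof -
  have *: "event (\<lambda>X. \<exists>i\<in>I. Q i X) = (\<Union>i\<in>I. event (Q i))" by (auto simp: event_def)
  have "emeasure (bond_percolation E p) (\<Union>i\<in>I. event (Q i)) =
      (\<integral>\<^sup>+\<omega>. indicator (\<Union>i\<in>I. event (Q i)) \<omega> \<partial>bond_percolation E p)"
    using assms ev_sets by (intro nn_integral_indicator[symmetric] sets.countable_UN') auto
  also have "\<dots> \<le> (\<integral>\<^sup>+\<omega>. (\<integral>\<^sup>+i. indicator (event (Q i)) \<omega> \<partial>count_space I) \<partial>bond_percolation E p)"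
  proof (rule nn_integral_mono)
    fix \<omega>
    show "indicator (\<Union>i\<in>I. event (Q i)) \<omega> \<le> (\<integral>\<^sup>+i. indicator (event (Q i)) \<omega> \<partial>count_space I :: ennreal)"
    proof (cases "\<exists>i\<in>I. \<omega> \<in> event (Q i)")
      case True
      then obtain i where i: "i \<in> I" "\<omega> \<in> event (Q i)" by blast
      have "indicator (\<Union>i\<in>I. event (Q i)) \<omega> = (\<integral>\<^sup>+j. indicator {i} j \<partial>count_space I :: ennreal)"
        using i by (subst nn_integral_indicator) (auto simp: indicator_def)
      also have "\<dots> \<le> (\<integral>\<^sup>+j. indicator (event (Q j)) \<omega> \<partial>count_space I)"
        using i by (intro nn_integral_mono) (auto simp: indicator_def)
      finally show ?thesis .
    qed auto
  qed
  also have "\<dots> = (\<integral>\<^sup>+i. (\<integral>\<^sup>+\<omega>. indicator (event (Q i)) \<omega> \<partial>bond_percolation E p) \<partial>count_space I)"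
    using assms by (intro nn_integral_count_space_nn_integral borel_measurable_indicator ev_sets)
  also have "\<dots> = (\<integral>\<^sup>+i. emeasure (bond_percolation E p) (event (Q i)) \<partial>count_space I)"
    using assms(2) by (intro nn_integral_cong nn_integral_indicator ev_sets) auto
  finally show ?thesis by (simp add: * flip: emeasure_event)
qed

lemma pr_incseq:
  assumes "\<And>n. ev (Q n)" "\<And>n X. X \<subseteq> E \<Longrightarrow> Q n X \<Longrightarrow> Q (Suc n) X"
  shows "(\<lambda>n. pr p (Q n)) \<longlonglongrightarrow> pr p (\<lambda>X. \<exists>n. Q n X)"
proof -
  have *: "open_edges E \<omega> \<subseteq> E" for \<omega> by (auto simp: open_edges_def)
  have "event (\<lambda>X. \<exists>n. Q n X) = (\<Union>n. event (Q n))" by (auto simp: event_def)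
  moreover have "incseq (\<lambda>n. event (Q n))"
    using assms(2)[OF *] by (intro incseq_SucI) (auto simp: event_def)
  ultimately show ?thesis unfolding pr_def
    using perc.finite_Lim_measure_incseq[of "\<lambda>n. event (Q n)" p] assms(1) ev_sets
    by (simp add: image_subset_iff)
qed

lemma pr_decseq:
  assumes "\<And>n. ev (Q n)" "\<And>n X. X \<subseteq> E \<Longrightarrow> Q (Suc n) X \<Longrightarrow> Q n X"
  shows "(\<lambda>n. pr p (Q n)) \<longlonglongrightarrow> pr p (\<lambda>X. \<forall>n. Q n X)"
proof -
  have "(\<lambda>n. 1 - pr p (\<lambda>X. \<not> Q n X)) \<longlonglongrightarrow> 1 - pr p (\<lambda>X. \<exists>n. \<not> Q n X)"
    by (intro tendsto_intros pr_incseq) (use assms in auto)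
  moreover have "pr p (\<lambda>X. \<exists>n. \<not> Q n X) = 1 - pr p (\<lambda>X. \<forall>n. Q n X)"
    using pr_not[of "\<lambda>X. \<forall>n. Q n X" p] assms(1) by auto
  ultimately show ?thesis using assms(1) by (simp add: pr_not)
qed

section \<open>Independence of events on disjoint edge sets\<close>

lemma dependsI: "(\<And>X. X \<subseteq> E \<Longrightarrow> Q X \<longleftrightarrow> Q (X \<inter> J)) \<Longrightarrow> depends J Q"
  by (simp add: depends_def)

lemma dependsD: "depends J Q \<Longrightarrow> X \<subseteq> E \<Longrightarrow> Q X \<longleftrightarrow> Q (X \<inter> J)"
  by (simp add: depends_def)

lemma depends_mono: "depends J Q \<Longrightarrow> J \<subseteq> J' \<Longrightarrow> depends J' Q"
proof (rule dependsI)
  fix X assume *: "depends J Q" "J \<subseteq> J'" "X \<subseteq> E"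
  have "Q X \<longleftrightarrow> Q (X \<inter> J)" "Q (X \<inter> J') \<longleftrightarrow> Q ((X \<inter> J') \<inter> J)"
    using *(1,3) unfolding depends_def by blast+
  moreover have "(X \<inter> J') \<inter> J = X \<inter> J" using *(2) by blast
  ultimately show "Q X \<longleftrightarrow> Q (X \<inter> J')" by simp
qed

lemma depends_conj: "depends J Q \<Longrightarrow> depends J R \<Longrightarrow> depends J (\<lambda>X. Q X \<and> R X)"
  unfolding depends_def by blast

lemma depends_not: "depends J Q \<Longrightarrow> depends J (\<lambda>X. \<not> Q X)"
  unfolding depends_def by blast

text \<open>The joint law of the coordinates is the percolation measure itself, which is the product
  of its marginals.\<close>

lemma indep_coordinates:
  "E \<noteq> {} \<Longrightarrow> perc.indep_vars p (\<lambda>_. count_space UNIV) (\<lambda>e \<omega>. \<omega> e) E"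
proof -
  assume "E \<noteq> {}"
  let ?P = "bond_percolation E p"
  have rv: "(\<lambda>\<omega>. \<omega> e) \<in> measurable ?P (count_space UNIV)" if "e \<in> E" for e
    unfolding bond_percolation_def
    by (rule measurable_compose[OF measurable_component_singleton[OF that]]) simp
  have "distr ?P (\<Pi>\<^sub>M i\<in>E. count_space UNIV) (\<lambda>x. \<lambda>i\<in>E. x i) = distr ?P ?P (\<lambda>x. x)"
    by (intro distr_cong) (auto simp: bond_percolation_def space_PiM intro!: sets_PiM_cong)
  also have "\<dots> = ?P" by (rule distr_id)
  also have "\<dots> = (\<Pi>\<^sub>M i\<in>E. distr ?P (count_space UNIV) (\<lambda>\<omega>. \<omega> i))"
  proof -
    have "measure_pmf (bernoulli_pmf p) = distr ?P (count_space UNIV) (\<lambda>\<omega>. \<omega> i)" if "i \<in> E" for i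
    proof -
      have "distr ?P (count_space UNIV) (\<lambda>\<omega>. \<omega> i) = distr ?P (measure_pmf (bernoulli_pmf p)) (\<lambda>\<omega>. \<omega> i)"
        by (intro distr_cong) auto
      also have "\<dots> = measure_pmf (bernoulli_pmf p)"
        unfolding bond_percolation_def
        by (intro distr_PiM_component that prob_space_measure_pmf)
      finally show ?thesis by (rule sym)
    qed
    then have "(\<Pi>\<^sub>M i\<in>E. measure_pmf (bernoulli_pmf p)) = (\<Pi>\<^sub>M i\<in>E. distr ?P (count_space UNIV) (\<lambda>\<omega>. \<omega> i))"
      by (rule PiM_cong[OF refl])
    then show ?thesis by (rule trans[OF bond_percolation_def])
  qed
  finally show ?thesis
    using rv \<open>E \<noteq> {}\<close> by (subst perc.indep_vars_iff_distr_eq_PiM')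
qed

lemma pr_indep:
  assumes "ev Q" "ev R" "depends J Q" "depends K R" "J \<inter> K = {}"
  shows "pr p (\<lambda>X. Q X \<and> R X) = pr p Q * pr p R"
proof (cases "E = {}")
  case True
  \<comment> \<open>Without edges the only set of open edges is empty. The case is separate because
    \<open>indep_coordinates\<close> needs a nonempty index set.\<close>
  have "pr p S = (if S {} then 1 else 0)" for S
  proof -
    have "pr p S = pr p (\<lambda>X. S {})" by (rule pr_cong) (use True in auto)
    then show ?thesis using pr_True[of p] by (simp add: pr_def event_def)
  qed
  then show ?thesis by simp
next
  case False
  \<comment> \<open>Two disjoint blocks of coordinates, indexed by \<open>bool\<close>: the
    restrictions to them are independent, and each event is a function of one restriction.\<close>
  define L where "L b = (if b then J \<inter> E else K \<inter> E)" for b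
  let ?N = "\<lambda>j. PiM (L j) (\<lambda>_. count_space (UNIV :: bool set))"
  let ?S = "\<lambda>j S. {\<eta> \<in> space (?N j). S {e \<in> L j. \<eta> e}}"
  have "disjoint_family_on L UNIV" using assms(5) by (auto simp: L_def disjoint_family_on_def)
  then have ind: "perc.indep_vars p ?N (\<lambda>j \<omega>. restrict \<omega> (L j)) UNIV"
    by (rule perc.indep_vars_restrict[OF indep_coordinates[OF False, of p], rotated]) (simp add: L_def)
  have sets: "?S j S \<in> sets (?N j)" if "ev S" for j S
  proof -
    \<comment> \<open>Extends a block configuration to \<open>E\<close> by closed edges, so that
      measurability on the block is inherited from \<open>ev S\<close>.\<close>
    define h where "h \<eta> = (\<lambda>e\<in>E. e \<in> L j \<and> \<eta> e)" for \<eta> :: "'a set \<Rightarrow> bool"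
    have L: "L j \<subseteq> E" by (auto simp: L_def)
    have h: "h \<in> measurable (?N j) (bond_percolation E 0)"
      unfolding bond_percolation_def h_def
    proof (rule measurable_restrict)
      fix e assume "e \<in> E"
      have "(\<lambda>\<eta>. e \<in> L j \<and> \<eta> e) \<in> measurable (?N j) (count_space UNIV)"
        by (cases "e \<in> L j") auto
      then show "(\<lambda>\<eta>. e \<in> L j \<and> \<eta> e) \<in> measurable (?N j) (measure_pmf (bernoulli_pmf 0))"
        by (simp add: measurable_def)
    qed
    have "h -` event S \<inter> space (?N j) \<in> sets (?N j)"
      using that h unfolding ev_def by (rule measurable_sets[rotated])
    also have "h -` event S \<inter> space (?N j) = ?S j S"
    proof -
      have "open_edges E (h \<eta>) = {e \<in> L j. \<eta> e}" for \<eta>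
        using L by (auto simp: open_edges_def h_def)
      moreover have "h \<eta> \<in> space (bond_percolation E 0)" for \<eta>
        by (simp add: space_percolation_PiE h_def)
      ultimately show ?thesis by (auto simp: event_def)
    qed
    finally show ?thesis .
  qed
  have restr: "(\<lambda>\<omega>. restrict \<omega> (L j)) -` ?S j S \<inter> space (bond_percolation E p) = event S"
    if "depends (if j then J else K) S" for j S
  proof -
    have "{e \<in> L j. restrict \<omega> (L j) e} = open_edges E \<omega> \<inter> (if j then J else K)" for \<omega>
      by (auto simp: L_def open_edges_def)
    moreover have "restrict \<omega> (L j) \<in> space (?N j)" for \<omega> by (simp add: space_PiM)
    moreover have "open_edges E \<omega> \<subseteq> E" for \<omega> by (auto simp: open_edges_def)
    ultimately show ?thesis
      using that unfolding depends_def event_eq[of S p] by auto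
  qed
  have "perc.prob p (\<Inter>j\<in>UNIV. (\<lambda>\<omega>. restrict \<omega> (L j)) -` (if j then ?S True Q else ?S False R) \<inter> space (bond_percolation E p))
    = (\<Prod>j\<in>UNIV. perc.prob p ((\<lambda>\<omega>. restrict \<omega> (L j)) -` (if j then ?S True Q else ?S False R) \<inter> space (bond_percolation E p)))"
    by (rule perc.indep_varsD[OF ind]) (use sets[OF assms(1), of True] sets[OF assms(2), of False] in auto)
  moreover have "(\<Inter>j\<in>UNIV. (\<lambda>\<omega>. restrict \<omega> (L j)) -` (if j then ?S True Q else ?S False R) \<inter> space (bond_percolation E p))
     = event Q \<inter> event R"
    using restr[of True Q] restr[of False R] assms(3,4) by (simp add: UNIV_bool Int_commute)
  moreover have "event Q \<inter> event R = event (\<lambda>X. Q X \<and> R X)" by (auto simp: event_def)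
  ultimately show ?thesis
    using restr[of True Q] restr[of False R] assms(3,4) by (simp add: pr_def UNIV_bool)
qed

section \<open>Cylinder events as polynomials in \<open>p\<close>, and invariance under edge
  permutations\<close>

lemma pr_cylinder:
  assumes "finite F" "F \<subseteq> E" "T \<subseteq> F" "0 \<le> p" "p \<le> 1"
  shows "pr p (\<lambda>X. X \<inter> F = T) = p ^ card T * (1 - p) ^ card (F - T)"
proof -
  let ?M = "\<lambda>_ :: 'a set. measure_pmf (bernoulli_pmf p)"
  interpret product_prob_space ?M E
    by (intro product_prob_spaceI prob_space_measure_pmf)
  have "event (\<lambda>X. X \<inter> F = T) = {\<omega> \<in> space (PiM E ?M). \<forall>e\<in>F. \<omega> e \<in> {e \<in> T}}"
    using assms(2,3) unfolding event_eq[of _ p] by (auto simp: bond_percolation_def open_edges_def)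
  then have "ennreal (pr p (\<lambda>X. X \<inter> F = T)) =
      emeasure (PiM E ?M) {\<omega> \<in> space (PiM E ?M). \<forall>e\<in>F. \<omega> e \<in> {e \<in> T}}"
    by (simp add: emeasure_event[symmetric] bond_percolation_def)
  also have "\<dots> = (\<Prod>e\<in>F. emeasure (measure_pmf (bernoulli_pmf p)) {e \<in> T})"
    using assms(1,2) by (intro emeasure_PiM_Collect) auto
  also have "\<dots> = (\<Prod>e\<in>F. ennreal (if e \<in> T then p else 1 - p))"
    using assms(4,5) by (intro prod.cong) (auto simp: emeasure_pmf_single)
  also have "\<dots> = ennreal (\<Prod>e\<in>F. if e \<in> T then p else 1 - p)"
    using assms(4,5) by (intro prod_ennreal) auto
  also have "(\<Prod>e\<in>F. if e \<in> T then p else 1 - p) = p ^ card T * (1 - p) ^ card (F - T)"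
  proof -
    have "F \<inter> {e. e \<in> T} = T" "F \<inter> - {e. e \<in> T} = F - T" using assms(3) by auto
    then show ?thesis using assms(1) by (simp add: prod.If_cases)
  qed
  finally show ?thesis
    using assms(4,5) by (subst (asm) ennreal_inj) auto
qed

text \<open>For \<open>0 \<le> p \<le> 1\<close> this is the expectation of \<open>h\<close> at the
  set of open edges of \<open>F\<close>. Being a polynomial on all reals, it has two-sided
  derivatives even at 0 and 1.\<close>

definition cylinder_poly :: "'a set set \<Rightarrow> ('a set set \<Rightarrow> real) \<Rightarrow> real \<Rightarrow> real" where
  "cylinder_poly F h p = (\<Sum>T\<in>Pow F. h T * (p ^ card T * (1 - p) ^ card (F - T)))"

lemma ev_depends_finite:
  assumes "finite F" "depends F Q"
  shows "ev Q"
proof -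
  have "ev (\<lambda>X. \<exists>T\<in>Pow F. Q T \<and> (\<forall>e\<in>F. e \<in> X \<longleftrightarrow> e \<in> T))"
    using assms(1) by (intro ev_bex ev_conj ev_const ev_ball)
      (auto simp: countable_finite iff_conv_conj_imp intro!: ev_conj ev_imp)
  also have "?this \<longleftrightarrow> ev Q"
  proof (rule ev_cong)
    fix X assume "X \<subseteq> E"
    have "(\<forall>e\<in>F. e \<in> X \<longleftrightarrow> e \<in> T) \<longleftrightarrow> T = X \<inter> F" if "T \<subseteq> F" for T using that by auto
    then show "(\<exists>T\<in>Pow F. Q T \<and> (\<forall>e\<in>F. e \<in> X \<longleftrightarrow> e \<in> T)) = Q X"
      using assms(2) \<open>X \<subseteq> E\<close> unfolding depends_def by (metis Int_lower2 PowD PowI)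
  qed
  finally show ?thesis .
qed

lemma pr_depends_finite:
  assumes "finite F" "F \<subseteq> E" "depends F Q" "0 \<le> p" "p \<le> 1"
  shows "pr p Q = cylinder_poly F (\<lambda>T. of_bool (Q T)) p"
proof -
  have "pr p Q = pr p (\<lambda>X. \<exists>T\<in>{T\<in>Pow F. Q T}. X \<inter> F = T)"
    using assms(3) by (intro pr_cong) (auto simp: depends_def)
  also have "\<dots> = (\<Sum>T\<in>{T\<in>Pow F. Q T}. pr p (\<lambda>X. X \<inter> F = T))"
  proof (rule pr_bex_finite)
    fix T
    show "ev (\<lambda>X. X \<inter> F = T)" using assms(1) by (rule ev_depends_finite) (simp add: depends_def)
  qed (use assms(1) in auto)
  also have "\<dots> = (\<Sum>T\<in>{T\<in>Pow F. Q T}. p ^ card T * (1 - p) ^ card (F - T))"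
    using assms by (intro sum.cong pr_cylinder) auto
  also have "\<dots> = cylinder_poly F (\<lambda>T. of_bool (Q T)) p"
    unfolding cylinder_poly_def using assms(1) by (intro sum.mono_neutral_cong_left) auto
  finally show ?thesis .
qed

lemma pr_open: "e \<in> E \<Longrightarrow> 0 \<le> p \<Longrightarrow> p \<le> 1 \<Longrightarrow> pr p (\<lambda>X. e \<in> X) = p"
proof -
  assume *: "e \<in> E" "0 \<le> p" "p \<le> 1"
  have "pr p (\<lambda>X. e \<in> X) = pr p (\<lambda>X. X \<inter> {e} = {e})" by (rule pr_cong) auto
  then show ?thesis using pr_cylinder[of "{e}" "{e}" p] * by simp
qed

lemma pr_all_closed:
  "finite F \<Longrightarrow> F \<subseteq> E \<Longrightarrow> 0 \<le> p \<Longrightarrow> p \<le> 1 \<Longrightarrow> pr p (\<lambda>X. X \<inter> F = {}) = (1 - p) ^ card F"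
  using pr_cylinder[of F "{}" p] by simp

lemma pr_image:
  assumes "bij_betw g E E" "ev (\<lambda>X. Q (g ` X))"
  shows "pr p (\<lambda>X. Q (g ` X)) = pr p Q"
proof -
  let ?P = "bond_percolation E p"
  \<comment> \<open>\<open>t \<omega>\<close> opens \<open>e\<close> iff \<open>\<omega>\<close>
    opens \<open>g e\<close>, so \<open>g\<close> maps the open edges of \<open>t \<omega>\<close>
    onto those of \<open>\<omega>\<close>; reindexing equal factors preserves the law.\<close>
  define t where "t \<omega> = (\<lambda>e\<in>E. \<omega> (g e))" for \<omega> :: "'a set \<Rightarrow> bool"
  have g: "inj_on g E" "g ` E = E" using assms(1) by (auto simp: bij_betw_def)
  have distr: "distr ?P ?P t = ?P"
    using distr_PiM_reindex[of E "\<lambda>_. measure_pmf (bernoulli_pmf p)" g E] g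
    by (auto simp: bond_percolation_def prob_space_measure_pmf t_def[abs_def])
  have t: "t \<in> measurable ?P ?P"
    unfolding bond_percolation_def t_def using g
    by (intro measurable_restrict measurable_component_singleton) auto
  have "pr p (\<lambda>X. Q (g ` X)) = measure (distr ?P ?P t) (event (\<lambda>X. Q (g ` X)))"
    by (simp add: distr pr_def)
  also have "\<dots> = measure ?P (t -` event (\<lambda>X. Q (g ` X)) \<inter> space ?P)"
    using t assms(2) by (intro measure_distr ev_sets)
  also have "t -` event (\<lambda>X. Q (g ` X)) \<inter> space ?P = event Q"
  proof -
    have img: "g ` open_edges E (t \<omega>) = open_edges E \<omega>" for \<omega>
    proof -
      have "open_edges E (t \<omega>) = {e \<in> E. \<omega> (g e)}" by (auto simp: open_edges_def t_def)
      moreover have "g ` {e \<in> E. \<omega> (g e)} = {e \<in> g ` E. \<omega> e}" by blast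
      ultimately show ?thesis by (simp add: g(2) open_edges_def)
    qed
    show ?thesis
    proof (rule set_eqI)
      fix \<omega>
      have "\<omega> \<in> t -` event (\<lambda>X. Q (g ` X)) \<inter> space ?P \<longleftrightarrow>
          t \<omega> \<in> space ?P \<and> Q (g ` open_edges E (t \<omega>)) \<and> \<omega> \<in> space ?P"
        unfolding event_eq[of "\<lambda>X. Q (g ` X)" p] vimage_def Int_iff mem_Collect_eq by simp
      also have "\<dots> \<longleftrightarrow> Q (open_edges E \<omega>) \<and> \<omega> \<in> space ?P"
        unfolding img using measurable_space[OF t, of \<omega>] by argo
      also have "\<dots> \<longleftrightarrow> \<omega> \<in> event Q"
        unfolding event_eq[of Q p] mem_Collect_eq by (rule conj_commute)
      finally show "\<omega> \<in> t -` event (\<lambda>X. Q (g ` X)) \<inter> space ?P \<longleftrightarrow> \<omega> \<in> event Q" .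
    qed
  qed
  finally show ?thesis by (simp add: pr_def)
qed

section \<open>Russo's formula and the dependence on \<open>p\<close>\<close>

lemma cylinder_poly_insert:
  assumes "finite F" "e \<notin> F"
  shows "cylinder_poly (insert e F) h p =
    p * cylinder_poly F (\<lambda>T. h (insert e T)) p + (1 - p) * cylinder_poly F h p"
proof -
  let ?t = "\<lambda>T. h T * (p ^ card T * (1 - p) ^ card (insert e F - T))"
  have inj: "inj_on (insert e) (Pow F)"
    using assms(2) by (intro inj_onI) (auto dest: insert_ident[THEN iffD1, rotated 2])
  have "cylinder_poly (insert e F) h p = sum ?t (Pow F) + sum ?t (insert e ` Pow F)"
    unfolding cylinder_poly_def Pow_insert
    using assms by (intro sum.union_disjoint) auto
  also have "sum ?t (insert e ` Pow F) = (\<Sum>T\<in>Pow F. ?t (insert e T))"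
    using inj by (simp add: sum.reindex)
  also have "\<dots> = p * cylinder_poly F (\<lambda>T. h (insert e T)) p"
    unfolding cylinder_poly_def sum_distrib_left
  proof (rule sum.cong[OF refl])
    fix T assume "T \<in> Pow F"
    then have "finite T" "e \<notin> T" "insert e F - insert e T = F - T"
      using assms finite_subset by auto
    then show "?t (insert e T) = p * (h (insert e T) * (p ^ card T * (1 - p) ^ card (F - T)))"
      by simp
  qed
  also have "sum ?t (Pow F) = (1 - p) * cylinder_poly F h p"
    unfolding cylinder_poly_def sum_distrib_left
  proof (rule sum.cong[OF refl])
    fix T assume T: "T \<in> Pow F"
    then have "insert e F - T = insert e (F - T)" using assms by auto
    then have "card (insert e F - T) = Suc (card (F - T))" using assms by simp
    then show "?t T = (1 - p) * (h T * (p ^ card T * (1 - p) ^ card (F - T)))" by simp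
  qed
  finally show ?thesis by simp
qed

lemma cylinder_poly_cong:
  "(\<And>T. T \<subseteq> F \<Longrightarrow> h T = h' T) \<Longrightarrow> cylinder_poly F h p = cylinder_poly F h' p"
  unfolding cylinder_poly_def by (intro sum.cong) auto

lemma depends_insert:
  assumes "depends F Q" "e \<in> E"
  shows "depends (F - {e}) (\<lambda>X. Q (insert e X))"
    and "e \<in> F \<Longrightarrow> depends F (\<lambda>X. Q (insert e X))"
proof -
  show *: "depends (F - {e}) (\<lambda>X. Q (insert e X))"
  proof (rule dependsI)
    fix X assume "X \<subseteq> E"
    then have "Q (insert e X) \<longleftrightarrow> Q (insert e X \<inter> F)"
      "Q (insert e (X \<inter> (F - {e}))) \<longleftrightarrow> Q (insert e (X \<inter> (F - {e})) \<inter> F)"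
      using assms(2) by (auto intro!: dependsD[OF assms(1)])
    moreover have "insert e X \<inter> F = insert e (X \<inter> (F - {e})) \<inter> F" by auto
    ultimately show "Q (insert e X) \<longleftrightarrow> Q (insert e (X \<inter> (F - {e})))" by simp
  qed
  show "depends F (\<lambda>X. Q (insert e X))" by (rule depends_mono[OF *]) auto
qed

lemma depends_remove:
  assumes "depends F Q"
  shows "depends (F - {e}) (\<lambda>X. Q (X - {e}))" "depends F (\<lambda>X. Q (X - {e}))"
proof -
  show *: "depends (F - {e}) (\<lambda>X. Q (X - {e}))"
  proof (rule dependsI)
    fix X assume "X \<subseteq> E"
    then have "Q (X - {e}) \<longleftrightarrow> Q ((X - {e}) \<inter> F)"
      "Q (X \<inter> (F - {e}) - {e}) \<longleftrightarrow> Q ((X \<inter> (F - {e}) - {e}) \<inter> F)"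
      by (auto intro!: dependsD[OF assms])
    moreover have "(X - {e}) \<inter> F = (X \<inter> (F - {e}) - {e}) \<inter> F" by auto
    ultimately show "Q (X - {e}) \<longleftrightarrow> Q (X \<inter> (F - {e}) - {e})" by simp
  qed
  show "depends F (\<lambda>X. Q (X - {e}))" by (rule depends_mono[OF *]) auto
qed

text \<open>Induction on \<open>F\<close>, conditioning on the new edge: differentiating the weights
  \<open>p\<close> and \<open>1 - p\<close> yields the influence of that edge, and the induction
  hypothesis for both conditioned functions yields the other influences.\<close>

lemma russo_formula_cylinder_poly:
  assumes "finite F"
  shows "(cylinder_poly F h has_real_derivative
    (\<Sum>e\<in>F. cylinder_poly F (\<lambda>T. h (insert e T)) p - cylinder_poly F (\<lambda>T. h (T - {e})) p)) (at p)"
  using assms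
proof (induction F arbitrary: h rule: finite_induct)
  case empty
  then show ?case by (simp add: cylinder_poly_def[abs_def])
next
  case (insert e F)
  note rec = cylinder_poly_insert[OF insert(1,2)]
  let ?D = "\<lambda>h f. cylinder_poly F (\<lambda>T. h (insert f T)) p - cylinder_poly F (\<lambda>T. h (T - {f})) p"
  let ?D' = "\<lambda>f. cylinder_poly (insert e F) (\<lambda>T. h (insert f T)) p -
      cylinder_poly (insert e F) (\<lambda>T. h (T - {f})) p"
  let ?h = "\<lambda>T. h (insert e T)"
  have "((\<lambda>p. p * cylinder_poly F ?h p + (1 - p) * cylinder_poly F h p) has_real_derivative
      (p * (\<Sum>f\<in>F. ?D ?h f) + cylinder_poly F ?h p) +
      ((1 - p) * (\<Sum>f\<in>F. ?D h f) + (- 1) * cylinder_poly F h p)) (at p)"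
    by (rule derivative_eq_intros insert.IH refl | simp)+
  moreover have "(p * (\<Sum>f\<in>F. ?D ?h f) + cylinder_poly F ?h p) +
      ((1 - p) * (\<Sum>f\<in>F. ?D h f) + (- 1) * cylinder_poly F h p) = (\<Sum>f\<in>insert e F. ?D' f)"
  proof -
    have "?D' f = p * ?D ?h f + (1 - p) * ?D h f" if "f \<in> F" for f
    proof -
      have "f \<noteq> e" using that insert(2) by auto
      then have "insert e T - {f} = insert e (T - {f})" "insert f (insert e T) = insert e (insert f T)" for T
        by auto
      then show ?thesis by (simp add: rec algebra_simps)
    qed
    then have "(\<Sum>f\<in>F. ?D' f) = p * (\<Sum>f\<in>F. ?D ?h f) + (1 - p) * (\<Sum>f\<in>F. ?D h f)"
      by (simp add: sum.distrib sum_distrib_left)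
    moreover have "?D' e = cylinder_poly F ?h p - cylinder_poly F h p"
    proof -
      have "cylinder_poly F (\<lambda>T. h (insert e T - {e})) p = cylinder_poly F h p"
        "cylinder_poly F (\<lambda>T. h (T - {e})) p = cylinder_poly F h p"
        using insert(2) by (auto intro!: cylinder_poly_cong arg_cong[of _ _ h])
      then show ?thesis by (simp add: rec algebra_simps)
    qed
    ultimately show ?thesis using insert(1,2) by (simp add: algebra_simps)
  qed
  ultimately show ?case by (simp add: rec[abs_def])
qed

lemma russo_formula:
  assumes "finite F" "F \<subseteq> E" "depends F Q" "0 \<le> p" "p \<le> 1"
  shows "(cylinder_poly F (\<lambda>T. of_bool (Q T)) has_real_derivative
    (\<Sum>e\<in>F. pr p (\<lambda>X. Q (insert e X)) - pr p (\<lambda>X. Q (X - {e})))) (at p)"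
proof -
  have "pr p (\<lambda>X. Q (insert e X)) = cylinder_poly F (\<lambda>T. of_bool (Q (insert e T))) p"
    "pr p (\<lambda>X. Q (X - {e})) = cylinder_poly F (\<lambda>T. of_bool (Q (T - {e}))) p" if "e \<in> F" for e
  proof -
    have "depends F (\<lambda>X. Q (insert e X))" "depends F (\<lambda>X. Q (X - {e}))"
      using that assms(2,3) by (auto intro: depends_insert depends_remove)
    then show "pr p (\<lambda>X. Q (insert e X)) = cylinder_poly F (\<lambda>T. of_bool (Q (insert e T))) p"
      "pr p (\<lambda>X. Q (X - {e})) = cylinder_poly F (\<lambda>T. of_bool (Q (T - {e}))) p"
      using assms by (auto intro!: pr_depends_finite)
  qed
  then show ?thesis using russo_formula_cylinder_poly[OF assms(1), of "\<lambda>T. of_bool (Q T)" p] by simp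
qed

text \<open>For an increasing event every term of Russo's sum is nonnegative.\<close>

lemma pr_mono_parameter:
  assumes "finite F" "F \<subseteq> E" "depends F Q" "0 \<le> p" "p \<le> q" "q \<le> 1"
    and mono: "\<And>X Y. X \<subseteq> Y \<Longrightarrow> Q X \<Longrightarrow> Q Y"
  shows "pr p Q \<le> pr q Q"
proof -
  have "cylinder_poly F (\<lambda>T. of_bool (Q T)) p \<le> cylinder_poly F (\<lambda>T. of_bool (Q T)) q"
  proof (rule DERIV_nonneg_imp_nondecreasing[OF assms(5)])
    fix t assume t: "p \<le> t" "t \<le> q"
    have "0 \<le> (\<Sum>e\<in>F. pr t (\<lambda>X. Q (insert e X)) - pr t (\<lambda>X. Q (X - {e})))"
    proof (intro sum_nonneg)
      fix e assume e: "e \<in> F"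
      have "depends F (\<lambda>X. Q (insert e X))"
        using assms(2,3) e by (intro depends_insert) auto
      then have "pr t (\<lambda>X. Q (X - {e})) \<le> pr t (\<lambda>X. Q (insert e X))"
        by (intro pr_mono ev_depends_finite[OF assms(1)]) (auto elim!: mono[rotated])
      then show "0 \<le> pr t (\<lambda>X. Q (insert e X)) - pr t (\<lambda>X. Q (X - {e}))" by simp
    qed
    then show "\<exists>y. (cylinder_poly F (\<lambda>T. of_bool (Q T)) has_real_derivative y) (at t) \<and> 0 \<le> y"
      using russo_formula[OF assms(1-3), of t] t assms(4,6) by auto
  qed
  then show ?thesis using assms by (simp add: pr_depends_finite)
qed

lemma continuous_on_pr:
  assumes "finite F" "F \<subseteq> E" "depends F Q"
  shows "continuous_on {0..1} (\<lambda>p. pr p Q)"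
proof -
  have "continuous_on {0..1} (cylinder_poly F (\<lambda>T. of_bool (Q T)))"
    unfolding cylinder_poly_def[abs_def] by (intro continuous_intros)
  then show ?thesis
    by (rule continuous_on_eq) (use assms in \<open>simp add: pr_depends_finite\<close>)
qed

end

section \<open>Automorphisms, weights and the mass transport principle\<close>

context transitive_graph
begin

section \<open>Local finiteness, countability and automorphisms\<close>

lemma edge_in_V: "{u, v} \<in> E \<Longrightarrow> u \<in> V \<and> v \<in> V \<and> u \<noteq> v"
  using edges[of "{u, v}"] by (auto simp: doubleton_eq_iff)

lemma edge_subset_V: "e \<in> E \<Longrightarrow> e \<subseteq> V"
  using edges by blast

lemma finite_neighbours: "finite {u. {u, v} \<in> E}"
proof (cases "v \<in> V")
  case True
  then show ?thesis using locally_finite by (auto simp: locally_finite_def)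
next
  case False
  then have "{u. {u, v} \<in> E} = {}" using edge_in_V by blast
  then show ?thesis by (simp only: finite.emptyI)
qed

lemma finite_incident: "finite S \<Longrightarrow> finite {e \<in> E. e \<inter> S \<noteq> {}}"
proof -
  assume "finite S"
  have "{e \<in> E. e \<inter> S \<noteq> {}} \<subseteq> (\<Union>v\<in>S. (\<lambda>u. {u, v}) ` {u. {u, v} \<in> E})"
    using edges by (fastforce simp: insert_commute)
  moreover have "finite (\<Union>v\<in>S. (\<lambda>u. {u, v}) ` {u. {u, v} \<in> E})"
    using \<open>finite S\<close> finite_neighbours by (intro finite_UN_I finite_imageI)
  ultimately show ?thesis by (rule finite_subset)
qed

lemma finite_relpow: "finite {y. (x, y) \<in> adj E ^^ n}"
proof (induction n)
  case (Suc n)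
  have "{y. (x, y) \<in> adj E ^^ Suc n} \<subseteq> (\<Union>t\<in>{y. (x, y) \<in> adj E ^^ n}. {u. {u, t} \<in> E})"
    by (auto simp: adj_def insert_commute)
  moreover have "finite (\<Union>t\<in>{y. (x, y) \<in> adj E ^^ n}. {u. {u, t} \<in> E})"
    using Suc finite_neighbours by (intro finite_UN_I)
  ultimately show ?case by (rule finite_subset)
qed auto

lemma V_nonempty: "V \<noteq> {}"
  using infinite by auto

lemma component_E: "x \<in> V \<Longrightarrow> component E x = V"
proof
  show "x \<in> V \<Longrightarrow> component E x \<subseteq> V" by (rule component_closed) (auto dest: edge_in_V)
  show "x \<in> V \<Longrightarrow> V \<subseteq> component E x" using connected by (auto simp: connected_graph_def)
qed

lemma component_subset_V: "x \<in> V \<Longrightarrow> X \<subseteq> E \<Longrightarrow> component X x \<subseteq> V"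
  using component_mono[of _ X x E] component_E[of x] by auto

lemma countable_V: "countable V"
proof -
  obtain x where x: "x \<in> V" using V_nonempty by auto
  have "V \<subseteq> (\<Union>n. {y. (x, y) \<in> adj E ^^ n})"
    using component_E[OF x] component_iff_relpow[of _ E x] by blast
  then show ?thesis
    by (rule countable_subset) (auto intro: countable_finite finite_relpow)
qed

lemma countable_E: "countable E"
proof -
  have "E \<subseteq> (\<lambda>(u, v). {u, v}) ` (V \<times> V)" using edges by fastforce
  then show ?thesis by (rule countable_subset) (intro countable_image countable_SIGMA countable_V)
qed

sublocale countable_edges E
  by unfold_locales (rule countable_E)

lemma Aut_bij: "g \<in> Aut V E \<Longrightarrow> bij g"
  by (auto simp: Aut_def permutes_bij)

lemma Aut_V: "g \<in> Aut V E \<Longrightarrow> g x \<in> V \<longleftrightarrow> x \<in> V"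
  by (auto simp: Aut_def permutes_in_image)

lemma Aut_image_V: "g \<in> Aut V E \<Longrightarrow> g ` V = V"
  by (auto simp: Aut_def permutes_image)

lemma Aut_bij_betw: "g \<in> Aut V E \<Longrightarrow> bij_betw g V V"
  by (auto simp: Aut_def permutes_imp_bij)

lemma Aut_edge: "g \<in> Aut V E \<Longrightarrow> {g u, g v} \<in> E \<longleftrightarrow> {u, v} \<in> E"
  using edge_in_V[of u v] edge_in_V[of "g u" "g v"] Aut_V[of g] by (auto simp: Aut_def)

lemma Aut_id: "id \<in> Aut V E"
  by (simp add: Aut_def permutes_id)

lemma Aut_comp: "g \<in> Aut V E \<Longrightarrow> h \<in> Aut V E \<Longrightarrow> g \<circ> h \<in> Aut V E"
  using Aut_V[of h] by (auto simp: Aut_def intro: permutes_compose)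

lemma Aut_inv: "g \<in> Aut V E \<Longrightarrow> inv g \<in> Aut V E"
proof -
  assume g: "g \<in> Aut V E"
  then have p: "g permutes V" by (simp add: Aut_def)
  have "{inv g u, inv g v} \<in> E \<longleftrightarrow> {u, v} \<in> E" for u v
    using Aut_edge[OF g, of "inv g u" "inv g v"] permutes_inverses(1)[OF p] by simp
  then show ?thesis using permutes_inv[OF p] by (simp add: Aut_def)
qed

lemma Aut_inv_apply: "g \<in> Aut V E \<Longrightarrow> inv g (g x) = x" "g \<in> Aut V E \<Longrightarrow> g (inv g x) = x"
  by (auto simp: Aut_def permutes_inverses)

lemma Aut_image_E: "g \<in> Aut V E \<Longrightarrow> (`) g ` E = E"
proof -
  have sub: "(`) g ` E \<subseteq> E" if g: "g \<in> Aut V E" for g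
  proof (rule image_subsetI)
    fix e assume "e \<in> E"
    then obtain u v where "e = {u, v}" using edges by blast
    then show "g ` e \<in> E" using \<open>e \<in> E\<close> Aut_edge[OF g] by simp
  qed
  assume g: "g \<in> Aut V E"
  have "E \<subseteq> (`) g ` E"
  proof
    fix e assume "e \<in> E"
    then have "inv g ` e \<in> E" using sub[OF Aut_inv[OF g]] by auto
    moreover have "g ` (inv g ` e) = e" using Aut_inv_apply(2)[OF g] by (simp add: image_image)
    ultimately show "e \<in> (`) g ` E" by (metis imageI)
  qed
  then show ?thesis using sub[OF g] by auto
qed

lemma Aut_bij_betw_E: "g \<in> Aut V E \<Longrightarrow> bij_betw ((`) g) E E"
  using Aut_image_E Aut_bij by (auto simp: bij_betw_def bij_def inj_on_def inj_image_eq_iff)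

lemma Aut_relpow: "g \<in> Aut V E \<Longrightarrow> (g u, g v) \<in> adj E ^^ n \<longleftrightarrow> (u, v) \<in> adj E ^^ n"
  using relpow_adj_image[OF Aut_bij, where X = E and g = g] Aut_image_E[of g] by simp

section \<open>Orbits of stabilizers\<close>

lemma finite_stab_orbit:
  assumes "x \<in> V" "y \<in> V"
  shows "finite (stab_orbit V E x y)"
proof -
  have "y \<in> component E x" using component_E[OF assms(1)] assms(2) by simp
  then obtain n where n: "(x, y) \<in> adj E ^^ n" by (auto simp: component_iff_relpow)
  have "stab_orbit V E x y \<subseteq> {y. (x, y) \<in> adj E ^^ n}"
  proof
    fix z assume "z \<in> stab_orbit V E x y"
    then obtain g where "g \<in> Aut V E" "g x = x" "z = g y" by (auto simp: stab_orbit_def stabilizer_def)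
    then show "z \<in> {y. (x, y) \<in> adj E ^^ n}" using Aut_relpow[of g x y n] n by simp
  qed
  then show ?thesis using finite_relpow finite_subset by blast
qed

lemma stab_orbit_iff: "z \<in> stab_orbit V E x y \<longleftrightarrow> (\<exists>g\<in>Aut V E. g x = x \<and> g y = z)"
  by (auto simp: stab_orbit_def stabilizer_def)

lemma mem_stab_orbit: "y \<in> stab_orbit V E x y"
  unfolding stab_orbit_iff by (rule bexI[OF _ Aut_id]) simp

definition orbit_card :: "'a \<Rightarrow> 'a \<Rightarrow> nat" where
  "orbit_card x y = card (stab_orbit V E x y)"

lemma orbit_card_pos: "x \<in> V \<Longrightarrow> y \<in> V \<Longrightarrow> 0 < orbit_card x y"
  unfolding orbit_card_def using finite_stab_orbit[of x y] mem_stab_orbit[of y x]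
  by (metis card_gt_0_iff empty_iff)

lemma orbit_card_Aut:
  assumes "g \<in> Aut V E"
  shows "orbit_card (g x) (g y) = orbit_card x y"
proof -
  have "stab_orbit V E (g x) (g y) = g ` stab_orbit V E x y"
  proof (rule set_eqI)
    fix z
    have "z \<in> stab_orbit V E (g x) (g y) \<longleftrightarrow> inv g z \<in> stab_orbit V E x y"
    proof
      assume "z \<in> stab_orbit V E (g x) (g y)"
      then obtain h where h: "h \<in> Aut V E" "h (g x) = g x" "h (g y) = z" by (auto simp: stab_orbit_iff)
      then show "inv g z \<in> stab_orbit V E x y"
        unfolding stab_orbit_iff
        using assms by (intro bexI[of _ "inv g \<circ> h \<circ> g"] Aut_comp Aut_inv) (auto simp: Aut_inv_apply)
    next
      assume "inv g z \<in> stab_orbit V E x y"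
      then obtain h where h: "h \<in> Aut V E" "h x = x" "h y = inv g z" by (auto simp: stab_orbit_iff)
      then show "z \<in> stab_orbit V E (g x) (g y)"
        unfolding stab_orbit_iff
        using assms by (intro bexI[of _ "g \<circ> h \<circ> inv g"] Aut_comp Aut_inv) (auto simp: Aut_inv_apply)
    qed
    also have "\<dots> \<longleftrightarrow> z \<in> g ` stab_orbit V E x y"
      using Aut_inv_apply[OF assms] by (metis imageE imageI)
    finally show "z \<in> stab_orbit V E (g x) (g y) \<longleftrightarrow> z \<in> g ` stab_orbit V E x y" .
  qed
  moreover have "inj g" using Aut_bij[OF assms] by (simp add: bij_def)
  ultimately show ?thesis
    unfolding orbit_card_def by (simp add: card_image inj_on_subset)
qed

text \<open>The orbit of the pair \<open>(y, z)\<close> under the stabilizer of \<open>x\<close>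
  projects onto the orbit of \<open>y\<close>; each fibre is a translate of the orbit of
  \<open>z\<close> under the joint stabilizer of \<open>x\<close> and \<open>y\<close>.\<close>

lemma card_pair_orbit:
  assumes "x \<in> V" "y \<in> V" "z \<in> V"
  shows "card ((\<lambda>g. (g y, g z)) ` stabilizer V E x) =
    orbit_card x y * card ((\<lambda>g. g z) ` (stabilizer V E x \<inter> stabilizer V E y))"
proof -
  let ?P = "(\<lambda>g. (g y, g z)) ` stabilizer V E x"
  let ?K = "(\<lambda>g. g z) ` (stabilizer V E x \<inter> stabilizer V E y)"
  have sub: "?P \<subseteq> stab_orbit V E x y \<times> stab_orbit V E x z" by (auto simp: stab_orbit_def)
  then have fin: "finite ?P" using finite_stab_orbit assms by (meson finite_SigmaI finite_subset)
  have Sig: "?P = Sigma (stab_orbit V E x y) (\<lambda>y'. {z'. (y', z') \<in> ?P})"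
    by (auto simp: stab_orbit_def)
  have fib: "card {z'. (y', z') \<in> ?P} = card ?K" if y': "y' \<in> stab_orbit V E x y" for y'
  proof -
    obtain h where h: "h \<in> Aut V E" "h x = x" "h y = y'" using y' by (auto simp: stab_orbit_iff)
    have "{z'. (y', z') \<in> ?P} = h ` ?K"
    proof (intro set_eqI iffI)
      fix z' assume "z' \<in> {z'. (y', z') \<in> ?P}"
      then obtain g where g: "g \<in> Aut V E" "g x = x" "g y = y'" "g z = z'"
        by (auto simp: stabilizer_def)
      have "inv h \<circ> g \<in> stabilizer V E x \<inter> stabilizer V E y"
        using g h Aut_inv_apply(1)[OF h(1), of x] Aut_inv_apply(1)[OF h(1), of y] Aut_comp[OF Aut_inv[OF h(1)] g(1)]
        by (auto simp: stabilizer_def)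
      moreover have "z' = h ((inv h \<circ> g) z)" using g Aut_inv_apply[OF h(1)] by simp
      ultimately show "z' \<in> h ` ?K" by blast
    next
      fix z' assume "z' \<in> h ` ?K"
      then obtain g where g: "g \<in> Aut V E" "g x = x" "g y = y" "h (g z) = z'"
        by (auto simp: stabilizer_def)
      then show "z' \<in> {z'. (y', z') \<in> ?P}"
        using Aut_comp[OF h(1) g(1)] h by (auto simp: stabilizer_def image_iff intro!: bexI[of _ "h \<circ> g"])
    qed
    moreover have "inj h" using Aut_bij[OF h(1)] by (simp add: bij_def)
    ultimately show ?thesis by (simp add: card_image inj_on_subset)
  qed
  have "finite {z'. (y', z') \<in> ?P}" for y'
    by (rule finite_subset[of _ "snd ` ?P"]) (use fin in force)+
  then have "card ?P = (\<Sum>y'\<in>stab_orbit V E x y. card {z'. (y', z') \<in> ?P})"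
    by (subst Sig, subst card_SigmaI) (use finite_stab_orbit assms in auto)
  also have "\<dots> = orbit_card x y * card ?K" using fib by (simp add: orbit_card_def)
  finally show ?thesis .
qed

lemma orbit_card_cocycle:
  assumes "x \<in> V" "y \<in> V" "z \<in> V"
  shows "orbit_card x y * orbit_card y z * orbit_card z x = orbit_card x z * orbit_card z y * orbit_card y x"
proof -
  \<comment> \<open>\<open>k x y z\<close> is an orbit size under a joint stabilizer, symmetric in
    \<open>x\<close> and \<open>y\<close>. Counting the orbit of a pair in both orders relates
    \<open>orbit_card x y * k x y z\<close> to the same expression with \<open>y\<close> and
    \<open>z\<close> exchanged; the three cyclic relations multiply to the claim.\<close>
  define k where "k x y z = card ((\<lambda>g. g z) ` (stabilizer V E x \<inter> stabilizer V E y))" for x y z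
  have k_sym: "k x y z = k y x z" for x y z by (simp add: k_def Int_commute)
  have k_pos: "0 < k x y z" if "x \<in> V" "y \<in> V" "z \<in> V" for x y z
  proof -
    have "(\<lambda>g. g z) ` (stabilizer V E x \<inter> stabilizer V E y) \<subseteq> stab_orbit V E x z"
      by (auto simp: stab_orbit_def)
    moreover have "id \<in> stabilizer V E x \<inter> stabilizer V E y"
      using Aut_id by (simp add: stabilizer_def)
    ultimately show ?thesis
      unfolding k_def using finite_stab_orbit[OF that(1,3)] finite_subset by (auto simp: card_gt_0_iff)
  qed
  have sw: "orbit_card x y * k x y z = orbit_card x z * k x z y" if "x \<in> V" "y \<in> V" "z \<in> V" for x y z
  proof -
    have "(\<lambda>g. (g z, g y)) ` stabilizer V E x = prod.swap ` (\<lambda>g. (g y, g z)) ` stabilizer V E x"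
      by (auto simp: image_image)
    then have "card ((\<lambda>g. (g z, g y)) ` stabilizer V E x) = card ((\<lambda>g. (g y, g z)) ` stabilizer V E x)"
      by (simp add: card_image)
    then show ?thesis using card_pair_orbit[OF that] card_pair_orbit[OF that(1,3,2)] by (simp add: k_def)
  qed
  have 1: "orbit_card x y * k x y z = orbit_card x z * k x z y" using sw assms by blast
  have 2: "orbit_card y z * k y z x = orbit_card y x * k x y z" using sw assms k_sym by metis
  have 3: "orbit_card z x * k x z y = orbit_card z y * k y z x" using sw assms k_sym by metis
  have "(orbit_card x y * orbit_card y z * orbit_card z x) * (k x y z * k y z x * k x z y) =
      (orbit_card x y * k x y z) * (orbit_card y z * k y z x) * (orbit_card z x * k x z y)"
    by (simp add: ac_simps)
  also have "\<dots> = (orbit_card x z * orbit_card z y * orbit_card y x) * (k x y z * k y z x * k x z y)"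
    unfolding 1 2 3 by (simp add: ac_simps)
  finally show ?thesis
    using k_pos[OF assms] k_pos[OF assms(2,3,1)] k_pos[OF assms(1,3,2)] by simp
qed

end

section \<open>Weights and mass transport\<close>

locale weighted_graph = transitive_graph +
  fixes a :: 'a
  assumes a_in_V: "a \<in> V"
begin

definition w :: "'a \<Rightarrow> real" where
  "w x = weight V E a x"

lemma w_pos: "x \<in> V \<Longrightarrow> 0 < w x"
  unfolding w_def weight_def using orbit_card_pos a_in_V by (simp add: orbit_card_def)

text \<open>The cocycle identity eliminates the reference vertex \<open>a\<close>, which makes
  weight ratios invariant under automorphisms.\<close>

lemma w_ratio:
  assumes "x \<in> V" "z \<in> V"
  shows "w z / w x = real (orbit_card z x) / real (orbit_card x z)"
proof -
  have "w x = real (orbit_card x a) / real (orbit_card a x)" for x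
    by (simp add: w_def weight_def orbit_card_def)
  moreover have "real (orbit_card x a) > 0" "real (orbit_card a x) > 0" "real (orbit_card a z) > 0"
      "real (orbit_card x z) > 0"
    using orbit_card_pos assms a_in_V by simp_all
  moreover have "real (orbit_card a x) * real (orbit_card x z) * real (orbit_card z a) =
      real (orbit_card a z) * real (orbit_card z x) * real (orbit_card x a)"
    using orbit_card_cocycle[OF a_in_V assms] by (metis of_nat_mult)
  moreover have "(za / az) / (xa / ax) = zx / xz"
    if "xa > 0" "ax > 0" "az > 0" "xz > 0" "ax * xz * za = az * zx * xa" for xa ax az za zx xz :: real
    using that by (simp add: field_simps)
  ultimately show ?thesis by metis
qed

lemma w_ratio_Aut: "g \<in> Aut V E \<Longrightarrow> x \<in> V \<Longrightarrow> z \<in> V \<Longrightarrow> w (g z) / w (g x) = w z / w x"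
  by (simp add: w_ratio Aut_V orbit_card_Aut)

text \<open>An automorphism multiplies all weights by one common factor, so only relative heights
  are invariant; this is why events compare \<open>w z\<close> with \<open>c * w x\<close> instead
  of a constant.\<close>

lemma w_le_Aut:
  "g \<in> Aut V E \<Longrightarrow> x \<in> V \<Longrightarrow> z \<in> V \<Longrightarrow> c * w (g x) \<le> w (g z) \<longleftrightarrow> c * w x \<le> w z"
  using w_ratio_Aut[of g x z] w_pos[of x] w_pos[of "g x"]
  by (simp add: Aut_V flip: pos_le_divide_eq)

text \<open>Double counting of the pairs \<open>(y, z)\<close> for which one automorphism takes
  \<open>y\<close> to \<open>x\<close> and \<open>x\<close> to \<open>z\<close>; invariance gives
  \<open>f y x = f x z\<close> for these. Each \<open>y\<close> has \<open>orbit_card x z\<close>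
  partners, each \<open>z\<close> has \<open>orbit_card z x\<close>, and the quotient of the two
  numbers is the weight ratio.\<close>

lemma mass_transport:
  fixes f :: "'a \<Rightarrow> 'a \<Rightarrow> ennreal"
  assumes inv: "\<And>g x y. g \<in> Aut V E \<Longrightarrow> x \<in> V \<Longrightarrow> y \<in> V \<Longrightarrow> f (g x) (g y) = f x y"
    and x: "x \<in> V"
  shows "(\<integral>\<^sup>+y. f y x \<partial>count_space V) = (\<integral>\<^sup>+z. f x z * ennreal (w z / w x) \<partial>count_space V)"
proof -
  define related where "related y z \<longleftrightarrow> (\<exists>g\<in>Aut V E. g y = x \<and> g x = z)" for y z
  have A: "{z \<in> V. related y z} = stab_orbit V E x z" if rel: "related y z" "y \<in> V" "z \<in> V" for y z
  proof (intro set_eqI iffI)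
    obtain g where g: "g \<in> Aut V E" "g y = x" "g x = z" using rel by (auto simp: related_def)
    fix z'
    {
      assume "z' \<in> {z \<in> V. related y z}"
      then obtain h where h: "h \<in> Aut V E" "h y = x" "h x = z'" by (auto simp: related_def)
      then show "z' \<in> stab_orbit V E x z"
        unfolding stab_orbit_iff using g Aut_inv_apply(1)[OF g(1), of y] Aut_inv_apply(1)[OF g(1), of x]
        by (intro bexI[of _ "h \<circ> inv g"] Aut_comp Aut_inv) auto
    next
      assume "z' \<in> stab_orbit V E x z"
      then obtain h where h: "h \<in> Aut V E" "h x = x" "h z = z'" by (auto simp: stab_orbit_iff)
      then show "z' \<in> {z \<in> V. related y z}"
        unfolding related_def using g Aut_V rel(3) by (auto intro!: bexI[of _ "h \<circ> g"] Aut_comp)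
    }
  qed
  have B: "{y \<in> V. related y z} = stab_orbit V E x y" if rel: "related y z" "y \<in> V" "z \<in> V" for y z
  proof (intro set_eqI iffI)
    obtain g where g: "g \<in> Aut V E" "g y = x" "g x = z" using rel by (auto simp: related_def)
    fix y'
    {
      assume "y' \<in> {y \<in> V. related y z}"
      then obtain h where h: "h \<in> Aut V E" "h y' = x" "h x = z" by (auto simp: related_def)
      then show "y' \<in> stab_orbit V E x y"
        unfolding stab_orbit_iff using g Aut_inv_apply(1)[OF h(1), of y'] Aut_inv_apply(1)[OF h(1), of x]
        by (intro bexI[of _ "inv h \<circ> g"] Aut_comp Aut_inv) auto
    next
      assume "y' \<in> stab_orbit V E x y"
      then obtain h where h: "h \<in> Aut V E" "h x = x" "h y = y'" by (auto simp: stab_orbit_iff)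
      then show "y' \<in> {y \<in> V. related y z}"
        unfolding related_def using g Aut_V[OF h(1), of y] rel(2) Aut_inv_apply(1)[OF h(1), of y] Aut_inv_apply(1)[OF h(1), of x]
        by (auto intro!: bexI[of _ "g \<circ> inv h"] Aut_comp Aut_inv)
    }
  qed
  have exA: "\<exists>z\<in>V. related y z" if "y \<in> V" for y
    using transitive[OF that x] Aut_V x by (auto simp: related_def)
  have exB: "\<exists>y\<in>V. related y z" if z: "z \<in> V" for z
  proof -
    obtain g where g: "g \<in> Aut V E" "g x = z" using transitive[OF x z] by blast
    then have "inv g x \<in> V" "g (inv g x) = x" using Aut_V[OF Aut_inv[OF g(1)]] x Aut_inv_apply[OF g(1)] by auto
    then show ?thesis using g by (auto simp: related_def)
  qed
  have f_rel: "f y x = f x z" if "related y z" "y \<in> V" for y z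
    using that inv x by (auto simp: related_def)
  \<comment> \<open>Splits \<open>f y x\<close> equally among the partners \<open>z\<close> of
    \<open>y\<close>. Summing over \<open>z\<close> restores it, and summing over \<open>y\<close>
    gives the weighted mass sent.\<close>
  let ?h = "\<lambda>y z. f x z / ennreal (orbit_card x z) * indicator {z. related y z} z"
  have 1: "f y x = (\<integral>\<^sup>+z. ?h y z \<partial>count_space V)" if y: "y \<in> V" for y
  proof -
    obtain z0 where z0: "z0 \<in> V" "related y z0" using exA y by blast
    have A0: "{z \<in> V. related y z} = stab_orbit V E x z0" using A z0 y by blast
    have c: "orbit_card x z = orbit_card x z0" if "z \<in> V" "related y z" for z
      using A[OF that(2) y that(1)] A0 by (simp add: orbit_card_def)
    have "(\<integral>\<^sup>+z. ?h y z \<partial>count_space V) =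
        (\<integral>\<^sup>+z. f y x / ennreal (orbit_card x z0) * indicator {z \<in> V. related y z} z \<partial>count_space V)"
      by (rule nn_integral_cong) (auto simp: indicator_def f_rel[OF _ y] c)
    also have "\<dots> = f y x / ennreal (orbit_card x z0) * emeasure (count_space V) {z \<in> V. related y z}"
      by (rule nn_integral_cmult_indicator) auto
    also have "emeasure (count_space V) {z \<in> V. related y z} = ennreal (orbit_card x z0)"
      using A0 finite_stab_orbit[OF x z0(1)]
      by (subst emeasure_count_space_finite) (auto simp: orbit_card_def ennreal_of_nat_eq_real_of_nat)
    also have "f y x / ennreal (orbit_card x z0) * ennreal (orbit_card x z0) = f y x"
      using orbit_card_pos[OF x z0(1)]
      by (subst ennreal_divide_times, subst ennreal_divide_self) auto
    finally show ?thesis by simp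
  qed
  have 2: "(\<integral>\<^sup>+y. ?h y z \<partial>count_space V) = f x z * ennreal (w z / w x)" if z: "z \<in> V" for z
  proof -
    obtain y0 where y0: "y0 \<in> V" "related y0 z" using exB z by blast
    have B0: "{y \<in> V. related y z} = stab_orbit V E x y0" using B y0 z by blast
    \<comment> \<open>The automorphism taking \<open>y0\<close> to \<open>x\<close> and
      \<open>x\<close> to \<open>z\<close> carries the pair \<open>(x, y0)\<close> to
      \<open>(z, x)\<close>.\<close>
    have c: "orbit_card x y0 = orbit_card z x"
      using y0(2) orbit_card_Aut unfolding related_def by metis
    have "(\<integral>\<^sup>+y. ?h y z \<partial>count_space V) =
        (\<integral>\<^sup>+y. f x z / ennreal (orbit_card x z) * indicator {y \<in> V. related y z} y \<partial>count_space V)"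
      by (rule nn_integral_cong) (auto simp: indicator_def)
    also have "\<dots> = f x z / ennreal (orbit_card x z) * emeasure (count_space V) {y \<in> V. related y z}"
      by (rule nn_integral_cmult_indicator) auto
    also have "emeasure (count_space V) {y \<in> V. related y z} = ennreal (orbit_card z x)"
      using B0 finite_stab_orbit[OF x y0(1)] c
      by (subst emeasure_count_space_finite) (auto simp: orbit_card_def ennreal_of_nat_eq_real_of_nat)
    also have "f x z / ennreal (orbit_card x z) * ennreal (orbit_card z x) = f x z * ennreal (w z / w x)"
      unfolding w_ratio[OF x z] using orbit_card_pos[OF x z]
      by (subst divide_ennreal[symmetric]) (auto simp: divide_ennreal_def ac_simps)
    finally show ?thesis .
  qed
  have "(\<integral>\<^sup>+y. f y x \<partial>count_space V) = (\<integral>\<^sup>+y. (\<integral>\<^sup>+z. ?h y z \<partial>count_space V) \<partial>count_space V)"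
    by (rule nn_integral_cong) (simp add: 1)
  also have "\<dots> = (\<integral>\<^sup>+z. (\<integral>\<^sup>+y. ?h y z \<partial>count_space V) \<partial>count_space V)"
    by (rule nn_integral_count_space_nn_integral) (auto intro: countable_V)
  also have "\<dots> = (\<integral>\<^sup>+z. f x z * ennreal (w z / w x) \<partial>count_space V)"
    by (rule nn_integral_cong) (simp add: 2)
  finally show ?thesis .
qed

end

section \<open>Sharpness of the phase transition\<close>

context transitive_graph
begin

lemma pr_Aut:
  assumes "g \<in> Aut V E" "ev R" "\<And>X. X \<subseteq> E \<Longrightarrow> Q ((`) g ` X) \<longleftrightarrow> R X"
  shows "pr p Q = pr p R"
proof -
  have "ev (\<lambda>X. Q ((`) g ` X))" using assms(2,3) ev_cong by metis
  then have "pr p (\<lambda>X. Q ((`) g ` X)) = pr p Q" by (intro pr_image Aut_bij_betw_E assms(1))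
  moreover have "pr p (\<lambda>X. Q ((`) g ` X)) = pr p R" using assms(3) by (rule pr_cong)
  ultimately show ?thesis by simp
qed

section \<open>Bounding the susceptibility by a finite set with \<open>phi\<close> below 1\<close>

definition boundary :: "'a set \<Rightarrow> ('a \<times> 'a) set" where
  "boundary S = {(x, y). x \<in> S \<and> y \<notin> S \<and> {x, y} \<in> E}"

text \<open>The Duminil-Copin-Tassion functional: the expected number of open edges leaving
  \<open>S\<close> whose inner endpoint is joined to \<open>v\<close> inside \<open>S\<close>. The
  leaving edge is independent of that connection and contributes the factor
  \<open>p\<close>.\<close>

definition phi :: "real \<Rightarrow> 'a set \<Rightarrow> 'a \<Rightarrow> real" where
  "phi p S v = p * (\<Sum>(x, y)\<in>boundary S. pr p (\<lambda>X. x \<in> component {e \<in> X. e \<subseteq> S} v))"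

text \<open>Truncating path lengths turns the recursion for the susceptibility into an induction on
  \<open>n\<close>, so no possibly infinite sum has to be cancelled.\<close>

definition reach :: "nat \<Rightarrow> 'a set set \<Rightarrow> 'a \<Rightarrow> 'a \<Rightarrow> bool" where
  "reach n X x y \<longleftrightarrow> (\<exists>k\<le>n. (x, y) \<in> adj X ^^ k)"

lemma ev_reach: "ev (\<lambda>X. reach n {e \<in> X. P e} x y)" "ev (\<lambda>X. reach n X x y)"
  unfolding reach_def by (intro ev_ex ev_conj ev_const ev_relpow ev_relpow_UNIV)+

lemma finite_boundary: "finite S \<Longrightarrow> finite (boundary S)"
proof -
  assume "finite S"
  have "boundary S \<subseteq> Sigma S (\<lambda>x. {y. {y, x} \<in> E})"
    by (auto simp: boundary_def insert_commute)
  then show ?thesis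
    using \<open>finite S\<close> finite_neighbours by (meson finite_SigmaI finite_subset)
qed

text \<open>Take the last exit from the cluster \<open>C\<close> of \<open>v\<close> inside
  \<open>S\<close>. The next vertex is not in \<open>S\<close>, since otherwise the edge would lie
  inside \<open>S\<close> and the vertex in \<open>C\<close>.\<close>

lemma reach_leave:
  assumes "reach (Suc n) X v z" "v \<in> S" "z \<notin> S"
  defines "C \<equiv> component {e \<in> X. e \<subseteq> S} v"
  shows "\<exists>x\<in>C. \<exists>y. y \<notin> S \<and> {x, y} \<in> X \<and> reach n {e \<in> X. e \<inter> C = {}} y z"
proof -
  have C: "C \<subseteq> S" unfolding C_def using assms(2) by (intro component_closed) auto
  obtain k where k: "k \<le> Suc n" "(v, z) \<in> adj X ^^ k" using assms(1) by (auto simp: reach_def)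
  have "v \<in> C" by (simp add: C_def component_refl)
  then obtain x y j where *: "x \<in> C" "y \<notin> C" "{x, y} \<in> X" "j < k"
      "(y, z) \<in> adj {e \<in> X. e \<inter> C = {}} ^^ j"
    using relpow_last_exit[OF k(2), of C] C assms(3) by blast
  have "y \<notin> S"
  proof
    assume "y \<in> S"
    then have "{x, y} \<in> {e \<in> X. e \<subseteq> S}" using * C by auto
    then have "y \<in> C" using *(1) component_edge[of x "{e \<in> X. e \<subseteq> S}" v y] by (simp add: C_def)
    then show False using * by simp
  qed
  moreover have "reach n {e \<in> X. e \<inter> C = {}} y z"
    unfolding reach_def using * k by (intro exI[of _ j]) auto
  ultimately show ?thesis using * by blast
qed

lemma pr_component_eq:
  assumes "finite S" "C \<subseteq> S"
  shows "ev (\<lambda>X. component {e \<in> X. e \<subseteq> S} v = C)"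
    and "depends {e. e \<subseteq> S \<and> e \<inter> C \<noteq> {}} (\<lambda>X. component {e \<in> X. e \<subseteq> S} v = C)"
proof -
  show *: "depends {e. e \<subseteq> S \<and> e \<inter> C \<noteq> {}} (\<lambda>X. component {e \<in> X. e \<subseteq> S} v = C)"
  proof (rule dependsI)
    fix X
    show "component {e \<in> X. e \<subseteq> S} v = C \<longleftrightarrow>
        component {e \<in> X \<inter> {e. e \<subseteq> S \<and> e \<inter> C \<noteq> {}}. e \<subseteq> S} v = C"
      by (rule iffI; erule component_cong; auto)
  qed
  have "finite {e. e \<subseteq> S \<and> e \<inter> C \<noteq> {}}"
    by (rule finite_subset[of _ "Pow S"]) (use assms in auto)
  then show "ev (\<lambda>X. component {e \<in> X. e \<subseteq> S} v = C)"
    using * by (rule ev_depends_finite)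
qed

text \<open>Sum over the cluster \<open>C\<close> of \<open>v\<close> inside \<open>S\<close>. Three
  disjoint edge sets are involved: edges inside \<open>S\<close> touching \<open>C\<close> decide
  \<open>C\<close>, the leaving edge is not inside \<open>S\<close> but touches \<open>C\<close>,
  and the remaining path avoids \<open>C\<close>.\<close>

lemma pr_reach_Suc_le:
  assumes S: "finite S" "v \<in> S" and p: "0 \<le> p" "p \<le> 1" and z: "z \<notin> S"
  shows "pr p (\<lambda>X. reach (Suc n) X v z) \<le>
    (\<Sum>(x, y)\<in>boundary S. p * pr p (\<lambda>X. x \<in> component {e \<in> X. e \<subseteq> S} v) * pr p (\<lambda>X. reach n X y z))"
proof -
  let ?A = "\<lambda>C X. component {e \<in> X. e \<subseteq> S} v = C"
  let ?I = "Sigma (boundary S) (\<lambda>xy. {C \<in> Pow S. fst xy \<in> C})"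
  let ?h = "\<lambda>xy C. pr p (?A C) * (p * pr p (\<lambda>X. reach n X (snd xy) z))"
  let ?Q = "\<lambda>((x, y), C) X. ?A C X \<and> {x, y} \<in> X \<and> reach n {e \<in> X. e \<inter> C = {}} y z"
  have fin: "finite ?I" using S finite_boundary by auto
  have evQ: "ev (?Q i)" if "i \<in> ?I" for i
    using that by (auto intro!: ev_conj pr_component_eq(1)[OF S(1)] ev_reach ev_mem simp del: mem_Collect_eq split: prod.splits)
  have "pr p (\<lambda>X. reach (Suc n) X v z) \<le> pr p (\<lambda>X. \<exists>i\<in>?I. ?Q i X)"
  proof (rule pr_mono)
    show "ev (\<lambda>X. \<exists>i\<in>?I. ?Q i X)" using fin evQ by (intro ev_bex countable_finite)
    fix X assume X: "X \<subseteq> E" "reach (Suc n) X v z"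
    define C where "C = component {e \<in> X. e \<subseteq> S} v"
    have C: "C \<subseteq> S" unfolding C_def using S(2) by (intro component_closed) auto
    obtain x y where "x \<in> C" "y \<notin> S" "{x, y} \<in> X" "reach n {e \<in> X. e \<inter> C = {}} y z"
      using reach_leave[OF X(2) S(2) z] unfolding C_def by blast
    then have "((x, y), C) \<in> ?I" "?Q ((x, y), C) X"
      using C X by (auto simp: boundary_def C_def)
    then show "\<exists>i\<in>?I. ?Q i X" by blast
  qed
  also have "\<dots> \<le> (\<Sum>i\<in>?I. pr p (?Q i))" using fin evQ by (rule pr_bex_finite_le)
  also have "\<dots> \<le> (\<Sum>(xy, C)\<in>?I. ?h xy C)"
  proof (rule sum_mono)
    fix i assume "i \<in> ?I"
    then obtain x y C where i: "i = ((x, y), C)" "x \<in> S" "y \<notin> S" "{x, y} \<in> E" "C \<subseteq> S" "x \<in> C"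
      by (auto simp: boundary_def)
    let ?R = "\<lambda>X. reach n {e \<in> X. e \<inter> C = {}} y z"
    have depR: "depends {e. e \<inter> C = {}} ?R"
      by (rule dependsI) (auto intro!: arg_cong[of _ _ "\<lambda>X. reach n X y z"])
    have depe: "depends {{x, y}} (\<lambda>X. {x, y} \<in> X)" by (rule dependsI) auto
    have "pr p (?Q i) = pr p (?A C) * pr p (\<lambda>X. {x, y} \<in> X \<and> ?R X)"
      unfolding i(1) prod.case
    proof (rule pr_indep)
      show "depends {e. e \<subseteq> S \<and> e \<inter> C \<noteq> {}} (?A C)" using pr_component_eq(2)[OF S(1) i(5)] .
      show "depends ({{x, y}} \<union> {e. e \<inter> C = {}}) (\<lambda>X. {x, y} \<in> X \<and> ?R X)"
        by (intro depends_conj depends_mono[OF depe] depends_mono[OF depR]) auto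
      show "{e. e \<subseteq> S \<and> e \<inter> C \<noteq> {}} \<inter> ({{x, y}} \<union> {e. e \<inter> C = {}}) = {}" using i by auto
    qed (use pr_component_eq(1)[OF S(1) i(5)] ev_reach in auto)
    also have "pr p (\<lambda>X. {x, y} \<in> X \<and> ?R X) = pr p (\<lambda>X. {x, y} \<in> X) * pr p ?R"
      by (rule pr_indep[OF _ _ depe depR]) (use i ev_reach in auto)
    also have "pr p (\<lambda>X. {x, y} \<in> X) = p" using pr_open[OF i(4) p] .
    \<comment> \<open>Forgetting that the path avoids \<open>C\<close> only increases its
      probability, and makes this factor independent of \<open>C\<close>.\<close>
    also have "pr p (?A C) * (p * pr p ?R) \<le> pr p (?A C) * (p * pr p (\<lambda>X. reach n X y z))"
      using p by (intro mult_left_mono pr_mono ev_reach)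
        (auto simp: reach_def intro: relpow_adj_mono)
    finally show "pr p (?Q i) \<le> (case i of (xy, C) \<Rightarrow> ?h xy C)"
      by (simp add: i(1))
  qed
  also have "\<dots> = (\<Sum>xy\<in>boundary S. \<Sum>C\<in>{C \<in> Pow S. fst xy \<in> C}. ?h xy C)"
    using S finite_boundary by (intro sum.Sigma[symmetric]) auto
  also have "\<dots> = (\<Sum>(x, y)\<in>boundary S. p * pr p (\<lambda>X. x \<in> component {e \<in> X. e \<subseteq> S} v) * pr p (\<lambda>X. reach n X y z))"
  proof (rule sum.cong[OF refl])
    fix xy assume "xy \<in> boundary S"
    obtain x y where xy: "xy = (x, y)" by (cases xy)
    have "pr p (\<lambda>X. x \<in> component {e \<in> X. e \<subseteq> S} v) = pr p (\<lambda>X. \<exists>C\<in>{C \<in> Pow S. x \<in> C}. ?A C X)"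
    proof (rule pr_cong)
      fix X
      have "component {e \<in> X. e \<subseteq> S} v \<subseteq> S" using S(2) by (intro component_closed) auto
      then show "x \<in> component {e \<in> X. e \<subseteq> S} v \<longleftrightarrow> (\<exists>C\<in>{C \<in> Pow S. x \<in> C}. ?A C X)" by auto
    qed
    also have "\<dots> = (\<Sum>C\<in>{C \<in> Pow S. x \<in> C}. pr p (?A C))"
      using S pr_component_eq(1)[OF S(1)] by (intro pr_bex_finite) auto
    finally show "(\<Sum>C\<in>{C \<in> Pow S. fst xy \<in> C}. ?h xy C) =
        (case xy of (x, y) \<Rightarrow> p * pr p (\<lambda>X. x \<in> component {e \<in> X. e \<subseteq> S} v) * pr p (\<lambda>X. reach n X y z))"
      by (simp add: xy sum_distrib_right[symmetric])
  qed
  finally show ?thesis .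
qed

lemma pr_reach_Aut: "g \<in> Aut V E \<Longrightarrow> pr p (\<lambda>X. reach n X (g x) (g y)) = pr p (\<lambda>X. reach n X x y)"
  by (rule pr_Aut[OF _ ev_reach(2)]) (auto simp: reach_def relpow_adj_image[OF Aut_bij])

lemma sum_reach_transitive:
  assumes "x \<in> V" "y \<in> V"
  shows "(\<integral>\<^sup>+z. ennreal (pr p (\<lambda>X. reach n X y z)) \<partial>count_space V) =
    (\<integral>\<^sup>+z. ennreal (pr p (\<lambda>X. reach n X x z)) \<partial>count_space V)"
proof -
  obtain g where g: "g \<in> Aut V E" "g x = y" using transitive assms by blast
  have "(\<integral>\<^sup>+z. ennreal (pr p (\<lambda>X. reach n X y z)) \<partial>count_space V) =
      (\<integral>\<^sup>+z. ennreal (pr p (\<lambda>X. reach n X (g x) (g z))) \<partial>count_space V)"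
    using nn_integral_bij_count_space[OF Aut_bij_betw[OF g(1)], of "\<lambda>z. ennreal (pr p (\<lambda>X. reach n X y z))"]
    by (simp add: g(2))
  then show ?thesis by (simp add: pr_reach_Aut[OF g(1)])
qed

lemma susceptibility_reach_bound:
  assumes S: "finite S" "v \<in> S" "v \<in> V" "S \<subseteq> V" and p: "0 \<le> p" "p \<le> 1" and phi: "phi p S v < 1"
  shows "(\<integral>\<^sup>+z. ennreal (pr p (\<lambda>X. reach n X v z)) \<partial>count_space V) \<le>
    ennreal (card S / (1 - phi p S v))"
proof (induction n)
  define B where "B = card S / (1 - phi p S v)"
  define c where "c x = p * pr p (\<lambda>X. x \<in> component {e \<in> X. e \<subseteq> S} v)" for x
  have c: "0 \<le> c x" for x using p by (simp add: c_def)
  have phi_c: "phi p S v = (\<Sum>(x, y)\<in>boundary S. c x)"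
    by (simp add: phi_def c_def sum_distrib_left split_beta)
  have phi0: "0 \<le> phi p S v" unfolding phi_c using c by (intro sum_nonneg) auto
  have B0: "0 \<le> B" using phi by (simp add: B_def)
  \<comment> \<open>\<open>B\<close> is the fixed point of the recursion: vertices of
    \<open>S\<close> contribute at most \<open>card S\<close>, and the others are reached through a
    boundary edge and then within \<open>n\<close> steps from its outer end. So the bound
    \<open>B\<close> for \<open>n\<close> reproduces itself for \<open>Suc n\<close>.\<close>
  have B: "card S + phi p S v * B = B" using phi by (simp add: B_def field_simps)
  have ind: "(\<integral>\<^sup>+z. indicator S z \<partial>count_space V) = ennreal (card S)"
    using S by (subst nn_integral_indicator) (auto simp: emeasure_count_space_finite ennreal_of_nat_eq_real_of_nat)
  {
    case 0
    have "(\<integral>\<^sup>+z. ennreal (pr p (\<lambda>X. reach 0 X v z)) \<partial>count_space V) \<le> (\<integral>\<^sup>+z. indicator S z \<partial>count_space V)"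
    proof (rule nn_integral_mono)
      fix z
      show "ennreal (pr p (\<lambda>X. reach 0 X v z)) \<le> indicator S z"
      proof (cases "z \<in> S")
        case True
        then show ?thesis by (simp add: indicator_def)
      next
        case False
        then have "(\<lambda>X. reach 0 X v z) = (\<lambda>X. False)" using S(2) by (auto simp: reach_def fun_eq_iff)
        then show ?thesis by (simp add: pr_def event_def)
      qed
    qed
    also have "\<dots> = ennreal (card S)" by (rule ind)
    also have "\<dots> \<le> ennreal B" using B mult_nonneg_nonneg[OF phi0 B0] by (intro ennreal_leI) linarith
    finally show ?case by (simp add: B_def)
  next
    case (Suc n)
    let ?g = "\<lambda>y z. ennreal (pr p (\<lambda>X. reach n X y z))"
    have "(\<integral>\<^sup>+z. ennreal (pr p (\<lambda>X. reach (Suc n) X v z)) \<partial>count_space V) \<le>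
        (\<integral>\<^sup>+z. indicator S z + (\<Sum>(x, y)\<in>boundary S. ennreal (c x) * ?g y z) \<partial>count_space V)"
    proof (rule nn_integral_mono)
      fix z
      show "ennreal (pr p (\<lambda>X. reach (Suc n) X v z)) \<le>
          indicator S z + (\<Sum>(x, y)\<in>boundary S. ennreal (c x) * ?g y z)"
      proof (cases "z \<in> S")
        case True
        have "ennreal (pr p (\<lambda>X. reach (Suc n) X v z)) \<le> 1" by simp
        then show ?thesis using True by (simp add: indicator_def add_increasing2)
      next
        case False
        have "(\<Sum>(x, y)\<in>boundary S. ennreal (c x) * ?g y z) =
            ennreal (\<Sum>(x, y)\<in>boundary S. c x * pr p (\<lambda>X. reach n X y z))"
          using c by (subst sum_ennreal[symmetric]) (auto simp: ennreal_mult intro!: sum.cong)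
        moreover have "pr p (\<lambda>X. reach (Suc n) X v z) \<le> (\<Sum>(x, y)\<in>boundary S. c x * pr p (\<lambda>X. reach n X y z))"
          using pr_reach_Suc_le[OF S(1,2) p False] by (simp add: c_def)
        ultimately show ?thesis using False by (simp add: indicator_def ennreal_leI)
      qed
    qed
    also have "\<dots> = (\<integral>\<^sup>+z. indicator S z \<partial>count_space V) +
        (\<Sum>(x, y)\<in>boundary S. ennreal (c x) * (\<integral>\<^sup>+z. ?g y z \<partial>count_space V))"
      by (subst nn_integral_add) (auto simp: split_beta nn_integral_sum nn_integral_cmult)
    also have "\<dots> \<le> ennreal (card S) + (\<Sum>(x, y)\<in>boundary S. ennreal (c x) * ennreal B)"
    proof (intro add_mono sum_mono)
      fix xy assume "xy \<in> boundary S"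
      then obtain x y where xy: "xy = (x, y)" "y \<in> V" using edge_in_V by (auto simp: boundary_def)
      have "(\<integral>\<^sup>+z. ?g y z \<partial>count_space V) \<le> ennreal B"
        using sum_reach_transitive[OF S(3) xy(2)] Suc by (simp add: B_def)
      then show "(case xy of (x, y) \<Rightarrow> ennreal (c x) * (\<integral>\<^sup>+z. ?g y z \<partial>count_space V)) \<le>
          (case xy of (x, y) \<Rightarrow> ennreal (c x) * ennreal B)"
        by (auto simp: xy(1) intro: mult_left_mono)
    qed (simp add: ind)
    also have "(\<Sum>(x, y)\<in>boundary S. ennreal (c x) * ennreal B) = ennreal (phi p S v * B)"
      unfolding phi_c sum_distrib_right using c B0
      by (subst sum_ennreal[symmetric]) (auto simp: ennreal_mult split_beta intro!: sum.cong)
    also have "ennreal (card S) + ennreal (phi p S v * B) = ennreal B"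
      using phi0 B0 B by (simp flip: ennreal_plus)
    finally show ?case by (simp add: B_def)
  }
qed

text \<open>For a finite vertex set \<open>\<Lambda>\<close>, the event \<open>unreached \<Lambda> S\<close> says that \<open>S\<close> is the set of vertices
  of \<open>\<Lambda>\<close> that are not connected to the complement of \<open>\<Lambda>\<close>. This formulation shows that it does not
  depend on the edges inside \<open>S\<close>.\<close>

definition unreached :: "'a set \<Rightarrow> 'a set \<Rightarrow> 'a set set \<Rightarrow> bool" where
  "unreached \<Lambda> S X \<longleftrightarrow> (\<forall>x\<in>S. \<forall>y. y \<notin> S \<longrightarrow> {x, y} \<notin> X) \<and>
    (\<forall>v\<in>\<Lambda> - S. \<exists>z. z \<notin> \<Lambda> \<and> z \<in> component {e \<in> {e \<in> X. e \<inter> \<Lambda> \<noteq> {}}. e \<inter> S = {}} v)"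

section \<open>Pivotal edges and the differential inequality\<close>

lemma unreached_eq:
  assumes "unreached \<Lambda> S X" "S \<subseteq> \<Lambda>"
  shows "S = {v \<in> \<Lambda>. \<not> (\<exists>z. z \<notin> \<Lambda> \<and> z \<in> component {e \<in> X. e \<inter> \<Lambda> \<noteq> {}} v)}"
proof (intro set_eqI iffI)
  fix v assume v: "v \<in> S"
  then have "component {e \<in> X. e \<inter> \<Lambda> \<noteq> {}} v \<subseteq> S"
    using assms by (intro component_closed) (auto simp: unreached_def)
  then show "v \<in> {v \<in> \<Lambda>. \<not> (\<exists>z. z \<notin> \<Lambda> \<and> z \<in> component {e \<in> X. e \<inter> \<Lambda> \<noteq> {}} v)}"
    using assms(2) v by auto
next
  fix v assume v: "v \<in> {v \<in> \<Lambda>. \<not> (\<exists>z. z \<notin> \<Lambda> \<and> z \<in> component {e \<in> X. e \<inter> \<Lambda> \<noteq> {}} v)}"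
  show "v \<in> S"
  proof (rule ccontr)
    assume "v \<notin> S"
    then obtain z where "z \<notin> \<Lambda>" "z \<in> component {e \<in> {e \<in> X. e \<inter> \<Lambda> \<noteq> {}}. e \<inter> S = {}} v"
      using assms v unfolding unreached_def by blast
    then show False using v component_mono[of z _ v "{e \<in> X. e \<inter> \<Lambda> \<noteq> {}}"] by blast
  qed
qed

lemma unreached_exists:
  assumes "X \<subseteq> E"
  shows "unreached \<Lambda> {v \<in> \<Lambda>. \<not> (\<exists>z. z \<notin> \<Lambda> \<and> z \<in> component {e \<in> X. e \<inter> \<Lambda> \<noteq> {}} v)} X"
    (is "unreached \<Lambda> ?S X")
  unfolding unreached_def
proof (intro conjI ballI allI impI)
  let ?Y = "{e \<in> X. e \<inter> \<Lambda> \<noteq> {}}"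
  fix x y assume x: "x \<in> ?S" and y: "y \<notin> ?S"
  show "{x, y} \<notin> X"
  proof
    assume "{x, y} \<in> X"
    then have xy: "y \<in> component ?Y x"
      using x by (intro component_edge[OF component_refl]) auto
    show False
    proof (cases "y \<in> \<Lambda>")
      case True
      then obtain z where "z \<notin> \<Lambda>" "z \<in> component ?Y y" using y by auto
      then show False using xy x component_trans by fastforce
    qed (use xy x in auto)
  qed
next
  let ?Y = "{e \<in> X. e \<inter> \<Lambda> \<noteq> {}}"
  fix v assume v: "v \<in> \<Lambda> - ?S"
  then obtain z where z: "z \<notin> \<Lambda>" "z \<in> component ?Y v" by auto
  have disj: "component ?Y v \<inter> ?S = {}"
  proof (rule ccontr)
    assume "component ?Y v \<inter> ?S \<noteq> {}"
    then obtain u where u: "u \<in> component ?Y v" "u \<in> ?S" by blast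
    then have "z \<in> component ?Y u" using z component_eq by metis
    then show False using u z by auto
  qed
  have "component {e \<in> ?Y. e \<inter> ?S = {}} v = component ?Y v"
  proof (rule component_cong[OF refl])
    fix e assume e: "e \<inter> component ?Y v \<noteq> {}"
    show "e \<in> ?Y \<longleftrightarrow> e \<in> {e \<in> ?Y. e \<inter> ?S = {}}"
    proof (rule iffI)
      assume eY: "e \<in> ?Y"
      then obtain s t where st: "e = {s, t}" using assms edges by blast
      then have "s \<in> component ?Y v \<or> t \<in> component ?Y v" using e by auto
      then have "s \<in> component ?Y v \<and> t \<in> component ?Y v"
        using eY unfolding st using component_edge[of s ?Y v t] component_edge[of t ?Y v s]
        by (auto simp: insert_commute)
      then have "e \<subseteq> component ?Y v" by (simp add: st)
      then show "e \<in> {e \<in> ?Y. e \<inter> ?S = {}}" using disj eY by blast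
    qed simp
  qed
  then show "\<exists>z. z \<notin> \<Lambda> \<and> z \<in> component {e \<in> ?Y. e \<inter> ?S = {}} v" using z by auto
qed

text \<open>No edge inside \<open>S\<close> occurs in this edge set, which makes the event
  independent of connections within \<open>S\<close>.\<close>

lemma depends_unreached:
  assumes "S \<subseteq> \<Lambda>"
  shows "depends {e \<in> E. e \<inter> \<Lambda> \<noteq> {} \<and> \<not> e \<subseteq> S} (unreached \<Lambda> S)"
proof (rule dependsI)
  fix X assume X: "X \<subseteq> E"
  let ?J = "{e \<in> E. e \<inter> \<Lambda> \<noteq> {} \<and> \<not> e \<subseteq> S}"
  have "{x, y} \<in> X \<longleftrightarrow> {x, y} \<in> X \<inter> ?J" if "x \<in> S" "y \<notin> S" for x y
    using that X assms by auto
  moreover have "{e \<in> {e \<in> X. e \<inter> \<Lambda> \<noteq> {}}. e \<inter> S = {}} = {e \<in> {e \<in> X \<inter> ?J. e \<inter> \<Lambda> \<noteq> {}}. e \<inter> S = {}}"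
    using X by auto
  ultimately show "unreached \<Lambda> S X \<longleftrightarrow> unreached \<Lambda> S (X \<inter> ?J)"
    unfolding unreached_def by auto
qed

text \<open>Opening \<open>{x, y}\<close> joins \<open>v\<close> through \<open>x\<close> to
  \<open>y\<close>, and \<open>y\<close> is outside \<open>\<Lambda>\<close> or connected to the
  outside because it is not in \<open>S\<close>.\<close>

lemma unreached_pivotal:
  assumes "X \<subseteq> E" "v \<in> S" "S \<subseteq> \<Lambda>" and xy: "x \<in> S" "y \<notin> S" "{x, y} \<in> E"
    and un: "unreached \<Lambda> S X" and x: "x \<in> component {e \<in> X. e \<subseteq> S} v"
  defines "Q \<equiv> \<lambda>X. \<exists>z. z \<notin> \<Lambda> \<and> z \<in> component {e \<in> X. e \<inter> \<Lambda> \<noteq> {}} v"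
  shows "{x, y} \<notin> X \<and> \<not> Q X \<and> Q (insert {x, y} X)"
proof (intro conjI)
  show "{x, y} \<notin> X" using un xy by (auto simp: unreached_def)
  show "\<not> Q X" using unreached_eq[OF un assms(3)] assms(2) by (auto simp: Q_def)
  let ?Y = "{e \<in> insert {x, y} X. e \<inter> \<Lambda> \<noteq> {}}"
  have "{e \<in> X. e \<subseteq> S} \<subseteq> ?Y" using assms(1,3) edges by fastforce
  with x have "x \<in> component ?Y v" by (rule component_mono)
  then have y: "y \<in> component ?Y v" by (rule component_edge) (use xy assms(3) in auto)
  show "Q (insert {x, y} X)"
  proof (cases "y \<in> \<Lambda>")
    case True
    then obtain z where z: "z \<notin> \<Lambda>" "z \<in> component {e \<in> {e \<in> X. e \<inter> \<Lambda> \<noteq> {}}. e \<inter> S = {}} y"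
      using un xy(2) unfolding unreached_def by blast
    have "z \<in> component ?Y y" using component_mono[OF z(2), of ?Y] by auto
    then show ?thesis using z(1) component_trans[OF y] unfolding Q_def by blast
  qed (use y in \<open>auto simp: Q_def\<close>)
qed

text \<open>The differential inequality of Duminil-Copin and Tassion: given the set \<open>S\<close> of vertices not
  connected to the complement of \<open>\<Lambda>\<close>, the expected number of closed pivotal edges is
  \<open>phi p S v / p\<close>.\<close>

lemma pivotal_sum_ge:
  assumes L: "finite \<Lambda>" "v \<in> \<Lambda>" "\<Lambda> \<subseteq> V" and p: "0 \<le> p" "p \<le> 1"
    and phi: "\<And>S. finite S \<Longrightarrow> v \<in> S \<Longrightarrow> S \<subseteq> V \<Longrightarrow> 1 \<le> phi p S v"
  defines "F \<equiv> {e \<in> E. e \<inter> \<Lambda> \<noteq> {}}"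
    and "Q \<equiv> \<lambda>X. \<exists>z. z \<notin> \<Lambda> \<and> z \<in> component {e \<in> X. e \<inter> \<Lambda> \<noteq> {}} v"
  shows "1 - pr p Q \<le> (\<Sum>e\<in>F. pr p (\<lambda>X. Q (insert e X)) - pr p (\<lambda>X. Q (X - {e})))"
proof -
  have F: "finite F" "F \<subseteq> E" unfolding F_def using finite_incident[OF L(1)] by auto
  have depQ: "depends F Q"
  proof (rule dependsI)
    fix X assume "X \<subseteq> E"
    then have "{e \<in> X \<inter> F. e \<inter> \<Lambda> \<noteq> {}} = {e \<in> X. e \<inter> \<Lambda> \<noteq> {}}" by (auto simp: F_def)
    then show "Q X \<longleftrightarrow> Q (X \<inter> F)" by (simp add: Q_def)
  qed
  have monoQ: "Q Y" if "X \<subseteq> Y" "Q X" for X Y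
  proof -
    have "{e \<in> X. e \<inter> \<Lambda> \<noteq> {}} \<subseteq> {e \<in> Y. e \<inter> \<Lambda> \<noteq> {}}" using that by auto
    then show ?thesis using that(2) component_mono[of _ "{e \<in> X. e \<inter> \<Lambda> \<noteq> {}}" v "{e \<in> Y. e \<inter> \<Lambda> \<noteq> {}}"]
      unfolding Q_def by auto
  qed
  let ?piv = "\<lambda>e X. Q (insert e X) \<and> \<not> Q (X - {e})"
  let ?D = "\<lambda>S X. unreached \<Lambda> S X"
  let ?C = "\<lambda>S x X. x \<in> component {e \<in> X. e \<subseteq> S} v"
  let ?T = "Sigma {S \<in> Pow \<Lambda>. v \<in> S} boundary"
  let ?h = "\<lambda>(S, x, y). pr p (?D S) * pr p (?C S x)"
  have finS: "finite S" if "S \<subseteq> \<Lambda>" for S using L(1) that by (rule finite_subset[rotated])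
  have finT: "finite ?T" using L finS by (intro finite_SigmaI finite_boundary) auto
  have evD: "ev (?D S)" if "S \<subseteq> \<Lambda>" for S
  proof (rule ev_depends_finite[OF _ depends_unreached[OF that]])
    show "finite {e \<in> E. e \<inter> \<Lambda> \<noteq> {} \<and> \<not> e \<subseteq> S}"
      by (rule finite_subset[OF _ F(1)]) (auto simp: F_def)
  qed
  \<comment> \<open>For a given edge and configuration at most one triple \<open>(S, x, y)\<close>
    occurs: the configuration determines \<open>S\<close>, and \<open>x\<close> is the endpoint in
    \<open>S\<close>. Its occurrence makes \<open>e\<close> closed and pivotal; being closed is
    independent of being pivotal and has probability \<open>1 - p\<close>.\<close>
  have pivotal: "(\<Sum>i\<in>{i \<in> ?T. {fst (snd i), snd (snd i)} = e}. ?h i) \<le>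
      (1 - p) * (pr p (\<lambda>X. Q (insert e X)) - pr p (\<lambda>X. Q (X - {e})))" if e: "e \<in> F" for e
  proof -
    let ?I = "{i \<in> ?T. {fst (snd i), snd (snd i)} = e}"
    let ?R = "\<lambda>(S, x, y) X. ?D S X \<and> ?C S x X"
    have eE: "e \<in> E" using e F by auto
    have dep1: "depends (F - {e}) (\<lambda>X. Q (insert e X))" "depends (F - {e}) (\<lambda>X. Q (X - {e}))"
      using depends_insert(1)[OF depQ eE] depends_remove(1)[OF depQ] by auto
    then have ev1: "ev (\<lambda>X. Q (insert e X))" "ev (\<lambda>X. Q (X - {e}))"
      using F by (auto intro!: ev_depends_finite[of "F - {e}"])
    have evR: "ev (?R i)" if "i \<in> ?I" for i
      using that by (auto intro!: ev_conj evD ev_component)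
    have "(\<Sum>i\<in>?I. ?h i) = (\<Sum>i\<in>?I. pr p (?R i))"
    proof (rule sum.cong[OF refl])
      fix i assume "i \<in> ?I"
      then obtain S x y where i: "i = (S, x, y)" "S \<subseteq> \<Lambda>" by auto
      have "pr p (\<lambda>X. ?D S X \<and> ?C S x X) = pr p (?D S) * pr p (?C S x)"
      proof (rule pr_indep[OF evD[OF i(2)] ev_component depends_unreached[OF i(2)]])
        show "depends {e. e \<subseteq> S} (?C S x)"
          by (rule dependsI) (auto intro!: arg_cong[of _ _ "\<lambda>X. x \<in> component X v"])
      qed auto
      then show "?h i = pr p (?R i)" by (simp add: i(1))
    qed
    also have "\<dots> = pr p (\<lambda>X. \<exists>i\<in>?I. ?R i X)"
    proof (rule pr_bex_finite[symmetric])
      show "finite ?I" using finT by auto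
      fix i j X assume ij: "i \<in> ?I" "j \<in> ?I" and X: "X \<subseteq> E" "?R i X" "?R j X"
      obtain S x y S' x' y' where eqs: "i = (S, x, y)" "j = (S', x', y')" by (cases i, cases j) auto
      have "S = S'"
        using X ij unreached_eq[of \<Lambda> S X] unreached_eq[of \<Lambda> S' X] unfolding eqs by auto
      then show "i = j" using ij unfolding eqs by (auto simp: boundary_def doubleton_eq_iff)
    qed (rule evR)
    also have "\<dots> \<le> pr p (\<lambda>X. e \<notin> X \<and> ?piv e X)"
    proof (rule pr_mono)
      show "ev (\<lambda>X. e \<notin> X \<and> ?piv e X)" using ev1 by (intro ev_conj ev_not ev_mem)
      fix X assume X: "X \<subseteq> E" "\<exists>i\<in>?I. ?R i X"
      then obtain S x y where S: "S \<subseteq> \<Lambda>" "v \<in> S" "x \<in> S" "y \<notin> S" "{x, y} = e" "?D S X" "?C S x X"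
        by (auto simp: boundary_def)
      then have "e \<notin> X \<and> \<not> Q X \<and> Q (insert e X)"
        using unreached_pivotal[OF X(1) S(2,1,3,4) _ S(6,7)] eE unfolding Q_def by auto
      then show "e \<notin> X \<and> ?piv e X" by simp
    qed
    also have "\<dots> = pr p (\<lambda>X. e \<notin> X) * pr p (?piv e)"
    proof (rule pr_indep)
      show "depends {e} (\<lambda>X. e \<notin> X)" by (rule dependsI) auto
      show "depends (F - {e}) (?piv e)" using dep1 by (intro depends_conj depends_not)
    qed (use ev1 in \<open>auto intro!: ev_conj ev_not ev_mem\<close>)
    also have "pr p (\<lambda>X. e \<notin> X) = 1 - p" using pr_not[OF ev_mem] pr_open[OF eE p] by simp
    also have "pr p (?piv e) = pr p (\<lambda>X. Q (insert e X)) - pr p (\<lambda>X. Q (X - {e}))"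
    proof -
      have "pr p (\<lambda>X. Q (insert e X)) = pr p (\<lambda>X. ?piv e X \<or> Q (X - {e}))"
        using monoQ[of "X - {e}" "insert e X" for X] by (intro pr_cong) auto
      also have "\<dots> = pr p (?piv e) + pr p (\<lambda>X. Q (X - {e}))"
        using ev1 by (intro pr_disj ev_conj ev_not) auto
      finally show ?thesis by simp
    qed
    finally show ?thesis .
  qed
  have "1 - pr p Q = pr p (\<lambda>X. \<not> Q X)" using pr_not[OF ev_depends_finite[OF F(1) depQ]] by simp
  also have "\<dots> \<le> pr p (\<lambda>X. \<exists>S\<in>{S \<in> Pow \<Lambda>. v \<in> S}. ?D S X)"
  proof (rule pr_mono)
    show "ev (\<lambda>X. \<exists>S\<in>{S \<in> Pow \<Lambda>. v \<in> S}. ?D S X)"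
      using L(1) evD by (intro ev_bex countable_finite) auto
    fix X assume X: "X \<subseteq> E" "\<not> Q X"
    let ?S = "{v \<in> \<Lambda>. \<not> (\<exists>z. z \<notin> \<Lambda> \<and> z \<in> component {e \<in> X. e \<inter> \<Lambda> \<noteq> {}} v)}"
    have "?D ?S X" using X(1) by (rule unreached_exists)
    moreover have "?S \<in> {S \<in> Pow \<Lambda>. v \<in> S}" using X(2) L(2) by (auto simp: Q_def)
    ultimately show "\<exists>S\<in>{S \<in> Pow \<Lambda>. v \<in> S}. ?D S X" by blast
  qed
  also have "\<dots> = (\<Sum>S\<in>{S \<in> Pow \<Lambda>. v \<in> S}. pr p (?D S))"
  proof (rule pr_bex_finite)
    fix S S' X
    assume "S \<in> {S \<in> Pow \<Lambda>. v \<in> S}" "S' \<in> {S \<in> Pow \<Lambda>. v \<in> S}" "?D S X" "?D S' X"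
    then show "S = S'" using unreached_eq[of \<Lambda> S X] unreached_eq[of \<Lambda> S' X] by auto
  qed (use L(1) evD in auto)
  also have "\<dots> \<le> (\<Sum>S\<in>{S \<in> Pow \<Lambda>. v \<in> S}. \<Sum>xy\<in>boundary S. ?h (S, xy))"
  proof (rule sum_mono)
    fix S assume S: "S \<in> {S \<in> Pow \<Lambda>. v \<in> S}"
    let ?s = "\<Sum>(x, y)\<in>boundary S. pr p (?C S x)"
    have "0 \<le> ?s" by (intro sum_nonneg) auto
    moreover have "1 \<le> p * ?s" using phi[of S] S L finS unfolding phi_def by auto
    \<comment> \<open>\<open>phi\<close> is \<open>p\<close> times this sum and
      \<open>p \<le> 1\<close>, so the bound persists without the factor.\<close>
    ultimately have "1 \<le> ?s" using p mult_left_le_one_le[of ?s p] by linarith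
    then have "pr p (?D S) * 1 \<le> pr p (?D S) * ?s" by (intro mult_left_mono) auto
    then show "pr p (?D S) \<le> (\<Sum>xy\<in>boundary S. ?h (S, xy))"
      by (simp add: sum_distrib_left split_beta)
  qed
  also have "\<dots> = (\<Sum>i\<in>?T. ?h i)"
    using L(1) finS by (subst sum.Sigma) (auto intro!: finite_boundary)
  also have "\<dots> = (\<Sum>e\<in>F. \<Sum>i\<in>{i \<in> ?T. {fst (snd i), snd (snd i)} = e}. ?h i)"
  proof (rule sum.group[symmetric, OF finT F(1)])
    show "(\<lambda>i. {fst (snd i), snd (snd i)}) ` ?T \<subseteq> F"
      by (auto simp: boundary_def F_def)
  qed
  also have "\<dots> \<le> (\<Sum>e\<in>F. (1 - p) * (pr p (\<lambda>X. Q (insert e X)) - pr p (\<lambda>X. Q (X - {e}))))"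
    by (intro sum_mono pivotal)
  also have "\<dots> \<le> (\<Sum>e\<in>F. pr p (\<lambda>X. Q (insert e X)) - pr p (\<lambda>X. Q (X - {e})))"
  proof (rule sum_mono)
    fix e assume e: "e \<in> F"
    have "ev (\<lambda>X. Q (insert e X))"
      using F e by (intro ev_depends_finite[OF F(1) depends_insert(2)[OF depQ]]) auto
    then have "pr p (\<lambda>X. Q (X - {e})) \<le> pr p (\<lambda>X. Q (insert e X))"
      by (rule pr_mono) (rule monoQ, auto)
    then show "(1 - p) * (pr p (\<lambda>X. Q (insert e X)) - pr p (\<lambda>X. Q (X - {e}))) \<le>
        pr p (\<lambda>X. Q (insert e X)) - pr p (\<lambda>X. Q (X - {e}))"
      using p by (intro mult_left_le_one_le) auto
  qed
  finally show ?thesis .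
qed

text \<open>Integrates \<open>f' \<ge> 1 - f\<close>: the function \<open>(1 - f t) * exp t\<close>
  is nonincreasing on the interval and at most \<open>exp p\<close> at its left end. The bound does
  not depend on \<open>\<Lambda>\<close>.\<close>

lemma pr_leave_ge:
  assumes L: "finite \<Lambda>" "v \<in> \<Lambda>" "\<Lambda> \<subseteq> V" and pq: "0 \<le> p" "p \<le> q" "q \<le> 1"
    and phi: "\<And>t S. p \<le> t \<Longrightarrow> t \<le> q \<Longrightarrow> finite S \<Longrightarrow> v \<in> S \<Longrightarrow> S \<subseteq> V \<Longrightarrow> 1 \<le> phi t S v"
  shows "1 - exp (p - q) \<le> pr q (\<lambda>X. \<exists>z. z \<notin> \<Lambda> \<and> z \<in> component {e \<in> X. e \<inter> \<Lambda> \<noteq> {}} v)"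
proof -
  define F where "F = {e \<in> E. e \<inter> \<Lambda> \<noteq> {}}"
  define Q where "Q X \<longleftrightarrow> (\<exists>z. z \<notin> \<Lambda> \<and> z \<in> component {e \<in> X. e \<inter> \<Lambda> \<noteq> {}} v)" for X
  define D where "D t = (\<Sum>e\<in>F. pr t (\<lambda>X. Q (insert e X)) - pr t (\<lambda>X. Q (X - {e})))" for t
  define f where "f = cylinder_poly F (\<lambda>T. of_bool (Q T))"
  have F: "finite F" "F \<subseteq> E" unfolding F_def using finite_incident[OF L(1)] by auto
  have depQ: "depends F Q"
  proof (rule dependsI)
    fix X assume "X \<subseteq> E"
    then have "{e \<in> X \<inter> F. e \<inter> \<Lambda> \<noteq> {}} = {e \<in> X. e \<inter> \<Lambda> \<noteq> {}}" by (auto simp: F_def)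
    then show "Q X \<longleftrightarrow> Q (X \<inter> F)" by (simp add: Q_def)
  qed
  have f: "pr t Q = f t" if "0 \<le> t" "t \<le> 1" for t
    unfolding f_def using pr_depends_finite[OF F depQ that] .
  have "(1 - f q) * exp q \<le> (1 - f p) * exp p"
  proof (rule DERIV_nonpos_imp_nonincreasing[OF pq(2)])
    fix t assume t: "p \<le> t" "t \<le> q"
    have df: "(f has_real_derivative D t) (at t)"
      unfolding f_def D_def using t pq by (intro russo_formula[OF F depQ]) auto
    have "((\<lambda>t. (1 - f t) * exp t) has_real_derivative (- D t) * exp t + (1 - f t) * exp t) (at t)"
      by (rule derivative_eq_intros df refl | simp)+
    moreover have "1 - f t \<le> D t"
      using pivotal_sum_ge[OF L, of t] phi t pq f[of t] unfolding D_def F_def Q_def by auto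
    then have "(- D t) * exp t + (1 - f t) * exp t \<le> 0" by (simp flip: distrib_right)
    ultimately show "\<exists>y. ((\<lambda>t. (1 - f t) * exp t) has_real_derivative y) (at t) \<and> y \<le> 0" by blast
  qed
  also have "\<dots> \<le> 1 * exp p" using f[of p] pr_nonneg[of p Q] pq by (intro mult_right_mono) auto
  finally have "1 - f q \<le> exp (p - q)" by (simp add: exp_diff pos_le_divide_eq)
  then have "1 - exp (p - q) \<le> pr q Q" using f[of q] pq by simp
  then show ?thesis unfolding Q_def[abs_def] .
qed

lemma phi_mono:
  assumes "finite S" "0 \<le> p" "p \<le> q" "q \<le> 1"
  shows "phi p S v \<le> phi q S v"
proof -
  have "pr p (\<lambda>X. x \<in> component {e \<in> X. e \<subseteq> S} v) \<le> pr q (\<lambda>X. x \<in> component {e \<in> X. e \<subseteq> S} v)" for x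
  proof (rule pr_mono_parameter[OF _ _ _ assms(2-)])
    let ?F = "{e \<in> E. e \<subseteq> S}"
    show "finite ?F" by (rule finite_subset[of _ "Pow S"]) (use assms in auto)
    show "depends ?F (\<lambda>X. x \<in> component {e \<in> X. e \<subseteq> S} v)"
    proof (rule dependsI)
      fix X assume "X \<subseteq> E"
      then have "{e \<in> X. e \<subseteq> S} = {e \<in> X \<inter> ?F. e \<subseteq> S}" by auto
      then show "x \<in> component {e \<in> X. e \<subseteq> S} v \<longleftrightarrow> x \<in> component {e \<in> X \<inter> ?F. e \<subseteq> S} v" by simp
    qed
    fix X Y :: "'a set set" assume "X \<subseteq> Y" "x \<in> component {e \<in> X. e \<subseteq> S} v"
    then show "x \<in> component {e \<in> Y. e \<subseteq> S} v" by (elim component_mono) auto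
  qed auto
  then show ?thesis
    unfolding phi_def using assms by (intro mult_mono sum_mono sum_nonneg) (auto simp: split_beta)
qed

lemma ev_infinite_component:
  assumes "v \<in> V"
  shows "ev (\<lambda>X. infinite (component X v))"
proof -
  have "ev (\<lambda>X. \<forall>F\<in>{F. finite F \<and> F \<subseteq> V}. \<exists>z\<in>V. z \<notin> F \<and> z \<in> component X v)"
    by (intro ev_ball ev_bex countable_finite_subsets countable_V ev_conj ev_const ev_component_UNIV)
  also have "?this \<longleftrightarrow> ev (\<lambda>X. infinite (component X v))"
  proof (rule ev_cong)
    fix X assume "X \<subseteq> E"
    then have "component X v \<subseteq> V" using component_subset_V assms by simp
    have "\<exists>z\<in>V. z \<notin> F \<and> z \<in> component X v" if "infinite (component X v)" "finite F" for F
    proof -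
      have "\<not> component X v \<subseteq> F" using that finite_subset by metis
      then show ?thesis using \<open>component X v \<subseteq> V\<close> by blast
    qed
    then show "(\<forall>F\<in>{F. finite F \<and> F \<subseteq> V}. \<exists>z\<in>V. z \<notin> F \<and> z \<in> component X v) \<longleftrightarrow> infinite (component X v)"
      using \<open>component X v \<subseteq> V\<close> by blast
  qed
  finally show ?thesis .
qed

text \<open>Exhaust \<open>V\<close> by finite sets. The probability of leaving each of them has a
  uniform lower bound, and a cluster leaving all of them is infinite.\<close>

lemma pr_infinite_ge:
  assumes v: "v \<in> V" and pq: "0 \<le> p" "p \<le> q" "q \<le> 1"
    and phi: "\<And>t S. p \<le> t \<Longrightarrow> t \<le> q \<Longrightarrow> finite S \<Longrightarrow> v \<in> S \<Longrightarrow> S \<subseteq> V \<Longrightarrow> 1 \<le> phi t S v"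
  shows "1 - exp (p - q) \<le> pr q (\<lambda>X. infinite (component X v))"
proof -
  define L where "L n = insert v {u \<in> V. to_nat_on V u \<le> n}" for n
  have finL: "finite (L n)" for n
  proof -
    have "inj_on (to_nat_on V) {u \<in> V. to_nat_on V u \<le> n}"
      using inj_on_to_nat_on[OF countable_V] by (rule inj_on_subset) auto
    moreover have "finite (to_nat_on V ` {u \<in> V. to_nat_on V u \<le> n})"
      by (rule finite_subset[of _ "{..n}"]) auto
    ultimately show ?thesis unfolding L_def using finite_imageD by auto
  qed
  have LV: "L n \<subseteq> V" "v \<in> L n" for n using v by (auto simp: L_def)
  have ev: "ev (\<lambda>X. \<exists>z\<in>V. z \<notin> L n \<and> z \<in> component X v)" for n
    by (intro ev_bex countable_V ev_conj ev_const ev_component_UNIV)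
  have "(\<lambda>n. pr q (\<lambda>X. \<exists>z\<in>V. z \<notin> L n \<and> z \<in> component X v)) \<longlonglongrightarrow>
      pr q (\<lambda>X. \<forall>n. \<exists>z\<in>V. z \<notin> L n \<and> z \<in> component X v)"
    by (rule pr_decseq[OF ev]) (force simp: L_def)
  moreover have "1 - exp (p - q) \<le> pr q (\<lambda>X. \<exists>z\<in>V. z \<notin> L n \<and> z \<in> component X v)" for n
  proof -
    have "1 - exp (p - q) \<le> pr q (\<lambda>X. \<exists>z. z \<notin> L n \<and> z \<in> component {e \<in> X. e \<inter> L n \<noteq> {}} v)"
      using phi by (intro pr_leave_ge finL LV pq) auto
    also have "\<dots> \<le> pr q (\<lambda>X. \<exists>z\<in>V. z \<notin> L n \<and> z \<in> component X v)"
    proof (rule pr_mono[OF ev])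
      fix X assume X: "X \<subseteq> E" "\<exists>z. z \<notin> L n \<and> z \<in> component {e \<in> X. e \<inter> L n \<noteq> {}} v"
      then obtain z where z: "z \<notin> L n" "z \<in> component {e \<in> X. e \<inter> L n \<noteq> {}} v" by blast
      have "z \<in> component X v" using z(2) by (rule component_mono) auto
      then show "\<exists>z\<in>V. z \<notin> L n \<and> z \<in> component X v"
        using z(1) component_subset_V[OF v X(1)] by blast
    qed
    finally show ?thesis .
  qed
  ultimately have "1 - exp (p - q) \<le> pr q (\<lambda>X. \<forall>n. \<exists>z\<in>V. z \<notin> L n \<and> z \<in> component X v)"
    by (intro LIMSEQ_le_const) auto
  also have "\<dots> \<le> pr q (\<lambda>X. infinite (component X v))"
  proof (rule pr_mono[OF ev_infinite_component[OF v]])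
    fix X assume X: "X \<subseteq> E" "\<forall>n. \<exists>z\<in>V. z \<notin> L n \<and> z \<in> component X v"
    show "infinite (component X v)"
    proof
      assume fin: "finite (component X v)"
      then have "component X v \<subseteq> L (Max (to_nat_on V ` component X v))"
        using component_subset_V[OF v X(1)] by (auto simp: L_def)
      then show False using X(2) by blast
    qed
  qed
  finally show ?thesis .
qed

text \<open>Otherwise monotonicity of \<open>phi\<close> extends \<open>1 \<le> phi\<close> from
  \<open>p\<close> to the whole interval, and infinite clusters have positive probability at
  \<open>q\<close>.\<close>

lemma exists_phi_less_1:
  assumes "v \<in> V" "0 \<le> p" "p < q" "q \<le> 1" "pr q (\<lambda>X. infinite (component X v)) = 0"
  shows "\<exists>S. finite S \<and> v \<in> S \<and> S \<subseteq> V \<and> phi p S v < 1"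
proof (rule ccontr)
  assume *: "\<not> ?thesis"
  have "1 - exp (p - q) \<le> pr q (\<lambda>X. infinite (component X v))"
  proof (rule pr_infinite_ge)
    fix t S assume "p \<le> t" "t \<le> q" "finite S" "v \<in> S" "S \<subseteq> V"
    then have "1 \<le> phi p S v" "phi p S v \<le> phi t S v" using * assms by (auto intro!: phi_mono simp: not_less)
    then show "1 \<le> phi t S v" by simp
  qed (use assms in auto)
  moreover have "exp (p - q) < 1" using assms(3) by simp
  ultimately show False using assms(5) by linarith
qed

end

section \<open>Connections to greater heights\<close>

context weighted_graph
begin

text \<open>Paths are confined to weights at least \<open>w v\<close> so that the event ignores
  every edge with an endpoint lower than \<open>v\<close>. Its probability is the quantity
  \<open>A\<^sub>p(c)\<close>.\<close>

definition up :: "real \<Rightarrow> 'a \<Rightarrow> 'a set set \<Rightarrow> bool" where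
  "up c v X \<longleftrightarrow> (\<exists>z\<in>V. c * w v \<le> w z \<and> z \<in> component {e \<in> X. \<forall>u\<in>e. w v \<le> w u} v)"

lemma ev_up: "ev (up c v)"
  unfolding up_def[abs_def] by (intro ev_bex countable_V ev_conj ev_const ev_component)

lemma image_above:
  assumes "g \<in> Aut V E" "v \<in> V" "X \<subseteq> E"
  shows "{e \<in> (`) g ` X. \<forall>u\<in>e. w (g v) \<le> w u} = (`) g ` {e \<in> X. \<forall>u\<in>e. w v \<le> w u}"
proof -
  have "(\<forall>u\<in>g ` e. w (g v) \<le> w u) \<longleftrightarrow> (\<forall>u\<in>e. w v \<le> w u)" if "e \<in> X" for e
  proof -
    have "e \<subseteq> V" using that assms(3) edge_subset_V by auto
    then have "w (g v) \<le> w (g u) \<longleftrightarrow> w v \<le> w u" if "u \<in> e" for u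
      using w_le_Aut[OF assms(1,2), of u 1] that by auto
    then show ?thesis by auto
  qed
  then show ?thesis by auto
qed

lemma pr_up_Aut:
  assumes g: "g \<in> Aut V E" and v: "v \<in> V"
  shows "pr p (up c (g v)) = pr p (up c v)"
proof (rule pr_Aut[OF g ev_up])
  fix X assume X: "X \<subseteq> E"
  have "up c (g v) ((`) g ` X) \<longleftrightarrow>
      (\<exists>z\<in>g ` V. c * w (g v) \<le> w z \<and> z \<in> component ((`) g ` {e \<in> X. \<forall>u\<in>e. w v \<le> w u}) (g v))"
    unfolding up_def image_above[OF g v X] Aut_image_V[OF g] ..
  also have "\<dots> \<longleftrightarrow> (\<exists>z\<in>V. c * w (g v) \<le> w (g z) \<and>
      g z \<in> component ((`) g ` {e \<in> X. \<forall>u\<in>e. w v \<le> w u}) (g v))" by blast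
  also have "\<dots> \<longleftrightarrow> up c v X"
    unfolding up_def component_image[OF Aut_bij[OF g]] using w_le_Aut[OF g v] by auto
  finally show "up c (g v) ((`) g ` X) \<longleftrightarrow> up c v X" .
qed

lemma pr_up_transitive:
  assumes "u \<in> V" "v \<in> V"
  shows "pr p (up c u) = pr p (up c v)"
  using transitive[OF assms(2,1)] pr_up_Aut assms(2) by metis

text \<open>The edges explored until the cluster of \<open>v\<close> first reaches relative height \<open>c\<close> are disjoint
  from the edges above the vertex reached there.\<close>

lemma pr_up_supermult:
  assumes v: "v \<in> V" and c: "1 \<le> c" and d: "0 \<le> d"
  shows "pr p (up c v) * pr p (up d v) \<le> pr p (up (c * d) v)"
proof -
  define W where "W = {u. w u < c * w v}"
  define T where "T y X \<longleftrightarrow> c * w v \<le> w y \<and>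
      y \<in> component {e \<in> X. (\<forall>u\<in>e. w v \<le> w u) \<and> e \<inter> W \<noteq> {}} v" for y X
  \<comment> \<open>Selects the least vertex, in the enumeration of \<open>V\<close>, among those at
    height \<open>c\<close> reached through edges touching \<open>W\<close>. Choosing a single one
    makes the events \<open>D y\<close> disjoint.\<close>
  define D where "D y X \<longleftrightarrow> T y X \<and> (\<forall>y'\<in>V. to_nat_on V y' < to_nat_on V y \<longrightarrow> \<not> T y' X)" for y X
  let ?J = "{e. e \<inter> W \<noteq> {}}"
  have evT: "ev (T y)" for y unfolding T_def[abs_def] by (intro ev_conj ev_const ev_component)
  have evD: "ev (D y)" for y
    unfolding D_def[abs_def] using evT by (intro ev_conj ev_ball ev_imp ev_const ev_not countable_V) auto
  have depT: "depends ?J (T y)" for y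
  proof (rule dependsI)
    fix X
    have "{e \<in> X \<inter> ?J. (\<forall>u\<in>e. w v \<le> w u) \<and> e \<inter> W \<noteq> {}} = {e \<in> X. (\<forall>u\<in>e. w v \<le> w u) \<and> e \<inter> W \<noteq> {}}"
      by auto
    then show "T y X \<longleftrightarrow> T y (X \<inter> ?J)" by (simp only: T_def)
  qed
  have depD: "depends ?J (D y)" for y
  proof (rule dependsI)
    fix X assume "X \<subseteq> E"
    then have "T y X \<longleftrightarrow> T y (X \<inter> ?J)" for y using dependsD[OF depT] by blast
    then show "D y X \<longleftrightarrow> D y (X \<inter> ?J)" by (simp add: D_def)
  qed
  have disj: "y = y'" if "y \<in> V" "y' \<in> V" "D y X" "D y' X" for y y' X
  proof -
    have "to_nat_on V y = to_nat_on V y'"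
      using that unfolding D_def by (meson linorder_neqE_nat)
    then show ?thesis using inj_on_to_nat_on[OF countable_V] that by (auto dest: inj_onD)
  qed
  have "pr p (up c v) \<le> pr p (\<lambda>X. \<exists>y\<in>V. D y X)"
  proof (rule pr_mono)
    show "ev (\<lambda>X. \<exists>y\<in>V. D y X)" using evD countable_V by (intro ev_bex)
    fix X assume X: "X \<subseteq> E" "up c v X"
    then obtain z where z: "c * w v \<le> w z" "z \<in> component {e \<in> X. \<forall>u\<in>e. w v \<le> w u} v"
      by (auto simp: up_def)
    obtain y where y: "y \<notin> W" "y \<in> component {e \<in> {e \<in> X. \<forall>u\<in>e. w v \<le> w u}. e \<inter> W \<noteq> {}} v"
      using component_first_exit[OF z(2), of W] z(1) by (auto simp: W_def)
    have "{e \<in> {e \<in> X. \<forall>u\<in>e. w v \<le> w u}. e \<inter> W \<noteq> {}} = {e \<in> X. (\<forall>u\<in>e. w v \<le> w u) \<and> e \<inter> W \<noteq> {}}"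
      by auto
    then have "T y X" using y by (simp add: T_def W_def not_less)
    moreover have "y \<in> V"
      using y(2) component_subset_V[OF v, of "{e \<in> {e \<in> X. \<forall>u\<in>e. w v \<le> w u}. e \<inter> W \<noteq> {}}"] X(1) by auto
    ultimately obtain y0 where y0: "y0 \<in> V \<and> T y0 X"
        "\<And>y'. y' \<in> V \<and> T y' X \<Longrightarrow> to_nat_on V y0 \<le> to_nat_on V y'"
      using ex_has_least_nat[of "\<lambda>y. y \<in> V \<and> T y X" y "to_nat_on V"] by blast
    have "\<not> T y' X" if "y' \<in> V" "to_nat_on V y' < to_nat_on V y0" for y'
      using y0(2)[of y'] that by auto
    then have "D y0 X" using y0(1) by (simp add: D_def)
    then show "\<exists>y\<in>V. D y X" using y0 by blast
  qed
  then have "ennreal (pr p (up c v)) * ennreal (pr p (up d v)) \<le>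
      (\<integral>\<^sup>+y. ennreal (pr p (D y)) \<partial>count_space V) * ennreal (pr p (up d v))"
  proof (intro mult_right_mono)
    have "(\<integral>\<^sup>+y. ennreal (pr p (D y)) \<partial>count_space V) = ennreal (pr p (\<lambda>X. \<exists>y\<in>V. D y X))"
      by (rule pr_bex_disjoint[symmetric, OF countable_V evD]) (rule disj)
    then show "ennreal (pr p (up c v)) \<le> (\<integral>\<^sup>+y. ennreal (pr p (D y)) \<partial>count_space V)"
      using \<open>pr p (up c v) \<le> pr p (\<lambda>X. \<exists>y\<in>V. D y X)\<close> by (simp add: ennreal_leI)
  qed simp
  also have "\<dots> = (\<integral>\<^sup>+y. ennreal (pr p (D y)) * ennreal (pr p (up d v)) \<partial>count_space V)"
    by (rule nn_integral_multc[symmetric]) simp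
  also have "\<dots> = (\<integral>\<^sup>+y. ennreal (pr p (\<lambda>X. D y X \<and> up d y X)) \<partial>count_space V)"
  proof (rule nn_integral_cong)
    fix y assume "y \<in> space (count_space V)"
    then have y: "y \<in> V" by simp
    show "ennreal (pr p (D y)) * ennreal (pr p (up d v)) = ennreal (pr p (\<lambda>X. D y X \<and> up d y X))"
    proof (cases "c * w v \<le> w y")
      case True
      \<comment> \<open>Both ends of such an edge have weight at least \<open>c * w v\<close>, so it
        misses \<open>W\<close> and was not inspected in finding \<open>y\<close>.\<close>
      have "depends {e. \<forall>u\<in>e. w y \<le> w u} (up d y)"
      proof (rule dependsI)
        fix X
        have "{e \<in> X \<inter> {e. \<forall>u\<in>e. w y \<le> w u}. \<forall>u\<in>e. w y \<le> w u} = {e \<in> X. \<forall>u\<in>e. w y \<le> w u}" by auto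
        then show "up d y X \<longleftrightarrow> up d y (X \<inter> {e. \<forall>u\<in>e. w y \<le> w u})" by (simp only: up_def)
      qed
      then have "pr p (\<lambda>X. D y X \<and> up d y X) = pr p (D y) * pr p (up d y)"
        using True by (intro pr_indep[OF evD ev_up depD]) (auto simp: W_def)
      then show ?thesis using pr_up_transitive[OF y v] by (simp add: ennreal_mult)
    next
      case False
      then have "D y X \<longleftrightarrow> False" for X by (simp add: D_def T_def)
      then show ?thesis by (simp add: pr_def event_def)
    qed
  qed
  also have "\<dots> = ennreal (pr p (\<lambda>X. \<exists>y\<in>V. D y X \<and> up d y X))"
    by (rule pr_bex_disjoint[symmetric, OF countable_V ev_conj[OF evD ev_up]]) (use disj in blast)
  also have "\<dots> \<le> ennreal (pr p (up (c * d) v))"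
  proof (intro ennreal_leI pr_mono ev_up)
    fix X assume "X \<subseteq> E" "\<exists>y\<in>V. D y X \<and> up d y X"
    then obtain y z where y: "y \<in> V" "T y X" and z: "z \<in> V" "d * w y \<le> w z"
        "z \<in> component {e \<in> X. \<forall>u\<in>e. w y \<le> w u} y"
      by (auto simp: D_def up_def)
    have cy: "c * w v \<le> w y" using y by (simp add: T_def)
    moreover have "w v \<le> c * w v" using c w_pos[OF v] by simp
    ultimately have vy: "w v \<le> w y" by linarith
    have "y \<in> component {e \<in> X. \<forall>u\<in>e. w v \<le> w u} v"
      by (rule component_mono[of y "{e \<in> X. (\<forall>u\<in>e. w v \<le> w u) \<and> e \<inter> W \<noteq> {}}"])
        (use y(2) in \<open>auto simp: T_def\<close>)
    moreover have "z \<in> component {e \<in> X. \<forall>u\<in>e. w v \<le> w u} y"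
      by (rule component_mono[OF z(3)]) (use vy in force)
    ultimately have "z \<in> component {e \<in> X. \<forall>u\<in>e. w v \<le> w u} v" by (rule component_trans)
    moreover have "(c * d) * w v \<le> w z"
      using mult_left_mono[OF cy d] z(2) by (simp add: ac_simps)
    ultimately show "up (c * d) v X" using z(1) by (auto simp: up_def)
  qed
  finally show ?thesis by (simp flip: ennreal_mult)
qed

lemma pr_up_power:
  assumes "v \<in> V" "1 \<le> c"
  shows "pr p (up c v) ^ k \<le> pr p (up (c ^ k) v)"
proof (induction k)
  case 0
  have "up 1 v X" for X using assms(1) component_refl by (force simp: up_def)
  then show ?case using pr_True[of p] by simp
next
  case (Suc k)
  have "pr p (up c v) ^ Suc k \<le> pr p (up c v) * pr p (up (c ^ k) v)"
    using Suc by (simp add: mult_left_mono)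
  also have "\<dots> \<le> pr p (up (c ^ Suc k) v)"
    using pr_up_supermult[OF assms, of "c ^ k"] assms(2) by simp
  finally show ?case .
qed

text \<open>The truncated bound is uniform in \<open>n\<close>, so monotone convergence removes the
  truncation.\<close>

lemma susceptibility_bound:
  assumes S: "finite S" "v \<in> S" "v \<in> V" "S \<subseteq> V" and p: "0 \<le> p" "p \<le> 1" and phi: "phi p S v < 1"
  shows "(\<integral>\<^sup>+z. ennreal (pr p (\<lambda>X. z \<in> component X v)) \<partial>count_space V) \<le>
    ennreal (card S / (1 - phi p S v))"
proof -
  have inc: "pr p (\<lambda>X. reach n X v z) \<le> pr p (\<lambda>X. reach (Suc n) X v z)" for n z
    by (rule pr_mono[OF ev_reach(2)]) (auto simp: reach_def intro: le_SucI)
  have SUP: "(SUP n. ennreal (pr p (\<lambda>X. reach n X v z))) = ennreal (pr p (\<lambda>X. z \<in> component X v))" for z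
  proof -
    have "(\<lambda>n. pr p (\<lambda>X. reach n X v z)) \<longlonglongrightarrow> pr p (\<lambda>X. \<exists>n. reach n X v z)"
      by (rule pr_incseq[OF ev_reach(2)]) (auto simp: reach_def intro: le_SucI)
    also have "(\<lambda>X. \<exists>n. reach n X v z) = (\<lambda>X. z \<in> component X v)"
      by (auto simp: reach_def component_iff_relpow fun_eq_iff)
    finally have "(\<lambda>n. ennreal (pr p (\<lambda>X. reach n X v z))) \<longlonglongrightarrow> ennreal (pr p (\<lambda>X. z \<in> component X v))"
      by (rule tendsto_ennrealI)
    moreover have "incseq (\<lambda>n. ennreal (pr p (\<lambda>X. reach n X v z)))"
      using inc by (intro incseq_SucI ennreal_leI)
    ultimately show ?thesis using LIMSEQ_SUP LIMSEQ_unique by blast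
  qed
  have "(\<integral>\<^sup>+z. ennreal (pr p (\<lambda>X. z \<in> component X v)) \<partial>count_space V) =
      (\<integral>\<^sup>+z. (SUP n. ennreal (pr p (\<lambda>X. reach n X v z))) \<partial>count_space V)"
    by (simp add: SUP)
  also have "\<dots> = (SUP n. \<integral>\<^sup>+z. ennreal (pr p (\<lambda>X. reach n X v z)) \<partial>count_space V)"
    using inc by (intro nn_integral_monotone_convergence_SUP) (auto intro!: incseq_SucI le_funI ennreal_leI)
  also have "\<dots> \<le> ennreal (card S / (1 - phi p S v))"
    by (intro SUP_least susceptibility_reach_bound assms)
  finally show ?thesis .
qed

text \<open>Transport the connection probabilities: \<open>v\<close> receives the expected cluster
  size. It sends, with weights \<open>w z / w v\<close>, at least \<open>c\<close> times the
  expected number of cluster vertices at relative height \<open>c\<close> or more.\<close>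

lemma pr_up_mult_le_susceptibility:
  assumes v: "v \<in> V" and c: "0 \<le> c"
  shows "ennreal (c * pr p (up c v)) \<le> (\<integral>\<^sup>+z. ennreal (pr p (\<lambda>X. z \<in> component X v)) \<partial>count_space V)"
proof -
  let ?f = "\<lambda>x y. ennreal (pr p (\<lambda>X. y \<in> component X x))"
  have "pr p (up c v) \<le> pr p (\<lambda>X. \<exists>z\<in>V. c * w v \<le> w z \<and> z \<in> component X v)"
  proof (rule pr_mono)
    show "ev (\<lambda>X. \<exists>z\<in>V. c * w v \<le> w z \<and> z \<in> component X v)"
      by (intro ev_bex countable_V ev_conj ev_const ev_component_UNIV)
    fix X assume "up c v X"
    then obtain z where "z \<in> V" "c * w v \<le> w z" "z \<in> component {e \<in> X. \<forall>u\<in>e. w v \<le> w u} v"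
      by (auto simp: up_def)
    moreover from this(3) have "z \<in> component X v" by (rule component_mono) auto
    ultimately show "\<exists>z\<in>V. c * w v \<le> w z \<and> z \<in> component X v" by blast
  qed
  then have "ennreal (c * pr p (up c v)) \<le> ennreal c * ennreal (pr p (\<lambda>X. \<exists>z\<in>V. c * w v \<le> w z \<and> z \<in> component X v))"
    using c by (simp add: mult_left_mono flip: ennreal_mult)
  also have "\<dots> \<le> ennreal c * (\<integral>\<^sup>+z. ennreal (pr p (\<lambda>X. c * w v \<le> w z \<and> z \<in> component X v)) \<partial>count_space V)"
    by (intro mult_left_mono pr_bex_le countable_V ev_conj ev_const ev_component_UNIV) auto
  also have "\<dots> = (\<integral>\<^sup>+z. ennreal c * ennreal (pr p (\<lambda>X. c * w v \<le> w z \<and> z \<in> component X v)) \<partial>count_space V)"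
    by (rule nn_integral_cmult[symmetric]) simp
  also have "\<dots> \<le> (\<integral>\<^sup>+z. ?f v z * ennreal (w z / w v) \<partial>count_space V)"
  proof (rule nn_integral_mono)
    fix z assume "z \<in> space (count_space V)"
    show "ennreal c * ennreal (pr p (\<lambda>X. c * w v \<le> w z \<and> z \<in> component X v)) \<le> ?f v z * ennreal (w z / w v)"
    proof (cases "c * w v \<le> w z")
      case True
      then have "ennreal c \<le> ennreal (w z / w v)"
        using w_pos[OF v] by (intro ennreal_leI) (simp add: pos_le_divide_eq)
      then show ?thesis using True by (simp add: mult.commute[of "ennreal c"] mult_left_mono)
    qed (simp add: pr_def event_def)
  qed
  also have "\<dots> = (\<integral>\<^sup>+y. ?f y v \<partial>count_space V)"
  proof (rule mass_transport[symmetric, OF _ v])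
    fix g x y assume g: "g \<in> Aut V E"
    show "?f (g x) (g y) = ?f x y"
      by (intro arg_cong[of _ _ ennreal] pr_Aut[OF g ev_component_UNIV] component_image Aut_bij g)
  qed
  also have "\<dots> = (\<integral>\<^sup>+z. ?f v z \<partial>count_space V)"
    by (intro nn_integral_cong arg_cong[of _ _ ennreal] pr_cong) (auto intro: component_sym)
  finally show ?thesis .
qed

text \<open>If the product exceeded 1, its powers would be unbounded, whereas
  \<open>pr_up_power\<close> puts all of them below one finite bound on the susceptibility.\<close>

lemma pr_up_subcritical:
  assumes S: "finite S" "v \<in> S" "v \<in> V" "S \<subseteq> V" and p: "0 \<le> p" "p \<le> 1" and phi: "phi p S v < 1"
    and c: "1 \<le> c"
  shows "c * pr p (up c v) \<le> 1"
proof (rule ccontr)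
  assume *: "\<not> ?thesis"
  let ?B = "card S / (1 - phi p S v)"
  obtain k where k: "?B < (c * pr p (up c v)) ^ k" using real_arch_pow * by force
  have "(c * pr p (up c v)) ^ k \<le> c ^ k * pr p (up (c ^ k) v)"
    using pr_up_power[OF S(3) c, of p k] c by (simp add: power_mult_distrib mult_left_mono)
  moreover have "ennreal (c ^ k * pr p (up (c ^ k) v)) \<le> ennreal ?B"
    using pr_up_mult_le_susceptibility[OF S(3), of "c ^ k" p] susceptibility_bound[OF S p phi] c
    by (auto intro: order_trans)
  then have "c ^ k * pr p (up (c ^ k) v) \<le> ?B"
    using phi by (subst (asm) ennreal_le_iff) auto
  ultimately show False using k by linarith
qed

section \<open>The critical point\<close>

lemma pr_1_all_open: "pr 1 (\<lambda>X. X = E) = 1"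
proof -
  have ev: "ev (\<lambda>X. \<exists>e\<in>E. e \<notin> X)" by (intro ev_bex countable_E ev_not ev_mem)
  have "ennreal (pr 1 (\<lambda>X. \<exists>e\<in>E. e \<notin> X)) \<le> (\<integral>\<^sup>+e. ennreal (pr 1 (\<lambda>X. e \<notin> X)) \<partial>count_space E)"
    by (intro pr_bex_le countable_E ev_not ev_mem)
  also have "\<dots> = (\<integral>\<^sup>+e. 0 \<partial>count_space E)"
    by (rule nn_integral_cong) (simp add: pr_not[OF ev_mem] pr_open)
  finally have "pr 1 (\<lambda>X. \<exists>e\<in>E. e \<notin> X) = 0" by simp
  moreover have "pr 1 (\<lambda>X. X = E) = pr 1 (\<lambda>X. \<not> (\<exists>e\<in>E. e \<notin> X))" by (rule pr_cong) auto
  ultimately show ?thesis using pr_not[OF ev] by simp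
qed

lemma critical_probability_eq:
  "critical_probability E v = Inf {p \<in> {0..1}. 0 < pr p (\<lambda>X. infinite (component X v))}"
proof -
  have "pr p (\<lambda>X. infinite (component X v)) = measure (bond_percolation E p)
      {\<omega> \<in> space (bond_percolation E p). infinite (cluster E \<omega> v)}" for p
    by (simp add: pr_def event_eq[of _ p] cluster_def)
  then show ?thesis by (simp add: critical_probability_def)
qed

lemma
  assumes v: "v \<in> V"
  shows critical_probability_nonneg: "0 \<le> critical_probability E v"
    and critical_probability_le_1: "critical_probability E v \<le> 1"
    and subcritical: "0 \<le> p \<Longrightarrow> p < critical_probability E v \<Longrightarrow> pr p (\<lambda>X. infinite (component X v)) = 0"
proof -
  let ?S = "{p \<in> {0..1}. 0 < pr p (\<lambda>X. infinite (component X v))}"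
  have "1 = pr 1 (\<lambda>X. X = E)" by (simp add: pr_1_all_open)
  also have "\<dots> \<le> pr 1 (\<lambda>X. infinite (component X v))"
    by (rule pr_mono[OF ev_infinite_component[OF v]]) (use component_E[OF v] infinite in auto)
  finally have 1: "1 \<in> ?S" by simp
  have bdd: "bdd_below ?S" by (rule bdd_belowI[of _ 0]) auto
  show "0 \<le> critical_probability E v"
    unfolding critical_probability_eq using 1 by (intro cInf_greatest) auto
  show le: "critical_probability E v \<le> 1"
    unfolding critical_probability_eq using 1 bdd by (rule cInf_lower)
  assume p: "0 \<le> p" "p < critical_probability E v"
  then have "p \<notin> ?S" using cInf_lower[OF _ bdd, of p] unfolding critical_probability_eq by force
  then show "pr p (\<lambda>X. infinite (component X v)) = 0"
    using p le pr_nonneg[of p "\<lambda>X. infinite (component X v)"] by auto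
qed

lemma pr_up_below_critical:
  assumes v: "v \<in> V" and p: "0 \<le> p" "p < critical_probability E v" and c: "1 \<le> c"
  shows "c * pr p (up c v) \<le> 1"
proof -
  \<comment> \<open>A set with \<open>phi\<close> below 1 at \<open>p\<close> comes from the absence
    of infinite clusters at a strictly larger parameter, still subcritical.\<close>
  define q where "q = (p + critical_probability E v) / 2"
  have q: "p < q" "q < critical_probability E v" "q \<le> 1"
    using p critical_probability_le_1[OF v] by (auto simp: q_def)
  then have "pr q (\<lambda>X. infinite (component X v)) = 0" using p by (intro subcritical v) auto
  then obtain S where "finite S" "v \<in> S" "S \<subseteq> V" "phi p S v < 1"
    using exists_phi_less_1[OF v p(1) q(1,3)] by blast
  then show ?thesis using v p q c by (intro pr_up_subcritical) auto
qed

text \<open>The event is an increasing union of events on finite edge sets, whose probabilities are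
  continuous in \<open>p\<close>. The bound passes to the critical point for each finite edge set,
  and only then to the union.\<close>

lemma pr_up_critical:
  assumes v: "v \<in> V" and c: "1 \<le> c"
  defines "pc \<equiv> critical_probability E v"
  shows "c * pr pc (up c v) \<le> 1"
proof (cases "pc = 0")
  case True
  \<comment> \<open>There is no parameter below 0 to approximate from; at 0 itself
    \<open>phi\<close> vanishes.\<close>
  have "phi pc {v} v < 1" by (simp add: phi_def True)
  then show ?thesis using v c by (intro pr_up_subcritical[of "{v}"]) (auto simp: True)
next
  case False
  then have pc: "0 < pc" "pc \<le> 1"
    using critical_probability_nonneg[OF v] critical_probability_le_1[OF v] by (auto simp: pc_def)
  define F where "F n = {e \<in> E. to_nat_on E e \<le> n}" for n
  have F: "finite (F n)" "F n \<subseteq> E" for n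
  proof -
    have "inj_on (to_nat_on E) (F n)"
      using inj_on_to_nat_on[OF countable_E] by (rule inj_on_subset) (auto simp: F_def)
    moreover have "finite (to_nat_on E ` F n)"
      by (rule finite_subset[of _ "{..n}"]) (auto simp: F_def)
    ultimately show "finite (F n)" using finite_imageD by auto
  qed (auto simp: F_def)
  have dep: "depends (F n) (\<lambda>X. up c v (X \<inter> F n))" for n by (rule dependsI) (simp add: Int_assoc)
  have up_mono: "up c v Y" if "up c v X" "X \<subseteq> Y" for X Y
  proof -
    have "{e \<in> X. \<forall>u\<in>e. w v \<le> w u} \<subseteq> {e \<in> Y. \<forall>u\<in>e. w v \<le> w u}" using that by auto
    then show ?thesis using that(1) component_mono unfolding up_def by meson
  qed
  have le: "c * pr pc (\<lambda>X. up c v (X \<inter> F n)) \<le> 1" for n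
  proof -
    define s where "s k = pc * (real k / real (Suc k))" for k
    have s: "0 \<le> s k" "s k < pc" for k
      using pc by (auto simp: s_def field_simps)
    have "(\<lambda>k. real k / real (Suc k)) \<longlonglongrightarrow> 1" by (rule LIMSEQ_n_over_Suc_n)
    then have "(\<lambda>k. pc * (real k / real (Suc k))) \<longlonglongrightarrow> pc * 1" by (rule tendsto_mult_left)
    then have "s \<longlonglongrightarrow> pc" by (simp add: s_def[abs_def])
    then have "(\<lambda>k. pr (s k) (\<lambda>X. up c v (X \<inter> F n))) \<longlonglongrightarrow> pr pc (\<lambda>X. up c v (X \<inter> F n))"
    proof (rule continuous_on_tendsto_compose[OF continuous_on_pr[OF F dep]])
      have "s k \<in> {0..1}" for k using s[of k] pc by auto
      then show "\<forall>\<^sub>F k in sequentially. s k \<in> {0..1}" by simp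
    qed (use pc in auto)
    then have "(\<lambda>k. c * pr (s k) (\<lambda>X. up c v (X \<inter> F n))) \<longlonglongrightarrow> c * pr pc (\<lambda>X. up c v (X \<inter> F n))"
      by (intro tendsto_intros)
    moreover have "c * pr (s k) (\<lambda>X. up c v (X \<inter> F n)) \<le> 1" for k
    proof -
      have "pr (s k) (\<lambda>X. up c v (X \<inter> F n)) \<le> pr (s k) (up c v)"
        by (rule pr_mono[OF ev_up]) (auto elim: up_mono)
      then have "c * pr (s k) (\<lambda>X. up c v (X \<inter> F n)) \<le> c * pr (s k) (up c v)"
        using c by (intro mult_left_mono) auto
      also have "\<dots> \<le> 1" using s pr_up_below_critical[OF v _ _ c] by (simp add: pc_def)
      finally show ?thesis .
    qed
    ultimately show ?thesis by (intro LIMSEQ_le_const2) auto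
  qed
  have "(\<lambda>n. pr pc (\<lambda>X. up c v (X \<inter> F n))) \<longlonglongrightarrow> pr pc (\<lambda>X. \<exists>n. up c v (X \<inter> F n))"
  proof (rule pr_incseq)
    show "ev (\<lambda>X. up c v (X \<inter> F n))" for n using ev_depends_finite[OF F(1) dep] .
    show "up c v (X \<inter> F (Suc n))" if "up c v (X \<inter> F n)" for n X
      using that by (rule up_mono) (auto simp: F_def)
  qed
  moreover have "pr pc (\<lambda>X. \<exists>n. up c v (X \<inter> F n)) = pr pc (up c v)"
  proof (rule pr_cong, rule iffI)
    fix X assume X: "X \<subseteq> E" and "up c v X"
    then obtain z k where z: "z \<in> V" "c * w v \<le> w z" "(v, z) \<in> adj {e \<in> X. \<forall>u\<in>e. w v \<le> w u} ^^ k"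
      by (auto simp: up_def component_iff_relpow)
    then obtain G where G: "finite G" "G \<subseteq> {e \<in> X. \<forall>u\<in>e. w v \<le> w u}" "(v, z) \<in> adj G ^^ k"
      using iffD1[OF relpow_adj_finite z(3)] by blast
    define n where "n = Max (to_nat_on E ` G)"
    have "G \<subseteq> F n" using G X by (auto simp: F_def n_def)
    then have "G \<subseteq> {e \<in> X \<inter> F n. \<forall>u\<in>e. w v \<le> w u}" using G(2) by auto
    moreover have "z \<in> component G v" using G(3) component_iff_relpow by metis
    ultimately have "z \<in> component {e \<in> X \<inter> F n. \<forall>u\<in>e. w v \<le> w u} v" by (rule component_mono[rotated])
    then show "\<exists>n. up c v (X \<inter> F n)" using z by (auto simp: up_def)
  qed (auto elim: up_mono)
  ultimately have "(\<lambda>n. c * pr pc (\<lambda>X. up c v (X \<inter> F n))) \<longlonglongrightarrow> c * pr pc (up c v)"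
    by (auto intro!: tendsto_intros)
  then show ?thesis by (rule LIMSEQ_le_const2) (use le in auto)
qed

end

section \<open>Expected numbers of occurring events\<close>

context countable_edges
begin

text \<open>Tonelli. The number of occurring events is written as a counting measure, which is
  correctly infinite where \<open>card\<close> would be 0.\<close>

lemma nn_integral_pr:
  assumes "countable I" "\<And>i. i \<in> I \<Longrightarrow> ev (Q i)"
  shows "(\<integral>\<^sup>+i. ennreal (pr p (Q i)) \<partial>count_space I) =
    (\<integral>\<^sup>+\<omega>. emeasure (count_space I) {i \<in> I. Q i (open_edges E \<omega>)} \<partial>bond_percolation E p)"
proof -
  have "(\<integral>\<^sup>+i. ennreal (pr p (Q i)) \<partial>count_space I) =
      (\<integral>\<^sup>+i. (\<integral>\<^sup>+\<omega>. indicator (event (Q i)) \<omega> \<partial>bond_percolation E p) \<partial>count_space I)"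
    using assms(2) by (intro nn_integral_cong) (simp add: ev_sets emeasure_event)
  also have "\<dots> = (\<integral>\<^sup>+\<omega>. (\<integral>\<^sup>+i. indicator (event (Q i)) \<omega> \<partial>count_space I) \<partial>bond_percolation E p)"
    using assms by (intro nn_integral_count_space_nn_integral[symmetric] borel_measurable_indicator ev_sets)
  also have "\<dots> = (\<integral>\<^sup>+\<omega>. emeasure (count_space I) {i \<in> I. Q i (open_edges E \<omega>)} \<partial>bond_percolation E p)"
  proof (rule nn_integral_cong)
    fix \<omega> assume "\<omega> \<in> space (bond_percolation E p)"
    then have "(\<integral>\<^sup>+i. indicator (event (Q i)) \<omega> \<partial>count_space I) =
        (\<integral>\<^sup>+i. indicator {i \<in> I. Q i (open_edges E \<omega>)} i \<partial>count_space I :: ennreal)"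
      by (intro nn_integral_cong) (auto simp: event_eq[of _ p] indicator_def)
    also have "\<dots> = emeasure (count_space I) {i \<in> I. Q i (open_edges E \<omega>)}"
      by (rule nn_integral_indicator) auto
    finally show "(\<integral>\<^sup>+i. indicator (event (Q i)) \<omega> \<partial>count_space I) =
        emeasure (count_space I) {i \<in> I. Q i (open_edges E \<omega>)}" .
  qed
  finally show ?thesis .
qed

text \<open>The count is bounded on finite subsets because \<open>card\<close> of an infinite set is
  0; this form also forces finiteness.\<close>

lemma nn_integral_pr_le:
  assumes "countable I" "\<And>i. i \<in> I \<Longrightarrow> ev (Q i)" "ev R"
    and "\<And>i X. i \<in> I \<Longrightarrow> X \<subseteq> E \<Longrightarrow> Q i X \<Longrightarrow> R X"
    and card: "\<And>X F. X \<subseteq> E \<Longrightarrow> finite F \<Longrightarrow> F \<subseteq> {i \<in> I. Q i X} \<Longrightarrow> card F \<le> m"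
  shows "(\<integral>\<^sup>+i. ennreal (pr p (Q i)) \<partial>count_space I) \<le> ennreal (real m * pr p R)"
proof -
  have X: "open_edges E \<omega> \<subseteq> E" for \<omega> by (auto simp: open_edges_def)
  have "(\<integral>\<^sup>+i. ennreal (pr p (Q i)) \<partial>count_space I) =
      (\<integral>\<^sup>+\<omega>. emeasure (count_space I) {i \<in> I. Q i (open_edges E \<omega>)} \<partial>bond_percolation E p)"
    by (rule nn_integral_pr[OF assms(1,2)])
  also have "\<dots> \<le> (\<integral>\<^sup>+\<omega>. ennreal m * indicator (event R) \<omega> \<partial>bond_percolation E p)"
  proof (rule nn_integral_mono)
    fix \<omega> assume \<omega>: "\<omega> \<in> space (bond_percolation E p)"
    let ?A = "{i \<in> I. Q i (open_edges E \<omega>)}"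
    have fin: "finite ?A"
    proof (rule ccontr)
      assume "infinite ?A"
      then obtain F where "F \<subseteq> ?A" "finite F" "card F = Suc m" using infinite_arbitrarily_large by blast
      then show False using card[OF X, of F \<omega>] by simp
    qed
    then have "card ?A \<le> m" using card[OF X, of ?A \<omega>] by simp
    show "emeasure (count_space I) ?A \<le> ennreal m * indicator (event R) \<omega>"
    proof (cases "?A = {}")
      case False
      then have "\<omega> \<in> event R" using assms(4)[OF _ X] \<omega> by (auto simp: event_eq[of _ p])
      then show ?thesis
        using fin \<open>card ?A \<le> m\<close>
        by (subst emeasure_count_space_finite) (auto simp: ennreal_of_nat_eq_real_of_nat)
    qed (simp only: emeasure_empty zero_le)
  qed
  also have "\<dots> = ennreal m * ennreal (pr p R)"
    using assms(3) by (simp add: nn_integral_cmult_indicator ev_sets emeasure_event)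
  finally show ?thesis by (simp add: ennreal_mult)
qed

lemma mult_pr_le_nn_integral:
  assumes "countable I" "\<And>i. i \<in> I \<Longrightarrow> ev (Q i)" "ev R"
    and card: "\<And>X. X \<subseteq> E \<Longrightarrow> R X \<Longrightarrow> \<exists>F. finite F \<and> F \<subseteq> {i \<in> I. Q i X} \<and> m \<le> card F"
  shows "ennreal (real m * pr p R) \<le> (\<integral>\<^sup>+i. ennreal (pr p (Q i)) \<partial>count_space I)"
proof -
  have X: "open_edges E \<omega> \<subseteq> E" for \<omega> by (auto simp: open_edges_def)
  have "ennreal (real m * pr p R) = (\<integral>\<^sup>+\<omega>. ennreal m * indicator (event R) \<omega> \<partial>bond_percolation E p)"
    using assms(3) by (simp add: nn_integral_cmult_indicator ev_sets emeasure_event ennreal_mult)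
  also have "\<dots> \<le> (\<integral>\<^sup>+\<omega>. emeasure (count_space I) {i \<in> I. Q i (open_edges E \<omega>)} \<partial>bond_percolation E p)"
  proof (rule nn_integral_mono)
    fix \<omega>
    let ?A = "{i \<in> I. Q i (open_edges E \<omega>)}"
    show "ennreal m * indicator (event R) \<omega> \<le> emeasure (count_space I) ?A"
    proof (cases "\<omega> \<in> event R")
      case True
      then obtain F where F: "finite F" "F \<subseteq> ?A" "m \<le> card F"
        using card[OF X, of \<omega>] by (auto simp: event_def)
      have "ennreal m * indicator (event R) \<omega> \<le> ennreal (card F)"
        using True F(3) by (simp add: ennreal_leI)
      also have "\<dots> = emeasure (count_space I) F"
        using F by (subst emeasure_count_space_finite) (auto simp: ennreal_of_nat_eq_real_of_nat)
      also have "\<dots> \<le> emeasure (count_space I) ?A" using F by (intro emeasure_mono) auto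
      finally show ?thesis .
    qed simp
  qed
  also have "\<dots> = (\<integral>\<^sup>+i. ennreal (pr p (Q i)) \<partial>count_space I)"
    by (rule nn_integral_pr[OF assms(1,2), symmetric])
  finally show ?thesis .
qed

end

context transitive_graph
begin

lemma degree_bound: "\<exists>d. \<forall>v\<in>V. card {e \<in> E. v \<in> e} \<le> d"
proof -
  obtain o' where o': "o' \<in> V" using V_nonempty by auto
  have "card {e \<in> E. v \<in> e} \<le> card {e \<in> E. o' \<in> e}" if v: "v \<in> V" for v
  proof -
    obtain g where g: "g \<in> Aut V E" "g v = o'" using transitive[OF v o'] by blast
    have inj: "inj_on ((`) g) {e \<in> E. v \<in> e}"
      using Aut_bij_betw_E[OF g(1)] by (auto simp: bij_betw_def intro: inj_on_subset)
    have sub: "(`) g ` {e \<in> E. v \<in> e} \<subseteq> {e \<in> E. o' \<in> e}"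
      using Aut_image_E[OF g(1)] g(2) by auto
    have "finite {e \<in> E. o' \<in> e}"
      using finite_incident[of "{o'}"] by simp
    then show ?thesis using card_inj_on_le[OF inj sub] by simp
  qed
  then show ?thesis by blast
qed

section \<open>Exploring a cluster inside a region\<close>

definition inner :: "'a set \<Rightarrow> 'a \<Rightarrow> 'a set set \<Rightarrow> 'a set" where
  "inner W x X = component {e \<in> X. e \<subseteq> W} x"

definition exits :: "'a set \<Rightarrow> 'a \<Rightarrow> 'a set set \<Rightarrow> 'a set" where
  "exits W x X = {v. v \<notin> W \<and> (\<exists>u\<in>inner W x X. {u, v} \<in> X)}"

lemma inner_subset: "x \<in> W \<Longrightarrow> inner W x X \<subseteq> W"
  unfolding inner_def by (rule component_closed) auto

lemma inner_subset_component: "inner W x X \<subseteq> component X x"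
  unfolding inner_def using component_mono[of _ "{e \<in> X. e \<subseteq> W}" x X] by auto

lemma exits_subset_component: "exits W x X \<subseteq> component X x"
proof
  fix v assume "v \<in> exits W x X"
  then obtain u where u: "u \<in> inner W x X" "{u, v} \<in> X" by (auto simp: exits_def)
  then have "u \<in> component X x" using inner_subset_component by blast
  then show "v \<in> component X x" using u(2) by (rule component_edge)
qed

lemma exits_nonempty:
  assumes "x \<in> W" "z \<in> component X x" "z \<notin> W"
  shows "exits W x X \<noteq> {}"
proof -
  have "x \<in> inner W x X" by (simp add: inner_def component_refl)
  moreover have "z \<notin> inner W x X" using inner_subset[OF assms(1)] assms(3) by auto
  ultimately obtain u v where uv: "u \<in> inner W x X" "v \<notin> inner W x X" "{u, v} \<in> X"
    using component_exit_edge[OF assms(2)] by blast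
  have "v \<notin> W"
  proof
    assume "v \<in> W"
    then have "{u, v} \<in> {e \<in> X. e \<subseteq> W}" using uv inner_subset[OF assms(1), of X] by auto
    then show False using uv(1,2) component_edge unfolding inner_def by metis
  qed
  then show ?thesis using uv by (auto simp: exits_def)
qed

lemma finite_exits: "finite (inner W x X) \<Longrightarrow> X \<subseteq> E \<Longrightarrow> finite (exits W x X)"
proof -
  assume *: "finite (inner W x X)" "X \<subseteq> E"
  have "exits W x X \<subseteq> (\<Union>u\<in>inner W x X. {v. {v, u} \<in> E})"
  proof
    fix v assume "v \<in> exits W x X"
    then obtain u where "u \<in> inner W x X" "{v, u} \<in> X" by (auto simp: exits_def insert_commute)
    then show "v \<in> (\<Union>u\<in>inner W x X. {v. {v, u} \<in> E})" using *(2) by blast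
  qed
  moreover have "finite (\<Union>u\<in>inner W x X. {v. {v, u} \<in> E})"
    using *(1) finite_neighbours by (intro finite_UN_I)
  ultimately show ?thesis by (rule finite_subset)
qed

definition escapes :: "'a set \<Rightarrow> 'a \<Rightarrow> 'a set set \<Rightarrow> bool" where
  "escapes W x X \<longleftrightarrow> finite (inner W x X) \<and> exits W x X \<noteq> {}"

text \<open>These are the countably many possible outcomes of a finite exploration with an exit;
  conditioning on the outcome becomes a sum over them.\<close>

definition shapes :: "'a set \<Rightarrow> ('a set \<times> 'a set) set" where
  "shapes W = {K. finite K \<and> K \<subseteq> V \<and> K \<subseteq> W} \<times> {R. finite R \<and> R \<subseteq> V \<and> R \<noteq> {} \<and> R \<inter> W = {}}"

definition has_shape :: "'a set \<Rightarrow> 'a \<Rightarrow> 'a set \<times> 'a set \<Rightarrow> 'a set set \<Rightarrow> bool" where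
  "has_shape W x = (\<lambda>(K, R) X. inner W x X = K \<and> exits W x X = R)"

lemma has_shape_iff: "has_shape W x i X \<longleftrightarrow> i = (inner W x X, exits W x X)"
  by (cases i) (auto simp: has_shape_def)

lemma countable_shapes: "countable (shapes W)"
proof -
  have "shapes W \<subseteq> {K. finite K \<and> K \<subseteq> V} \<times> {K. finite K \<and> K \<subseteq> V}" by (auto simp: shapes_def)
  then show ?thesis
    by (rule countable_subset) (intro countable_SIGMA countable_finite_subsets countable_V)
qed

lemma escapes_iff:
  assumes "x \<in> V" "x \<in> W" "X \<subseteq> E"
  shows "escapes W x X \<longleftrightarrow> (\<exists>i\<in>shapes W. has_shape W x i X)"
proof
  assume e: "escapes W x X"
  have "inner W x X \<subseteq> V" "exits W x X \<subseteq> V"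
    using component_subset_V[OF assms(1,3)] inner_subset_component exits_subset_component by blast+
  then have "(inner W x X, exits W x X) \<in> shapes W"
    using e inner_subset[OF assms(2)] finite_exits[of W x X] assms(3)
    by (auto simp: shapes_def escapes_def exits_def)
  then show "\<exists>i\<in>shapes W. has_shape W x i X" by (simp add: has_shape_iff)
qed (auto simp: escapes_def shapes_def has_shape_def)

text \<open>Only edges touching \<open>K\<close> are inspected: they decide whether the inner
  cluster is \<open>K\<close>, and each edge to an exit has an end in \<open>K\<close>.\<close>

lemma has_shape_event:
  assumes "finite K"
  shows "depends {e \<in> E. e \<inter> K \<noteq> {}} (has_shape W x (K, R))" and "ev (has_shape W x (K, R))"
proof -
  let ?J = "{e \<in> E. e \<inter> K \<noteq> {}}"
  show dep: "depends ?J (has_shape W x (K, R))"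
  proof (rule dependsI)
    fix X assume X: "X \<subseteq> E"
    have "inner W x X = K \<longleftrightarrow> inner W x (X \<inter> ?J) = K"
      unfolding inner_def by (rule iffI; erule component_cong) (use X in auto)
    moreover have "exits W x X = exits W x (X \<inter> ?J)" if "inner W x X = K" "inner W x (X \<inter> ?J) = K"
      unfolding exits_def that using X by auto
    ultimately show "has_shape W x (K, R) X \<longleftrightarrow> has_shape W x (K, R) (X \<inter> ?J)"
      by (auto simp: has_shape_def)
  qed
  show "ev (has_shape W x (K, R))" using finite_incident[OF assms] dep by (rule ev_depends_finite)
qed

lemma ev_has_shape: "i \<in> shapes W \<Longrightarrow> ev (has_shape W x i)"
  using has_shape_event(2) by (auto simp: shapes_def)

lemma ev_escapes:
  assumes "x \<in> V" "x \<in> W"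
  shows "ev (escapes W x)" "ev (\<lambda>X. escapes W x X \<and> card (exits W x X) \<le> M)"
    "ev (\<lambda>X. escapes W x X \<and> \<not> card (exits W x X) \<le> M)"
proof -
  have "ev (\<lambda>X. \<exists>i\<in>shapes W. has_shape W x i X)"
    by (intro ev_bex countable_shapes ev_has_shape)
  also have "?this \<longleftrightarrow> ev (escapes W x)" by (rule ev_cong) (simp add: escapes_iff[OF assms])
  finally show 1: "ev (escapes W x)" .
  have "ev (\<lambda>X. \<exists>i\<in>shapes W. has_shape W x i X \<and> card (snd i) \<le> M)"
    by (intro ev_bex countable_shapes ev_conj ev_has_shape ev_const)
  also have "?this \<longleftrightarrow> ev (\<lambda>X. escapes W x X \<and> card (exits W x X) \<le> M)"
    by (rule ev_cong) (simp add: escapes_iff[OF assms] has_shape_iff)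
  finally show 2: "ev (\<lambda>X. escapes W x X \<and> card (exits W x X) \<le> M)" .
  have "ev (\<lambda>X. escapes W x X \<and> \<not> (escapes W x X \<and> card (exits W x X) \<le> M))"
    by (rule ev_conj[OF 1 ev_not[OF 2]])
  also have "?this \<longleftrightarrow> ev (\<lambda>X. escapes W x X \<and> \<not> card (exits W x X) \<le> M)"
    by (rule ev_cong) auto
  finally show "ev (\<lambda>X. escapes W x X \<and> \<not> card (exits W x X) \<le> M)" .
qed

text \<open>Given the cluster inside \<open>W\<close> and its exits, the remaining edges at the exits are independent
  of the explored edges, and the cluster stops at the exits if they are all closed.\<close>

lemma pr_stop_at_exits:
  assumes x: "x \<in> V" "x \<in> W" and p: "0 \<le> p" "p \<le> 1"
    and d: "\<And>v. v \<in> V \<Longrightarrow> card {e \<in> E. v \<in> e} \<le> d"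
  shows "(1 - p) ^ (d * M) * pr p (\<lambda>X. escapes W x X \<and> card (exits W x X) \<le> M) \<le>
    pr p (\<lambda>X. escapes W x X \<and> component X x \<subseteq> inner W x X \<union> exits W x X)"
proof -
  let ?I = "{i \<in> shapes W. card (snd i) \<le> M}"
  let ?\<delta> = "(1 - p) ^ (d * M)"
  \<comment> \<open>The edges at the exits that the exploration has not inspected. With at most
    \<open>M\<close> exits and degrees at most \<open>d\<close> there are at most
    \<open>d * M\<close> of them, so all are closed with probability at least
    \<open>(1 - p) ^ (d * M)\<close>.\<close>
  define B where "B = (\<lambda>(K :: 'a set, R :: 'a set). {e \<in> E. e \<inter> R \<noteq> {} \<and> e \<inter> K = {}})"
  let ?G = "\<lambda>i X. has_shape W x i X \<and> X \<inter> B i = {}"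
  have cI: "countable ?I" by (rule countable_subset[OF _ countable_shapes[of W]]) auto
  have finB: "finite (B i)" "B i \<subseteq> E" "card (B i) \<le> d * M" if i: "i \<in> ?I" for i
  proof -
    obtain K R where KR: "i = (K, R)" by (cases i)
    have R: "finite R" "R \<subseteq> V" "card R \<le> M" using i by (auto simp: KR shapes_def)
    have sub: "B i \<subseteq> (\<Union>v\<in>R. {e \<in> E. v \<in> e})" by (auto simp: B_def KR)
    have fin: "finite {e \<in> E. v \<in> e}" for v using finite_incident[of "{v}"] by simp
    then have finU: "finite (\<Union>v\<in>R. {e \<in> E. v \<in> e})" using R by blast
    show "finite (B i)" using sub finU by (rule finite_subset)
    have "card (B i) \<le> card (\<Union>v\<in>R. {e \<in> E. v \<in> e})" using finU sub by (rule card_mono)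
    also have "\<dots> \<le> (\<Sum>v\<in>R. card {e \<in> E. v \<in> e})" using R(1) by (rule card_UN_le)
    also have "\<dots> \<le> card R * d" using d R(2) by (intro sum_bounded_above[where K = d, simplified]) auto
    also have "\<dots> \<le> d * M" using R(3) by (simp add: mult.commute)
    finally show "card (B i) \<le> d * M" .
  qed (auto simp: B_def)
  have evB: "ev (\<lambda>X. X \<inter> B i = {})" if "i \<in> ?I" for i
    by (rule ev_depends_finite[OF finB(1)[OF that]]) (auto intro: dependsI)
  have shape: "ev (has_shape W x i)" if "i \<in> ?I" for i using that ev_has_shape by auto
  have indep: "?\<delta> * pr p (has_shape W x i) \<le> pr p (?G i)" if i: "i \<in> ?I" for i
  proof -
    obtain K R where KR: "i = (K, R)" by (cases i)
    have "pr p (?G i) = pr p (has_shape W x i) * pr p (\<lambda>X. X \<inter> B i = {})"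
    proof (rule pr_indep[OF shape[OF i] evB[OF i]])
      show "depends {e \<in> E. e \<inter> K \<noteq> {}} (has_shape W x i)"
        unfolding KR using i by (intro has_shape_event) (auto simp: KR shapes_def)
      show "depends (B i) (\<lambda>X. X \<inter> B i = {})" by (rule dependsI) auto
      show "{e \<in> E. e \<inter> K \<noteq> {}} \<inter> B i = {}" by (auto simp: B_def KR)
    qed
    also have "pr p (\<lambda>X. X \<inter> B i = {}) = (1 - p) ^ card (B i)"
      using finB[OF i] p by (intro pr_all_closed) auto
    finally have eq: "pr p (?G i) = pr p (has_shape W x i) * (1 - p) ^ card (B i)" .
    have "pr p (has_shape W x i) * ?\<delta> \<le> pr p (has_shape W x i) * (1 - p) ^ card (B i)"
      using p by (intro mult_left_mono power_decreasing finB(3)[OF i]) auto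
    then show ?thesis unfolding eq by (simp only: mult.commute[of ?\<delta>])
  qed
  have shape_unique: "i = j" if "has_shape W x i X" "has_shape W x j X" for i j X
    using that by (simp add: has_shape_iff)
  have eq: "pr p (\<lambda>X. escapes W x X \<and> card (exits W x X) \<le> M) = pr p (\<lambda>X. \<exists>i\<in>?I. has_shape W x i X)"
    by (rule pr_cong) (auto simp: escapes_iff[OF x] has_shape_iff)
  have "ennreal (?\<delta> * pr p (\<lambda>X. escapes W x X \<and> card (exits W x X) \<le> M)) =
      ennreal ?\<delta> * ennreal (pr p (\<lambda>X. \<exists>i\<in>?I. has_shape W x i X))"
    using p unfolding eq by (intro ennreal_mult) auto
  also have "ennreal (pr p (\<lambda>X. \<exists>i\<in>?I. has_shape W x i X)) =
      (\<integral>\<^sup>+i. ennreal (pr p (has_shape W x i)) \<partial>count_space ?I)"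
    by (rule pr_bex_disjoint[OF cI shape]) (assumption, rule shape_unique)
  also have "ennreal ?\<delta> * (\<integral>\<^sup>+i. ennreal (pr p (has_shape W x i)) \<partial>count_space ?I) =
      (\<integral>\<^sup>+i. ennreal ?\<delta> * ennreal (pr p (has_shape W x i)) \<partial>count_space ?I)"
    by (rule nn_integral_cmult[symmetric]) simp
  also have "\<dots> \<le> (\<integral>\<^sup>+i. ennreal (pr p (?G i)) \<partial>count_space ?I)"
  proof (rule nn_integral_mono)
    fix i assume "i \<in> space (count_space ?I)"
    then have "?\<delta> * pr p (has_shape W x i) \<le> pr p (?G i)" using indep by simp
    then show "ennreal ?\<delta> * ennreal (pr p (has_shape W x i)) \<le> ennreal (pr p (?G i))"
      using p by (simp add: ennreal_leI flip: ennreal_mult)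
  qed
  also have "\<dots> = ennreal (pr p (\<lambda>X. \<exists>i\<in>?I. ?G i X))"
  proof (rule pr_bex_disjoint[symmetric, OF cI])
    show "ev (?G i)" if "i \<in> ?I" for i using that shape evB by (intro ev_conj)
  qed (use shape_unique in blast)
  also have "\<dots> \<le> ennreal (pr p (\<lambda>X. escapes W x X \<and> component X x \<subseteq> inner W x X \<union> exits W x X))"
  proof (intro ennreal_leI pr_mono)
    have "ev (\<lambda>X. \<exists>i\<in>shapes W. has_shape W x i X \<and> (\<forall>z\<in>V. z \<in> component X x \<longrightarrow> z \<in> fst i \<union> snd i))"
      by (intro ev_bex countable_shapes ev_conj ev_has_shape ev_ball countable_V ev_imp ev_component_UNIV ev_const)
    also have "?this \<longleftrightarrow> ev (\<lambda>X. escapes W x X \<and> component X x \<subseteq> inner W x X \<union> exits W x X)"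
    proof (rule ev_cong)
      fix X assume X: "X \<subseteq> E"
      show "(\<exists>i\<in>shapes W. has_shape W x i X \<and> (\<forall>z\<in>V. z \<in> component X x \<longrightarrow> z \<in> fst i \<union> snd i)) \<longleftrightarrow>
          escapes W x X \<and> component X x \<subseteq> inner W x X \<union> exits W x X"
        using component_subset_V[OF x(1) X] by (auto simp: escapes_iff[OF x X] has_shape_iff)
    qed
    finally show "ev (\<lambda>X. escapes W x X \<and> component X x \<subseteq> inner W x X \<union> exits W x X)" .
  next
    fix X assume X: "X \<subseteq> E" and "\<exists>i\<in>?I. ?G i X"
    then obtain K R where KR: "(K, R) \<in> shapes W" "inner W x X = K" "exits W x X = R" "X \<inter> B (K, R) = {}"
      by (auto simp: has_shape_def)
    have "component X x \<subseteq> K \<union> R"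
    proof (rule component_closed)
      show "x \<in> K \<union> R" using KR(2) component_refl[of x] by (auto simp: inner_def)
      fix u v assume u: "u \<in> K \<union> R" and uv: "{u, v} \<in> X"
      show "v \<in> K \<union> R"
      proof (cases "u \<in> K")
        case True
        show ?thesis
        proof (cases "v \<in> W")
          case vW: True
          have "{u, v} \<in> {e \<in> X. e \<subseteq> W}" using uv vW True KR(1) by (auto simp: shapes_def)
          then have "v \<in> inner W x X"
            using True component_edge[of u "{e \<in> X. e \<subseteq> W}" x v] KR(2) by (simp add: inner_def)
          then show ?thesis using KR(2) by simp
        next
          case False
          then have "v \<in> exits W x X" using True uv KR(2) by (auto simp: exits_def)
          then show ?thesis using KR(3) by simp
        qed
      next
        case False
        \<comment> \<open>Here \<open>u\<close> is an exit outside \<open>K\<close>. An open edge at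
          \<open>u\<close> is not in \<open>B\<close>, so its other end lies in
          \<open>K\<close>.\<close>
        then have "{u, v} \<notin> B (K, R)" "{u, v} \<inter> R \<noteq> {}" using uv KR(4) u by auto
        then show ?thesis using False uv X by (auto simp: B_def)
      qed
    qed
    moreover have "escapes W x X" using escapes_iff[OF x X] KR by (auto simp: has_shape_def)
    ultimately show "escapes W x X \<and> component X x \<subseteq> inner W x X \<union> exits W x X" using KR by simp
  qed
  finally show ?thesis by (subst (asm) ennreal_le_iff) auto
qed

end

section \<open>Light clusters at the critical point\<close>

context weighted_graph
begin

section \<open>Height bands and mass transport for clusters with a bounded top\<close>

lemma exists_ratio_bound: "\<exists>r>1. \<forall>u v. {u, v} \<in> E \<longrightarrow> w v \<le> r * w u"
proof -
  obtain b where b: "b \<in> V" using V_nonempty by auto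
  define N where "N = {z. {z, b} \<in> E}"
  have N: "finite N" "N \<subseteq> V" using finite_neighbours edge_in_V by (auto simp: N_def)
  \<comment> \<open>The sum dominates the ratio to each neighbour of \<open>b\<close>, transitivity
    carries the bound to all edges, and the summand 2 ensures \<open>1 < r\<close>.\<close>
  define r where "r = 2 + (\<Sum>z\<in>N. w z / w b)"
  have pos: "0 \<le> w z / w b" if "z \<in> N" for z using that N b w_pos by (auto intro!: divide_nonneg_nonneg less_imp_le)
  have "w v \<le> r * w u" if uv: "{u, v} \<in> E" for u v
  proof -
    have V: "u \<in> V" "v \<in> V" using edge_in_V[OF uv] by auto
    obtain g where g: "g \<in> Aut V E" "g u = b" using transitive[OF V(1) b] by blast
    have "g v \<in> N" using Aut_edge[OF g(1), of v u] uv g(2) by (simp add: N_def insert_commute)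
    then have "w (g v) / w b \<le> (\<Sum>z\<in>N. w z / w b)" using pos N by (intro member_le_sum) auto
    then have "w v / w u \<le> r" using w_ratio_Aut[OF g(1) V] g(2) by (simp add: r_def)
    then show ?thesis using w_pos[OF V(1)] by (simp add: pos_divide_le_eq)
  qed
  moreover have "1 < r" using sum_nonneg[of N "\<lambda>z. w z / w b"] pos by (simp add: r_def)
  ultimately show ?thesis by blast
qed

text \<open>Quantifying over finite sets makes the event a countable intersection and lets an
  infinite top violate it, although \<open>card\<close> of an infinite set is 0. The factor
  \<open>r\<close> lets the vertices of one band of ratio \<open>r\<close> count one
  another.\<close>

definition top_bounded :: "real \<Rightarrow> nat \<Rightarrow> 'a \<Rightarrow> 'a set set \<Rightarrow> bool" where
  "top_bounded r m x X \<longleftrightarrow>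
    (\<forall>F\<in>{F. finite F \<and> F \<subseteq> V}. (\<forall>z\<in>F. z \<in> component X x \<and> w x < r * w z) \<longrightarrow> card F \<le> m)"

lemma ev_top_bounded: "ev (top_bounded r m x)"
  unfolding top_bounded_def[abs_def]
  by (intro ev_ball ev_imp ev_conj ev_const ev_component_UNIV countable_finite_subsets countable_V)
    (auto intro: countable_finite)

lemma w_less_Aut:
  "g \<in> Aut V E \<Longrightarrow> x \<in> V \<Longrightarrow> z \<in> V \<Longrightarrow> w (g x) < c * w (g z) \<longleftrightarrow> w x < c * w z"
  unfolding not_le[symmetric] using w_le_Aut[of g z x c] by simp

lemma top_bounded_Aut:
  assumes g: "g \<in> Aut V E" and x: "x \<in> V"
  shows "top_bounded r m (g x) ((`) g ` X) \<longleftrightarrow> top_bounded r m x X"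
proof -
  have inj: "inj g" using Aut_bij[OF g] by (simp add: bij_def)
  have img: "{F. finite F \<and> F \<subseteq> V} = (`) g ` {F. finite F \<and> F \<subseteq> V}"
  proof (intro set_eqI iffI)
    fix F assume F: "F \<in> {F. finite F \<and> F \<subseteq> V}"
    then have "inv g ` F \<subseteq> V" using Aut_V[OF Aut_inv[OF g]] by auto
    moreover have "F = g ` (inv g ` F)" using Aut_inv_apply(2)[OF g] by (simp add: image_image)
    ultimately show "F \<in> (`) g ` {F. finite F \<and> F \<subseteq> V}" using F by blast
  qed (use Aut_V[OF g] in auto)
  have ball: "(\<forall>F\<in>(`) g ` S. P F) \<longleftrightarrow> (\<forall>F\<in>S. P (g ` F))" for S P by blast
  have "top_bounded r m (g x) ((`) g ` X) \<longleftrightarrow> (\<forall>F\<in>{F. finite F \<and> F \<subseteq> V}.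
      (\<forall>z\<in>g ` F. z \<in> component ((`) g ` X) (g x) \<and> w (g x) < r * w z) \<longrightarrow> card (g ` F) \<le> m)"
    unfolding top_bounded_def by (subst img) (rule ball)
  also have "\<dots> \<longleftrightarrow> top_bounded r m x X"
    unfolding top_bounded_def
  proof (rule ball_cong[OF refl])
    fix F assume F: "F \<in> {F. finite F \<and> F \<subseteq> V}"
    have "w (g x) < r * w (g z) \<longleftrightarrow> w x < r * w z" if "z \<in> F" for z
      using w_less_Aut[OF g x, of z r] F that by auto
    then have "(\<forall>z\<in>g ` F. z \<in> component ((`) g ` X) (g x) \<and> w (g x) < r * w z) \<longleftrightarrow>
        (\<forall>z\<in>F. z \<in> component X x \<and> w x < r * w z)"
      using component_image[OF Aut_bij[OF g]] by auto
    moreover have "card (g ` F) = card F" using inj by (intro card_image) (auto intro: inj_on_subset)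
    ultimately show "((\<forall>z\<in>g ` F. z \<in> component ((`) g ` X) (g x) \<and> w (g x) < r * w z) \<longrightarrow> card (g ` F) \<le> m) \<longleftrightarrow>
        ((\<forall>z\<in>F. z \<in> component X x \<and> w x < r * w z) \<longrightarrow> card F \<le> m)" by simp
  qed
  finally show ?thesis .
qed

text \<open>Seen from the lower vertex \<open>y\<close>: the vertex \<open>x\<close> is in the band
  of relative heights from \<open>c\<close> to \<open>r * c\<close>, and the path to it never goes
  below \<open>y\<close>, so \<open>up c y\<close> occurs.\<close>

definition descends :: "real \<Rightarrow> nat \<Rightarrow> real \<Rightarrow> 'a \<Rightarrow> 'a \<Rightarrow> 'a set set \<Rightarrow> bool" where
  "descends r m c y x X \<longleftrightarrow> (c * w y \<le> w x \<and> w x < r * c * w y) \<and>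
    x \<in> component {e \<in> X. \<forall>u\<in>e. w y \<le> w u} y \<and> top_bounded r m x X"

lemma ev_descends: "ev (descends r m c y x)"
  unfolding descends_def[abs_def] by (intro ev_conj ev_const ev_component ev_top_bounded)

lemma pr_descends_Aut:
  assumes g: "g \<in> Aut V E" and "y \<in> V" "x \<in> V"
  shows "pr p (descends r m c (g y) (g x)) = pr p (descends r m c y x)"
proof (rule pr_Aut[OF g ev_descends])
  fix X assume X: "X \<subseteq> E"
  show "descends r m c (g y) (g x) ((`) g ` X) \<longleftrightarrow> descends r m c y x X"
    unfolding descends_def image_above[OF g assms(2) X] component_image[OF Aut_bij[OF g]]
      top_bounded_Aut[OF g assms(3)] w_le_Aut[OF g assms(2,3)] w_less_Aut[OF g assms(3,2)] ..
qed

text \<open>Mass transport: if each vertex \<open>y\<close> sends mass to the vertices at relative height about \<open>c\<close> to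
  which it is connected from below, then it sends at most \<open>m\<close> in total, and only when it is
  connected to height \<open>c\<close>.\<close>

lemma sum_descends_le:
  assumes x: "x \<in> V" and r: "0 \<le> r" and c: "0 < c" and up: "c * pr p (up c x) \<le> 1"
  shows "(\<integral>\<^sup>+y. ennreal (pr p (descends r m c y x)) \<partial>count_space V) \<le> ennreal (r * m)"
proof -
  let ?f = "\<lambda>y x. ennreal (pr p (descends r m c y x))"
  have "(\<integral>\<^sup>+y. ?f y x \<partial>count_space V) = (\<integral>\<^sup>+z. ?f x z * ennreal (w z / w x) \<partial>count_space V)"
    using pr_descends_Aut by (intro mass_transport x) simp
  also have "\<dots> \<le> (\<integral>\<^sup>+z. ennreal (r * c) * ?f x z \<partial>count_space V)"
  proof (rule nn_integral_mono)
    fix z assume "z \<in> space (count_space V)"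
    \<comment> \<open>Inside the band the weight ratio is at most \<open>r * c\<close>; outside it
      nothing is sent.\<close>
    show "?f x z * ennreal (w z / w x) \<le> ennreal (r * c) * ?f x z"
    proof (cases "w z < r * c * w x")
      case True
      then have "ennreal (w z / w x) \<le> ennreal (r * c)"
        using w_pos[OF x] by (intro ennreal_leI) (simp add: pos_divide_le_eq)
      then show ?thesis by (subst mult.commute) (rule mult_right_mono, auto)
    next
      case False
      then have "descends r m c x z = (\<lambda>X. False)" by (simp add: descends_def fun_eq_iff)
      then show ?thesis by (simp add: pr_def event_def)
    qed
  qed
  also have "\<dots> = ennreal (r * c) * (\<integral>\<^sup>+z. ?f x z \<partial>count_space V)"
    by (rule nn_integral_cmult) simp
  also have "\<dots> \<le> ennreal (r * c) * ennreal (real m * pr p (up c x))"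
  proof (intro mult_left_mono nn_integral_pr_le countable_V ev_descends ev_up)
    show "up c x X" if "z \<in> V" "descends r m c x z X" for z X
      using that by (auto simp: descends_def up_def)
  next
    fix X F assume X: "X \<subseteq> E" and F: "finite F" "F \<subseteq> {z \<in> V. descends r m c x z X}"
    show "card F \<le> m"
    proof (cases "F = {}")
      case False
      then obtain z0 where "z0 \<in> F" by blast
      then have z0: "descends r m c x z0 X" using F by auto
      have comp: "z \<in> component X x" if "descends r m c x z X" for z
        using that component_mono[of z "{e \<in> X. \<forall>u\<in>e. w x \<le> w u}" x X] by (auto simp: descends_def)
      \<comment> \<open>Recipients lie in one cluster and one band, so their weights differ by a
        factor less than \<open>r\<close>, and all of \<open>F\<close> belongs to the top counted at
        \<open>z0\<close>.\<close>
      have "z \<in> component X z0 \<and> w z0 < r * w z" if "z \<in> F" for z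
      proof
        have z: "descends r m c x z X" using that F by auto
        show "z \<in> component X z0"
          using component_trans[OF component_sym[OF comp[OF z0]] comp[OF z]] .
        have "w z0 < r * (c * w x)" using z0 by (simp add: descends_def mult.assoc)
        also have "\<dots> \<le> r * w z" using z r by (intro mult_left_mono) (auto simp: descends_def)
        finally show "w z0 < r * w z" .
      qed
      moreover have "top_bounded r m z0 X" using z0 by (simp add: descends_def)
      ultimately show ?thesis using F unfolding top_bounded_def by blast
    qed simp
  qed simp
  \<comment> \<open>The factor \<open>c\<close> from the weights meets the bound on
    \<open>c * pr p (up c x)\<close>, so the result no longer depends on \<open>c\<close>.\<close>
  also have "\<dots> = ennreal (r * m * (c * pr p (up c x)))"
    using r c by (subst ennreal_mult[symmetric]) (auto simp: ac_simps)
  also have "\<dots> \<le> ennreal (r * m)"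
    using r up by (intro ennreal_leI mult_left_le) auto
  finally show ?thesis .
qed

definition higher :: "'a \<Rightarrow> real \<Rightarrow> 'a set" where
  "higher x c = {u. w x < c * w u}"

text \<open>An exit is one edge away from a vertex of weight more than \<open>w x / c\<close>, hence
  has weight more than \<open>w x / (r * c)\<close> and at most \<open>w x / c\<close>. The
  exploration path, read backwards, stays above it.\<close>

lemma exits_descends:
  assumes x: "x \<in> V" and X: "X \<subseteq> E" and c: "1 < c"
    and ratio: "\<And>u v. {u, v} \<in> E \<Longrightarrow> w v \<le> r * w u"
    and y: "y \<in> exits (higher x c) x X" and top: "top_bounded r m x X"
  shows "descends r m c y x X"
proof -
  have xW: "x \<in> higher x c" using c w_pos[OF x] by (simp add: higher_def)
  obtain u where u: "y \<notin> higher x c" "u \<in> inner (higher x c) x X" "{u, y} \<in> X"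
    using y by (auto simp: exits_def)
  have uW: "w x < c * w u" using inner_subset[OF xW] u(2) by (auto simp: higher_def)
  have cy: "c * w y \<le> w x" using u(1) by (simp add: higher_def)
  have above: "w y < w v" if "v \<in> higher x c" for v
  proof -
    have "c * w y < c * w v" using that cy by (simp add: higher_def)
    then show ?thesis using c by simp
  qed
  have "w u \<le> r * w y" using ratio[of y u] u(3) X by (auto simp: insert_commute)
  then have "c * w u \<le> c * (r * w y)" using c by (intro mult_left_mono) auto
  then have "w x < r * c * w y" using uW by (simp add: ac_simps)
  moreover have "x \<in> component {e \<in> X. \<forall>u\<in>e. w y \<le> w u} y"
  proof (rule component_sym)
    have "u \<in> component {e \<in> X. \<forall>u\<in>e. w y \<le> w u} x"
      using u(2) unfolding inner_def
      by (rule component_mono) (use above in \<open>auto intro: less_imp_le\<close>)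
    then show "y \<in> component {e \<in> X. \<forall>u\<in>e. w y \<le> w u} x"
      by (rule component_edge) (use u inner_subset[OF xW] above in \<open>auto intro: less_imp_le\<close>)
  qed
  ultimately show ?thesis using cy top by (simp add: descends_def)
qed

text \<open>Markov's inequality for the number of \<open>y\<close> with
  \<open>descends r m c y x\<close>, among which are all exits.\<close>

lemma pr_many_exits_le:
  assumes x: "x \<in> V" and c: "1 < c" and r: "0 \<le> r" and up: "c * pr p (up c x) \<le> 1"
    and ratio: "\<And>u v. {u, v} \<in> E \<Longrightarrow> w v \<le> r * w u"
  shows "real (Suc M) * pr p (\<lambda>X. (escapes (higher x c) x X \<and> \<not> card (exits (higher x c) x X) \<le> M) \<and>
    top_bounded r m x X) \<le> r * m"
proof -
  let ?R = "\<lambda>X. (escapes (higher x c) x X \<and> \<not> card (exits (higher x c) x X) \<le> M) \<and> top_bounded r m x X"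
  have xW: "x \<in> higher x c" using c w_pos[OF x] by (simp add: higher_def)
  have "ennreal (real (Suc M) * pr p ?R) \<le> (\<integral>\<^sup>+y. ennreal (pr p (descends r m c y x)) \<partial>count_space V)"
  proof (rule mult_pr_le_nn_integral[OF countable_V ev_descends])
    show "ev ?R" using ev_escapes(3)[OF x xW] ev_top_bounded by (rule ev_conj)
    fix X assume X: "X \<subseteq> E" and R: "?R X"
    let ?F = "exits (higher x c) x X"
    have "?F \<subseteq> {y \<in> V. descends r m c y x X}"
      using exits_descends[OF x X c ratio] R exits_subset_component[of "higher x c" x X]
        component_subset_V[OF x X] by auto
    moreover have "finite ?F" using R X by (auto simp: escapes_def intro: finite_exits)
    moreover have "Suc M \<le> card ?F" using R by simp
    ultimately show "\<exists>F. finite F \<and> F \<subseteq> {y \<in> V. descends r m c y x X} \<and> Suc M \<le> card F" by blast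
  qed
  also have "\<dots> \<le> ennreal (r * m)" using c by (intro sum_descends_le[OF x r _ up]) auto
  finally show ?thesis using r by (subst (asm) ennreal_le_iff) auto
qed

text \<open>\<open>higher x c\<close> is contained in \<open>higher x d\<close> on \<open>V\<close>:
  an exit from the larger region lies outside the smaller one as well, and the smaller inner cluster
  is part of a finite one.\<close>

lemma escapes_antimono:
  assumes x: "x \<in> V" and X: "X \<subseteq> E" and c: "1 < c" "c \<le> d" and esc: "escapes (higher x d) x X"
  shows "escapes (higher x c) x X"
proof -
  have xW: "x \<in> higher x c" using c w_pos[OF x] by (simp add: higher_def)
  obtain v where v: "v \<in> exits (higher x d) x X" using esc by (auto simp: escapes_def)
  then have vX: "v \<in> component X x" "v \<notin> higher x d"
    using exits_subset_component[of "higher x d" x X] by (auto simp: exits_def)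
  have mono: "u \<in> higher x d" if "u \<in> V" "u \<in> higher x c" for u
  proof -
    have "c * w u \<le> d * w u" using c w_pos[OF that(1)] by (intro mult_right_mono) auto
    then show ?thesis using that(2) by (simp add: higher_def)
  qed
  then have "v \<notin> higher x c" using vX component_subset_V[OF x X] by blast
  then have "exits (higher x c) x X \<noteq> {}" using exits_nonempty[OF xW vX(1)] by blast
  moreover have "inner (higher x c) x X \<subseteq> inner (higher x d) x X"
    unfolding inner_def
  proof
    fix z assume "z \<in> component {e \<in> X. e \<subseteq> higher x c} x"
    then show "z \<in> component {e \<in> X. e \<subseteq> higher x d} x"
    proof (rule component_mono)
      show "{e \<in> X. e \<subseteq> higher x c} \<subseteq> {e \<in> X. e \<subseteq> higher x d}"
      proof clarify
        fix e u assume "e \<in> X" "e \<subseteq> higher x c" "u \<in> e"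
        then show "u \<in> higher x d" using mono[of u] X edge_subset_V[of e] by blast
      qed
    qed
  qed
  then have "finite (inner (higher x c) x X)"
    using esc unfolding escapes_def by (meson finite_subset)
  ultimately show ?thesis by (simp add: escapes_def)
qed

text \<open>With at most \<open>M\<close> exits, the cluster stops with conditional probability bounded below, so the
  probability of having between 1 and \<open>M\<close> exits tends to 0, whereas by mass transport the expected
  number of exits is bounded when the top of the cluster is.\<close>

lemma pr_escapes_always:
  assumes x: "x \<in> V" and p: "0 \<le> p" "p < 1" and r: "1 < r"
    and ratio: "\<And>u v. {u, v} \<in> E \<Longrightarrow> w v \<le> r * w u"
    and up: "\<And>c. 1 < c \<Longrightarrow> c * pr p (up c x) \<le> 1"
  shows "pr p (\<lambda>X. (\<forall>n. escapes (higher x (r ^ Suc n)) x X) \<and> top_bounded r m x X) = 0"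
proof -
  \<comment> \<open>The exponent starts at 1, so that the level exceeds 1 and \<open>x\<close>
    belongs to its own region.\<close>
  define Z where "Z n = escapes (higher x (r ^ Suc n)) x" for n
  have c: "1 < r ^ Suc n" for n using r by (simp add: one_less_power del: power_Suc)
  have xW: "x \<in> higher x (r ^ Suc n)" for n using c[of n] w_pos[OF x] by (simp add: higher_def)
  have evZ: "ev (Z n)" for n unfolding Z_def using ev_escapes(1)[OF x xW] .
  have dec: "Z (Suc n) X \<Longrightarrow> Z n X" if "X \<subseteq> E" for n X
    unfolding Z_def using r by (intro escapes_antimono[OF x that c, of n "r ^ Suc (Suc n)"]) auto
  obtain d where d: "\<And>v. v \<in> V \<Longrightarrow> card {e \<in> E. v \<in> e} \<le> d" using degree_bound by blast
  let ?A = "pr p (\<lambda>X. (\<forall>n. Z n X) \<and> top_bounded r m x X)"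
  \<comment> \<open>Decreasing probabilities converge, so stopping between two consecutive levels
    has probability tending to 0.\<close>
  have lim: "(\<lambda>n. pr p (Z n) - pr p (Z (Suc n))) \<longlonglongrightarrow> 0"
  proof -
    have "(\<lambda>n. pr p (Z n)) \<longlonglongrightarrow> pr p (\<lambda>X. \<forall>n. Z n X)" using evZ dec by (rule pr_decseq)
    from tendsto_diff[OF this LIMSEQ_Suc[OF this]] show ?thesis by simp
  qed
  have main: "?A \<le> r * m / real (Suc M)" for M
  proof -
    define \<delta> where "\<delta> = (1 - p) ^ (d * M)"
    have \<delta>: "0 < \<delta>" using p by (simp add: \<delta>_def)
    \<comment> \<open>Few exits make stopping likely, many exits are rare by Markov. First
      \<open>n\<close> grows with \<open>M\<close> fixed, removing the first term; afterwards
      \<open>M\<close> grows.\<close>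
    have bound: "?A \<le> (pr p (Z n) - pr p (Z (Suc n))) / \<delta> + r * m / real (Suc M)" for n
    proof -
      let ?W = "higher x (r ^ Suc n)"
      let ?few = "\<lambda>X. escapes ?W x X \<and> card (exits ?W x X) \<le> M"
      let ?many = "\<lambda>X. (escapes ?W x X \<and> \<not> card (exits ?W x X) \<le> M) \<and> top_bounded r m x X"
      let ?stop = "\<lambda>X. escapes ?W x X \<and> component X x \<subseteq> inner ?W x X \<union> exits ?W x X"
      have ev_few: "ev ?few" by (rule ev_escapes(2)[OF x xW])
      have ev_many: "ev ?many" by (rule ev_conj[OF ev_escapes(3)[OF x xW] ev_top_bounded])
      have "?A \<le> pr p (\<lambda>X. ?few X \<or> ?many X)"
        by (rule pr_mono[OF ev_disj[OF ev_few ev_many]]) (auto simp: Z_def)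
      also have "\<dots> \<le> pr p ?few + pr p ?many" using ev_few ev_many by (rule pr_disj_le)
      also have "pr p ?many \<le> r * m / real (Suc M)"
        using pr_many_exits_le[OF x c[of n] _ up[OF c[of n]] ratio, of M m] r
        by (simp add: pos_le_divide_eq mult.commute del: power_Suc of_nat_Suc)
      also have "pr p ?few \<le> (pr p (Z n) - pr p (Z (Suc n))) / \<delta>"
      proof -
        have "\<delta> * pr p ?few \<le> pr p ?stop"
          unfolding \<delta>_def using p d by (intro pr_stop_at_exits[OF x xW]) auto
        also have "\<dots> \<le> pr p (\<lambda>X. Z n X \<and> \<not> Z (Suc n) X)"
        proof (rule pr_mono[OF ev_conj[OF evZ ev_not[OF evZ]]])
          fix X assume X: "X \<subseteq> E" and stop: "?stop X"
          \<comment> \<open>A stopped cluster consists of the inner part and exits one edge away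
            from it. Since consecutive levels have ratio \<open>r\<close>, none of its vertices lies
            outside the next region.\<close>
          have "\<not> Z (Suc n) X"
          proof
            assume "Z (Suc n) X"
            then obtain v where v: "v \<in> exits (higher x (r ^ Suc (Suc n))) x X"
              by (auto simp: Z_def escapes_def)
            then have low: "r ^ Suc (Suc n) * w v \<le> w x" by (simp add: exits_def higher_def)
            have comp: "v \<in> component X x" using v exits_subset_component by blast
            then have vV: "v \<in> V" using component_subset_V[OF x X] by blast
            from comp stop consider "v \<in> inner ?W x X" | "v \<in> exits ?W x X" by blast
            then show False
            proof cases
              case 1
              then have "w x < r ^ Suc n * w v" using inner_subset[OF xW] by (auto simp: higher_def)
              also have "\<dots> \<le> r ^ Suc (Suc n) * w v"
                using r w_pos[OF vV] by (intro mult_right_mono power_increasing) auto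
              finally show False using low by simp
            next
              case 2
              then obtain u where u: "u \<in> inner ?W x X" "{u, v} \<in> X" by (auto simp: exits_def)
              then have "w x < r ^ Suc n * w u" using inner_subset[OF xW] by (auto simp: higher_def)
              also have "\<dots> \<le> r ^ Suc n * (r * w v)"
                using r ratio[of v u] u(2) X by (intro mult_left_mono) (auto simp: insert_commute)
              finally show False using low by (simp add: ac_simps)
            qed
          qed
          then show "Z n X \<and> \<not> Z (Suc n) X" using stop by (simp add: Z_def)
        qed
        also have "\<dots> = pr p (Z n) - pr p (Z (Suc n))"
        proof -
          have "pr p (Z n) = pr p (\<lambda>X. (Z n X \<and> \<not> Z (Suc n) X) \<or> Z (Suc n) X)"
            using dec by (intro pr_cong) auto
          also have "\<dots> = pr p (\<lambda>X. Z n X \<and> \<not> Z (Suc n) X) + pr p (Z (Suc n))"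
            by (intro pr_disj ev_conj ev_not evZ) auto
          finally show ?thesis by simp
        qed
        finally show ?thesis using \<delta> by (simp add: pos_le_divide_eq mult.commute)
      qed
      finally show ?thesis by simp
    qed
    have "(\<lambda>n. (pr p (Z n) - pr p (Z (Suc n))) / \<delta> + r * m / real (Suc M)) \<longlonglongrightarrow> 0 / \<delta> + r * m / real (Suc M)"
      using \<delta> by (intro tendsto_intros lim) auto
    then have "?A \<le> 0 / \<delta> + r * m / real (Suc M)"
      by (rule LIMSEQ_le_const) (use bound in auto)
    then show ?thesis by simp
  qed
  have "(\<lambda>M. r * m / real (Suc M)) \<longlonglongrightarrow> 0" by (rule LIMSEQ_Suc[OF lim_const_over_n])
  then have "?A \<le> 0" by (rule LIMSEQ_le_const) (use main in auto)
  then have "?A = 0" using pr_nonneg by (rule antisym)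
  then show ?thesis unfolding Z_def .
qed

text \<open>Infinitely many terms above a positive constant have an infinite sum.\<close>

lemma light_finite:
  assumes "C \<subseteq> V" "light V E a C" "0 < \<epsilon>"
  shows "finite {v \<in> C. \<epsilon> < w v}"
proof (rule ccontr)
  let ?S = "{v \<in> C. \<epsilon> < w v}"
  assume inf: "infinite ?S"
  have "(\<Sum>\<^sub>\<infinity>v\<in>?S. ennreal (w v)) = \<infinity>"
    by (rule infsum_superconst_infinite_ennreal[of _ "ennreal \<epsilon>"])
      (use inf assms(3) in \<open>auto intro!: ennreal_leI\<close>)
  moreover have "(\<Sum>\<^sub>\<infinity>v\<in>?S. ennreal (w v)) \<le> (\<Sum>\<^sub>\<infinity>v\<in>C. ennreal (w v))"
    by (rule infsum_mono_neutral) (auto intro: nonneg_summable_on_complete)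
  ultimately have "heavy V E a C" by (simp add: heavy_def w_def top_unique)
  then show False using assms(2) by simp
qed

text \<open>Lightness leaves finitely many cluster vertices in each region
  \<open>higher x c\<close>, so an infinite cluster must exit it after a finite inner part. The
  number of cluster vertices above \<open>w x / r\<close> serves as \<open>m\<close>.\<close>

lemma infinite_light_cluster:
  assumes x: "x \<in> V" and X: "X \<subseteq> E" and r: "1 < r"
    and inf: "infinite (component X x)" and light: "light V E a (component X x)"
  shows "\<exists>m. (\<forall>n. escapes (higher x (r ^ Suc n)) x X) \<and> top_bounded r m x X"
proof -
  have sub: "component X x \<subseteq> V" using component_subset_V[OF x X] .
  have fin: "finite {v \<in> component X x. w x < c * w v}" if "0 < c" for c
  proof -
    have "{v \<in> component X x. w x < c * w v} = {v \<in> component X x. w x / c < w v}"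
      using that by (auto simp: pos_divide_less_eq mult.commute)
    then show ?thesis using light_finite[OF sub light, of "w x / c"] w_pos[OF x] that by simp
  qed
  have "escapes (higher x c) x X" if c: "1 < c" for c
  proof -
    have xW: "x \<in> higher x c" using c w_pos[OF x] by (simp add: higher_def)
    have fin': "finite (component X x \<inter> higher x c)"
      using fin[of c] c by (simp add: higher_def Int_def)
    then have "\<not> component X x \<subseteq> component X x \<inter> higher x c" using inf finite_subset by blast
    then have "exits (higher x c) x X \<noteq> {}" using exits_nonempty[OF xW] by blast
    moreover have "inner (higher x c) x X \<subseteq> component X x \<inter> higher x c"
      using inner_subset[OF xW] inner_subset_component by blast
    then have "finite (inner (higher x c) x X)" using fin' by (rule finite_subset)
    ultimately show ?thesis by (simp add: escapes_def)
  qed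
  then have "\<forall>n. escapes (higher x (r ^ Suc n)) x X"
    using r by (simp add: one_less_power del: power_Suc)
  moreover have "top_bounded r (card {v \<in> component X x. w x < r * w v}) x X"
    unfolding top_bounded_def using fin[of r] r by (auto intro!: card_mono)
  ultimately show ?thesis by blast
qed

text \<open>Two vertices of different weight exist, so by transitivity every vertex has a strictly
  heavier one. Were \<open>V\<close> light, only finitely many vertices would exceed a given
  positive weight, and one of them would be heaviest.\<close>

lemma heavy_V:
  assumes "\<not> unimodular V E"
  shows "heavy V E a V"
proof (rule ccontr)
  assume light: "\<not> heavy V E a V"
  obtain x y where xy: "x \<in> V" "y \<in> V" "orbit_card x y \<noteq> orbit_card y x"
    using assms by (auto simp: unimodular_def orbit_card_def)
  then have "w y / w x \<noteq> 1"
    using w_ratio[OF xy(1,2)] orbit_card_pos[OF xy(1,2)] by simp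
  then have "w x < w y \<or> w y < w x" using w_pos[OF xy(1)] by auto
  then obtain s t where st: "s \<in> V" "t \<in> V" "w s < w t" using xy by blast
  have grow: "\<exists>v\<in>V. w u < w v" if u: "u \<in> V" for u
  proof -
    obtain g where g: "g \<in> Aut V E" "g s = u" using transitive[OF st(1) u] by blast
    then have "w u < w (g t)" using w_less_Aut[OF g(1) st(1,2), of 1] st(3) by simp
    then show ?thesis using Aut_V[OF g(1)] st(2) by blast
  qed
  \<comment> \<open>The threshold is positive, so the set is finite, and below \<open>w a\<close>,
    so the set contains \<open>a\<close>.\<close>
  let ?S = "{v \<in> V. w a / 2 < w v}"
  have fin: "finite ?S" using light_finite[OF subset_refl light, of "w a / 2"] w_pos[OF a_in_V] by simp
  have "a \<in> ?S" using w_pos[OF a_in_V] a_in_V by simp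
  then have "Max (w ` ?S) \<in> w ` ?S" using fin by (intro Max_in) auto
  then obtain u where u: "u \<in> ?S" "Max (w ` ?S) = w u" by blast
  have max: "w v \<le> w u" if "v \<in> ?S" for v
    unfolding u(2)[symmetric] using fin that by (intro Max_ge) auto
  obtain v where v: "v \<in> V" "w u < w v" using grow u(1) by blast
  then show False using u(1) max[of v] by auto
qed

lemma AE_event:
  assumes "ev Q" "pr p Q = 0"
  shows "AE \<omega> in bond_percolation E p. \<not> Q (open_edges E \<omega>)"
proof -
  have "event Q \<in> null_sets (bond_percolation E p)"
    using assms ev_sets emeasure_event[of p Q] by (intro null_setsI) auto
  then have "AE \<omega> in bond_percolation E p. \<omega> \<notin> event Q" by (rule AE_not_in)
  then show ?thesis by (rule AE_mp) (auto simp: event_eq[of _ p])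
qed

theorem no_infinite_light_clusters:
  assumes "\<not> unimodular V E" and x: "x \<in> V"
  shows "AE \<omega> in bond_percolation E (critical_probability E x).
    \<not> (\<exists>C\<in>clusters V E \<omega>. infinite C \<and> light V E a C)"
proof (cases "critical_probability E x = 1")
  case True
  \<comment> \<open>At parameter 1 all edges are almost surely open, and the only cluster is
    \<open>V\<close>, which is heavy.\<close>
  have ev: "ev (\<lambda>X. X \<noteq> E)"
  proof -
    have "ev (\<lambda>X. \<exists>e\<in>E. e \<notin> X)" by (intro ev_bex countable_E ev_not ev_mem)
    also have "?this \<longleftrightarrow> ev (\<lambda>X. X \<noteq> E)" by (rule ev_cong) auto
    finally show ?thesis .
  qed
  have "pr 1 (\<lambda>X. X \<noteq> E) = 0" using pr_not[OF ev, of 1] pr_1_all_open by simp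
  then have "AE \<omega> in bond_percolation E 1. \<not> open_edges E \<omega> \<noteq> E" by (rule AE_event[OF ev])
  then show ?thesis
    unfolding True
  proof (rule AE_mp, intro AE_I2 impI notI)
    fix \<omega> assume "\<not> open_edges E \<omega> \<noteq> E" "\<exists>C\<in>clusters V E \<omega>. infinite C \<and> light V E a C"
    then show False using heavy_V[OF assms(1)] component_E by (auto simp: clusters_def cluster_def)
  qed
next
  case False
  let ?p = "critical_probability E x"
  have p: "0 \<le> ?p" "?p < 1"
    using critical_probability_nonneg[OF x] critical_probability_le_1[OF x] False by auto
  obtain r where r: "1 < r" "\<And>u v. {u, v} \<in> E \<Longrightarrow> w v \<le> r * w u" using exists_ratio_bound by blast
  let ?Q = "\<lambda>y m X. (\<forall>n. escapes (higher y (r ^ Suc n)) y X) \<and> top_bounded r m y X"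
  \<comment> \<open>There are countably many pairs \<open>(y, m)\<close>, so one null set covers the
    clusters of all vertices and all bounds on their tops.\<close>
  have "AE \<omega> in bond_percolation E ?p. \<not> ?Q y m (open_edges E \<omega>)" if y: "y \<in> V" for y m
  proof (rule AE_event)
    have "1 < r ^ Suc n" for n using r by (simp add: one_less_power del: power_Suc)
    then have "y \<in> higher y (r ^ Suc n)" for n
      using w_pos[OF y] mult_strict_right_mono[of 1 "r ^ Suc n" "w y"] unfolding higher_def by simp
    then show "ev (?Q y m)" by (intro ev_conj ev_all ev_escapes(1) y ev_top_bounded)
    show "pr ?p (?Q y m) = 0"
    proof (rule pr_escapes_always[OF y p r])
      \<comment> \<open>The critical probability is taken at \<open>x\<close>; transitivity carries
        the bound to \<open>y\<close>.\<close>
      fix c :: real assume "1 < c"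
      then show "c * pr ?p (up c y) \<le> 1"
        using pr_up_critical[OF x, of c] pr_up_transitive[OF y x] by simp
    qed
  qed
  then have "AE \<omega> in bond_percolation E ?p. \<forall>y\<in>V. \<forall>m. \<not> ?Q y m (open_edges E \<omega>)"
    unfolding AE_ball_countable[OF countable_V] AE_all_countable by blast
  then show ?thesis
  proof (rule AE_mp, intro AE_I2 impI notI)
    fix \<omega> assume *: "\<forall>y\<in>V. \<forall>m. \<not> ?Q y m (open_edges E \<omega>)"
      and "\<exists>C\<in>clusters V E \<omega>. infinite C \<and> light V E a C"
    then obtain y where y: "y \<in> V" "infinite (component (open_edges E \<omega>) y)"
        "light V E a (component (open_edges E \<omega>) y)"
      by (auto simp: clusters_def cluster_def)
    have "open_edges E \<omega> \<subseteq> E" by (auto simp: open_edges_def)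
    then show False using infinite_light_cluster[OF y(1) _ r(1) y(2,3)] * y(1) by blast
  qed
qed

end

theorem theorem4p3:
  fixes V :: "'a set" and E :: "'a set set" and a x :: 'a
  assumes "transitive_graph V E"
    and "\<not> unimodular V E"
    and "a \<in> V" and "x \<in> V"
  shows "AE \<omega> in bond_percolation E (critical_probability E x).
           \<not> (\<exists>C\<in>clusters V E \<omega>. infinite C \<and> light V E a C)"
proof -
  interpret weighted_graph V E a
    using assms by (simp add: weighted_graph_def weighted_graph_axioms_def)
  show ?thesis using assms(2,4) by (rule no_infinite_light_clusters)
qed

end
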